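(* Let $T>0$, let $u_0\in\mathcal H^1(\mathbb T^2)\cap W^{1,\infty}(\mathbb T^2)$, and for $\varepsilon>0$ let $u_\varepsilon$ be the mild solution on $[0,T]$ of $$\partial_t u_\varepsilon=-\Delta^2u_\varepsilon-\nabla\cdot f(\nabla u_\varepsilon)+\partial_tW_\varepsilon,\qquad u_\varepsilon(0)=u_0,\qquad f(y)=\frac{y}{1+|y|^2}\ \ (y\in\mathbb R^2).$$ Then for each $p\ge1$ and $t\in(0,T]$, $$\sup_{x\in\mathbb T^2}\mathbb E\left[\left|f\left(\nabla u_\varepsilon(t,x)\right)\right|^p\right]\to0\qquad\text{as }\varepsilon\to0.$$
   Context: Fix $L>0$ and let $\mathbb{T}^2=[0,L]^2$ with periodic boundary conditions. All functions have zero spatial mean. Let $\mathcal{Z}=\mathbb{Z}^2\setminus\{0\}$ and $e_k(x)=\omega_{k_1}(x_1)\omega_{k_2}(x_2)$ for $k=(k_1,k_2)\in\mathbb Z^2$, where $\omega_j(z)=\sqrt{2/L}\,\sin(2\pi jz/L)$ for $j>0$, $\omega_0(z)=1/\sqrt L$, and $\omega_j(z)=\sqrt{2/L}\,\cos(2\pi jz/L)$ for $j<0$; this is an orthonormal basis of $L^2([0,L]^2)$. Let $\mu_k=(2\pi|k|/L)^2$, so $-\Delta e_k=\mu_ke_k$. For $\alpha\in\mathbb R$, $\mathcal{H}^\alpha=\mathcal H^\alpha(\mathbb T^2)$ is the space of (formal) series $u=\sum_{k\in\mathcal Z}u_ke_k$ with $\|u\|_{\mathcal H^\alpha}^2=\sum_{k\in\mathcal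 Z}\mu_k^\alpha u_k^2<\infty$. Let $A=-\Delta^2$ and $e^{tA}\sum_{k\in\mathcal Z}u_ke_k=\sum_{k\in\mathcal Z}e^{-t\mu_k^2}u_ke_k$. Noise: $(\beta_k)_{k\in\mathcal Z}$ are i.i.d. real-valued Wiener processes on a probability space $(\Omega,\mathbb P)$. The regularization coefficients $(\alpha_k^{(\varepsilon)})_{k\in\mathcal Z}$, $\varepsilon>0$, are real and satisfy: (i) $\sup_{\varepsilon>0}\sup_{k\in\mathcal Z}|\alpha_k^{(\varepsilon)}|<\infty$; (ii) for every $\varepsilon>0$ there are $\delta(\varepsilon)>0$, $C_\varepsilon>0$ with $|\alpha_k^{(\varepsilon)}|\le C_\varepsilon|k|^{-\delta(\varepsilon)}$ for all $k\in\mathcal Z$; (iii) $\alpha_k^{(\varepsilon)}\to1$ as $\varepsilon\to0$ for each fixed $k$; (iv) for every $\varepsilon>0$ there is $a_\varepsilon:[0,\infty)\to\mathbb R$ with $\alpha_k^{(\varepsilon)}=a_\varepsilon(|k|)$ for all $k\in\mathcal Z$. Set $W_\varepsilon(t)=\sum_{k\in\mathcal Z}\alpha_k^{(\varepsilon)}\beta_k(t)e_k$ and $Z_\varepsilon(t,x)=\sum_{k\in\mathcal Z}\alpha_k^{(\varepsilon)}\int_0^te^{-(t-s)\mu_k^2}\,d\beta_k(s)\,e_k(x)$. Mild solution with $u_0\in\mathcal H^1$: a process $(u_\varepsilon(t))_{t\in[0,T]}$ with continuous paths in $\mathcal H^1$ such that for all $t\in[0,T]$, $u_\varepsilon(t)=e^{tA}u_0+\int_0^te^{(t-s)A}\mathfrak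 F(u_\varepsilon(s))\,ds+Z_\varepsilon(t)$, where $\mathfrak F(u)=-\nabla\cdot f(\nabla u)$. *)

theory Defs
  imports "HOL-Probability.Probability"
begin

section \<open>Fourier basis of the torus\<close>

type_synonym freq = "int \<times> int"

definition freqs :: "freq set" where
  "freqs = UNIV - {(0, 0)}"

definition fabs :: "freq \<Rightarrow> real" where
  "fabs k = sqrt (real_of_int (fst k) ^ 2 + real_of_int (snd k) ^ 2)"

text \<open>Functions on the torus of side \<open>L\<close> are \<open>L\<close>-periodic functions on the plane; integrals over
  the torus are integrals over \<open>cell L\<close>.\<close>

definition cell :: "real \<Rightarrow> (real ^ 2) set" where
  "cell L = cbox 0 (vec L)"

definition periodic :: "real \<Rightarrow> (real ^ 2 \<Rightarrow> 'b) \<Rightarrow> bool" where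
  "periodic L w \<longleftrightarrow> (\<forall>x i. w (x + axis i L) = w x)"

definition omega :: "real \<Rightarrow> int \<Rightarrow> real \<Rightarrow> real" where
  "omega L j z =
     (if j > 0 then sqrt (2 / L) * sin (2 * pi * of_int j * z / L)
      else if j = 0 then 1 / sqrt L
      else sqrt (2 / L) * cos (2 * pi * of_int j * z / L))"

definition e :: "real \<Rightarrow> freq \<Rightarrow> real ^ 2 \<Rightarrow> real" where
  "e L k x = omega L (fst k) (x $ 1) * omega L (snd k) (x $ 2)"

definition mu :: "real \<Rightarrow> freq \<Rightarrow> real" where
  "mu L k = (2 * pi * fabs k / L) ^ 2"

definition grad :: "(real ^ 2 \<Rightarrow> real) \<Rightarrow> real ^ 2 \<Rightarrow> real ^ 2" where
  "grad w x = (THE D. GDERIV w x :> D)"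

section \<open>Formal series\<close>

text \<open>A formal series \<open>\<Sum>k\<in>freqs. c k *\<^sub>R e L k\<close> is given by its coefficients \<open>c\<close>;
  the value \<open>c (0, 0)\<close> is never used.\<close>

type_synonym series = "freq \<Rightarrow> real"

definition in_H :: "real \<Rightarrow> real \<Rightarrow> series \<Rightarrow> bool" where
  "in_H L a c \<longleftrightarrow> (\<lambda>k. mu L k powr a * (c k)\<^sup>2) summable_on freqs"

definition norm_H :: "real \<Rightarrow> real \<Rightarrow> series \<Rightarrow> real" where
  "norm_H L a c = sqrt (\<Sum>\<^sub>\<infinity>k\<in>freqs. mu L k powr a * (c k)\<^sup>2)"

text \<open>Convergence of \<open>\<Sum>k\<in>freqs. F k\<close> to \<open>w\<close> in \<open>L\<^sup>2\<close> of the torus.\<close>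

definition L2_sums ::
  "real \<Rightarrow> (freq \<Rightarrow> real ^ 2 \<Rightarrow> 'b :: {real_normed_vector, second_countable_topology})
     \<Rightarrow> (real ^ 2 \<Rightarrow> 'b) \<Rightarrow> bool" where
  "L2_sums L F w \<longleftrightarrow> w \<in> borel_measurable borel \<and>
     ((\<lambda>K. \<integral>\<^sup>+ x \<in> cell L. ennreal ((norm ((\<Sum>k\<in>K. F k x) - w x))\<^sup>2) \<partial>lborel) \<longlongrightarrow> 0)
       (finite_subsets_at_top freqs)"

definition series_fun :: "real \<Rightarrow> series \<Rightarrow> (real ^ 2 \<Rightarrow> real) \<Rightarrow> bool" where
  "series_fun L c w \<longleftrightarrow> L2_sums L (\<lambda>k x. c k * e L k x) w"

definition series_grad :: "real \<Rightarrow> series \<Rightarrow> (real ^ 2 \<Rightarrow> real ^ 2) \<Rightarrow> bool" where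
  "series_grad L c G \<longleftrightarrow> L2_sums L (\<lambda>k x. c k *\<^sub>R grad (e L k) x) G"

text \<open>The gradient of an element of \<open>H\<^sup>1\<close>, as an \<open>L\<^sup>2\<close> vector field; unique only up to null sets.\<close>

definition weak_grad :: "real \<Rightarrow> series \<Rightarrow> real ^ 2 \<Rightarrow> real ^ 2" where
  "weak_grad L c = (SOME G. series_grad L c G)"

definition in_W1inf :: "real \<Rightarrow> series \<Rightarrow> bool" where
  "in_W1inf L c \<longleftrightarrow> (\<exists>w G C. series_fun L c w \<and> series_grad L c G \<and>
     (AE x in lborel. x \<in> cell L \<longrightarrow> \<bar>w x\<bar> \<le> C \<and> norm (G x) \<le> C))"

text \<open>Pointwise gradient of a series: the classical gradient of its continuously differentiable
  representative. That representative is unique when it exists, since two representatives agree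
  almost everywhere.\<close>

definition C1_fun :: "(real ^ 2 \<Rightarrow> real) \<Rightarrow> bool" where
  "C1_fun w \<longleftrightarrow> (\<forall>x. w differentiable (at x)) \<and> continuous_on UNIV (grad w)"

definition C1_rep :: "real \<Rightarrow> series \<Rightarrow> (real ^ 2 \<Rightarrow> real) \<Rightarrow> bool" where
  "C1_rep L c w \<longleftrightarrow> periodic L w \<and> C1_fun w \<and> series_fun L c w"

definition point_grad :: "real \<Rightarrow> series \<Rightarrow> real ^ 2 \<Rightarrow> real ^ 2" where
  "point_grad L c = grad (THE w. C1_rep L c w)"

section \<open>The noise\<close>

definition (in prob_space) wiener_process :: "(real \<Rightarrow> 'a \<Rightarrow> real) \<Rightarrow> bool" where
  "wiener_process B \<longleftrightarrow>
     (\<forall>t\<ge>0. B t \<in> borel_measurable M) \<and>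
     (AE \<omega> in M. B 0 \<omega> = 0) \<and>
     (\<forall>s t. 0 \<le> s \<longrightarrow> s < t \<longrightarrow>
        distributed M lborel (\<lambda>\<omega>. B t \<omega> - B s \<omega>) (normal_density 0 (sqrt (t - s)))) \<and>
     (\<forall>(\<tau> :: nat \<Rightarrow> real) n. 0 \<le> \<tau> 0 \<longrightarrow> mono \<tau> \<longrightarrow>
        indep_vars (\<lambda>_. borel) (\<lambda>i \<omega>. B (\<tau> (Suc i)) \<omega> - B (\<tau> i) \<omega>) {..<n}) \<and>
     (AE \<omega> in M. continuous_on {0..} (\<lambda>t. B t \<omega>))"

definition (in prob_space) iid_wiener :: "(freq \<Rightarrow> real \<Rightarrow> 'a \<Rightarrow> real) \<Rightarrow> bool" where
  "iid_wiener \<beta> \<longleftrightarrow> (\<forall>k\<in>freqs. wiener_process (\<beta> k)) \<and>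
     indep_vars (\<lambda>_. Pi\<^sub>M {0..} (\<lambda>_. borel)) (\<lambda>k \<omega>. \<lambda>t\<in>{0..}. \<beta> k t \<omega>) freqs"

text \<open>The Wiener integral \<open>\<integral>\<^sub>0\<^sup>t g dB\<close> of a deterministic \<open>g\<close>: the mean-square limit of the integrals
  of step functions converging to \<open>g\<close> in \<open>L\<^sup>2\<close>. It is determined up to null sets.\<close>

definition step_fun :: "nat \<Rightarrow> (nat \<Rightarrow> real) \<Rightarrow> (nat \<Rightarrow> real) \<Rightarrow> real \<Rightarrow> real" where
  "step_fun n \<tau> c s = (\<Sum>i<n. c i * indicator {\<tau> i<..\<tau> (Suc i)} s)"

definition step_integral ::
  "(real \<Rightarrow> 'a \<Rightarrow> real) \<Rightarrow> nat \<Rightarrow> (nat \<Rightarrow> real) \<Rightarrow> (nat \<Rightarrow> real) \<Rightarrow> 'a \<Rightarrow> real" where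
  "step_integral B n \<tau> c \<omega> = (\<Sum>i<n. c i * (B (\<tau> (Suc i)) \<omega> - B (\<tau> i) \<omega>))"

definition wiener_integral ::
  "'a measure \<Rightarrow> (real \<Rightarrow> 'a \<Rightarrow> real) \<Rightarrow> real \<Rightarrow> (real \<Rightarrow> real) \<Rightarrow> ('a \<Rightarrow> real) \<Rightarrow> bool" where
  "wiener_integral M B t g X \<longleftrightarrow> X \<in> borel_measurable M \<and>
     (\<exists>(n :: nat \<Rightarrow> nat) (\<tau> :: nat \<Rightarrow> nat \<Rightarrow> real) (c :: nat \<Rightarrow> nat \<Rightarrow> real).
        (\<forall>m. mono (\<tau> m) \<and> 0 \<le> \<tau> m 0 \<and> \<tau> m (n m) \<le> t) \<and>
        (\<lambda>m. \<integral>\<^sup>+ s \<in> {0..t}. ennreal ((step_fun (n m) (\<tau> m) (c m) s - g s)\<^sup>2) \<partial>lborel)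
          \<longlonglongrightarrow> 0 \<and>
        (\<lambda>m. \<integral>\<^sup>+ \<omega>. ennreal ((step_integral B (n m) (\<tau> m) (c m) \<omega> - X \<omega>)\<^sup>2) \<partial>M)
          \<longlonglongrightarrow> 0)"

definition regularization :: "(real \<Rightarrow> freq \<Rightarrow> real) \<Rightarrow> bool" where
  "regularization \<alpha> \<longleftrightarrow>
     (\<exists>C. \<forall>\<epsilon>>0. \<forall>k\<in>freqs. \<bar>\<alpha> \<epsilon> k\<bar> \<le> C) \<and>
     (\<forall>\<epsilon>>0. \<exists>\<delta>>0. \<exists>C>0. \<forall>k\<in>freqs. \<bar>\<alpha> \<epsilon> k\<bar> \<le> C * fabs k powr (- \<delta>)) \<and>
     (\<forall>k\<in>freqs. ((\<lambda>\<epsilon>. \<alpha> \<epsilon> k) \<longlongrightarrow> 1) (at_right 0)) \<and>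
     (\<forall>\<epsilon>>0. \<exists>a :: real \<Rightarrow> real. \<forall>k\<in>freqs. \<alpha> \<epsilon> k = a (fabs k))"

text \<open>\<open>Z t \<omega>\<close> is the series with coefficients \<open>a k * \<integral>\<^sub>0\<^sup>t exp (- (t - s) * (mu L k)\<^sup>2) d\<beta> k s\<close>.\<close>

definition stoch_convolution ::
  "'a measure \<Rightarrow> real \<Rightarrow> real \<Rightarrow> (freq \<Rightarrow> real \<Rightarrow> 'a \<Rightarrow> real) \<Rightarrow> (freq \<Rightarrow> real)
     \<Rightarrow> (real \<Rightarrow> 'a \<Rightarrow> series) \<Rightarrow> bool" where
  "stoch_convolution M L T \<beta> a Z \<longleftrightarrow>
     (\<forall>k\<in>freqs. \<forall>t\<in>{0..T}. \<exists>X.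
        wiener_integral M (\<beta> k) t (\<lambda>s. exp (- (t - s) * (mu L k)\<^sup>2)) X \<and>
        (\<forall>\<omega>\<in>space M. Z t \<omega> k = a k * X \<omega>))"

section \<open>Mild solutions\<close>

definition f :: "real ^ 2 \<Rightarrow> real ^ 2" where
  "f y = (1 / (1 + (norm y)\<^sup>2)) *\<^sub>R y"

definition semigroup_A :: "real \<Rightarrow> real \<Rightarrow> series \<Rightarrow> series" where
  "semigroup_A L t c = (\<lambda>k. exp (- t * (mu L k)\<^sup>2) * c k)"

text \<open>The distribution \<open>- div (f (grad u))\<close>: its \<open>k\<close>-th coefficient is its action on \<open>e L k\<close>, where
  the derivative falls on \<open>e L k\<close>.\<close>

definition nonlinearity :: "real \<Rightarrow> series \<Rightarrow> series" where
  "nonlinearity L c = (\<lambda>k. LINT x:cell L|lborel. f (weak_grad L c x) \<bullet> grad (e L k) x)"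

definition H1_continuous_path :: "real \<Rightarrow> real \<Rightarrow> (real \<Rightarrow> series) \<Rightarrow> bool" where
  "H1_continuous_path L T v \<longleftrightarrow> (\<forall>t\<in>{0..T}. in_H L 1 (v t) \<and>
     ((\<lambda>s. norm_H L 1 (\<lambda>k. v s k - v t k)) \<longlongrightarrow> 0) (at t within {0..T}))"

definition mild_solution ::
  "'a measure \<Rightarrow> real \<Rightarrow> real \<Rightarrow> series \<Rightarrow> (real \<Rightarrow> 'a \<Rightarrow> series) \<Rightarrow> (real \<Rightarrow> 'a \<Rightarrow> series) \<Rightarrow> bool" where
  "mild_solution M L T u0 Z u \<longleftrightarrow>
     (\<forall>t\<in>{0..T}. \<forall>k\<in>freqs. (\<lambda>\<omega>. u t \<omega> k) \<in> borel_measurable M) \<and>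
     (AE \<omega> in M. H1_continuous_path L T (\<lambda>t. u t \<omega>)) \<and>
     (\<forall>t\<in>{0..T}. AE \<omega> in M. \<forall>k\<in>freqs.
        u t \<omega> k = semigroup_A L t u0 k
          + (LINT s:{0..t}|lborel. semigroup_A L (t - s) (nonlinearity L (u s \<omega>)) k)
          + Z t \<omega> k)"

end

theory Submission
  imports Defs
begin

text \<open>
  Write the solution at the fixed time \<open>t\<close> as \<open>u = d + z\<close>, where \<open>d\<close> is the sum of the heat flow of
  the initial value and of the drift, and \<open>z\<close> is the stochastic convolution. The theorem holds
  because the gradient of \<open>d\<close> is bounded by a constant that depends neither on \<open>\<epsilon>\<close> nor on the
  randomness, whereas the gradient of \<open>z\<close> at a point is Gaussian with a variance that grows beyond
  all bounds as \<open>\<epsilon>\<close> tends to \<open>0\<close>, uniformly in the point. Thus \<open>norm (grad u)\<close> is large with probability close to one,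
  and \<open>f y\<close> is small when \<open>y\<close> is large.

  \<^item> The drift (\<open>drift_gradient_bound\<close>). Since \<open>norm (f y) \<le> 1 / 2\<close>, Bessel's inequality for the
    orthogonal system \<open>grad (e L k)\<close> shows that the coefficients \<open>N k\<close> of the nonlinearity satisfy
    \<open>\<Sum>k. (N k)\<^sup>2 / mu L k \<le> L\<^sup>2 / 4\<close>, whatever the solution is. The smoothing
    \<open>exp (- r * mu\<^sup>2) \<le> (r * mu\<^sup>2) powr (- 7 / 8)\<close> costs an integrable singularity in the time lag \<open>r\<close>
    and gains enough decay for the Cauchy-Schwarz inequality, because \<open>\<Sum>k. (fabs k) powr (- 3)\<close>
    converges on the two-dimensional lattice. Hence \<open>\<Sum>k. sqrt (mu L k) * \<bar>d k\<bar>\<close> is bounded;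
    the heat flow is treated in the same way.

  \<^item> The noise is Gaussian (\<open>stoch_convolution_gaussian\<close>). Finite linear combinations of the Wiener
    integrals are limits in mean square of combinations of independent normal increments. Such
    limits are normal because characteristic functions converge.

  \<^item> The gradient exists pointwise (\<open>noise_regular\<close>, \<open>point_grad_limit\<close>). The variance of the gradient
    of the part of \<open>z\<close> with frequencies of size about \<open>2 ^ n\<close> is at most of order
    \<open>2 powr (- 2 * \<delta> * n)\<close>, where \<open>\<delta>\<close> is the decay exponent of the regularization. A high moment summed over a fine grid
    controls the supremum of this part, and the suprema are summable almost surely. Therefore the
    Fourier series of \<open>u\<close> and of its gradient, summed along dyadic boxes, converge uniformly, and the
    limit is the continuously differentiable representative.

  \<^item> The variance explodes (\<open>gradient_variance_unbounded\<close>). Without regularization the variance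
    of the first component of the gradient of \<open>z\<close> is, up to constants, the sum of
    \<open>k\<^sub>1\<^sup>2 / (fabs k) ^ 4\<close> over the lattice, which diverges logarithmically. Adding up the four sign
    changes of \<open>k\<close> removes the dependence on the point \<open>x\<close>. Each fixed finite part of the sum is
    recovered, up to a factor, for small \<open>\<epsilon>\<close>.

  \<^item> Conclusion (\<open>expectation_f_le_small_ball\<close>). The density of a centred normal variable of variance
    \<open>v\<close> is at most \<open>1 / sqrt v\<close>, so its probability of lying in a fixed interval tends to \<open>0\<close> as \<open>v\<close>
    grows. Fatou's lemma transfers this from the partial sums to the gradient itself.
\<close>

section \<open>The Fourier basis and its gradients\<close>

lemma Basis_vec2: "(Basis :: (real^2) set) = {axis 1 1, axis 2 1}"
  unfolding Basis_vec_def by (auto simp: UNIV_2)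

text \<open>Lebesgue measure on \<^typ>\<open>real ^ 2\<close> is the image of a product measure indexed by the two basis
  vectors, so an integral of a product of functions of the coordinates factorizes.\<close>

lemma lborel_integral_vec2_prod:
  fixes g h :: "real \<Rightarrow> real"
  assumes g: "integrable lborel g" and h: "integrable lborel h"
  shows "integrable lborel (\<lambda>x :: real^2. g (x $ 1) * h (x $ 2))"
    and "(LINT x|lborel. g ((x :: real^2) $ 1) * h (x $ 2)) = (LINT z|lborel. g z) * (LINT z|lborel. h z)"
proof -
  define F where "F = (\<lambda>b :: real^2. if b = axis 1 1 then g else h)"
  have ne: "(axis 1 1 :: real^2) \<noteq> axis 2 1" by (simp add: axis_eq_axis)
  have F: "integrable lborel (F b)" for b using g h by (auto simp: F_def)
  interpret product_sigma_finite "\<lambda>_ :: real^2. lborel :: real measure" ..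
  have [measurable]: "g \<in> borel_measurable borel" "h \<in> borel_measurable borel"
    using g h by auto
  have eq: "g ((\<Sum>b\<in>Basis. y b *\<^sub>R b) $ 1) * h ((\<Sum>b\<in>Basis. y b *\<^sub>R b) $ 2)
      = (\<Prod>b\<in>Basis. F b (y b))" for y :: "real^2 \<Rightarrow> real"
    using ne by (simp add: Basis_vec2 F_def axis_def)
  have i: "integrable (\<Pi>\<^sub>M b\<in>(Basis :: (real^2) set). lborel) (\<lambda>y. \<Prod>b\<in>Basis. F b (y b))"
    by (rule product_integrable_prod) (auto intro: F)
  have v: "integral\<^sup>L (\<Pi>\<^sub>M b\<in>(Basis :: (real^2) set). lborel) (\<lambda>y. \<Prod>b\<in>Basis. F b (y b))
      = (\<Prod>b\<in>(Basis :: (real^2) set). LINT z|lborel. F b z)"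
    by (rule product_integral_prod) (auto intro: F)
  have m: "(\<lambda>x :: real^2. g (x $ 1) * h (x $ 2)) \<in> borel_measurable borel"
    by measurable
  show "integrable lborel (\<lambda>x :: real^2. g (x $ 1) * h (x $ 2))"
    using i m by (subst lborel_eq, subst integrable_distr_eq) (simp_all only: eq, auto)
  have "(LINT x|lborel. g ((x :: real^2) $ 1) * h (x $ 2))
     = integral\<^sup>L (\<Pi>\<^sub>M b\<in>(Basis :: (real^2) set). lborel) (\<lambda>y. \<Prod>b\<in>Basis. F b (y b))"
    by (subst lborel_eq, subst integral_distr) (simp_all only: eq, auto simp: m)
  also have "\<dots> = (LINT z|lborel. g z) * (LINT z|lborel. h z)"
    unfolding v using ne by (simp add: Basis_vec2 F_def)
  finally show "(LINT x|lborel. g ((x :: real^2) $ 1) * h (x $ 2)) = (LINT z|lborel. g z) * (LINT z|lborel. h z)" .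
qed

lemma mem_cell: "x \<in> cell L \<longleftrightarrow> 0 \<le> x $ 1 \<and> x $ 1 \<le> L \<and> 0 \<le> x $ 2 \<and> x $ 2 \<le> L"
  by (auto simp: cell_def mem_box_cart vec_def forall_2)

lemma cell_sets [measurable]: "cell L \<in> sets borel"
  by (simp add: cell_def)

lemma set_integral_cell_prod:
  fixes g h :: "real \<Rightarrow> real"
  assumes "continuous_on {0..L} g" "continuous_on {0..L} h"
  shows "set_integrable lborel (cell L) (\<lambda>x. g (x $ 1) * h (x $ 2))"
    and "(LINT x:cell L|lborel. g (x $ 1) * h (x $ 2)) = (LINT z:{0..L}|lborel. g z) * (LINT z:{0..L}|lborel. h z)"
proof -
  have gi: "integrable lborel (\<lambda>z. indicator {0..L} z * g z)" "integrable lborel (\<lambda>z. indicator {0..L} z * h z)"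
    using borel_integrable_atLeastAtMost'[OF assms(1)] borel_integrable_atLeastAtMost'[OF assms(2)]
    by (simp_all add: set_integrable_def)
  have eq: "indicator (cell L) x *\<^sub>R (g (x $ 1) * h (x $ 2))
     = (indicator {0..L} (x $ 1) * g (x $ 1)) * (indicator {0..L} (x $ 2) * h (x $ 2))" for x :: "real^2"
    by (auto simp: indicator_def mem_cell)
  show "set_integrable lborel (cell L) (\<lambda>x. g (x $ 1) * h (x $ 2))"
    unfolding set_integrable_def eq by (rule lborel_integral_vec2_prod(1)[OF gi])
  show "(LINT x:cell L|lborel. g (x $ 1) * h (x $ 2)) = (LINT z:{0..L}|lborel. g z) * (LINT z:{0..L}|lborel. h z)"
    unfolding set_lebesgue_integral_def eq lborel_integral_vec2_prod(2)[OF gi] by simp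
qed

text \<open>The normalization of the basis is such that differentiation only swaps the indices \<open>j\<close> and \<open>- j\<close>,
  including the sign; this makes every partial derivative of a basis function a multiple of another
  basis function, and it reduces all later estimates to those for the basis itself.\<close>

lemma omega_DERIV:
  "(omega L j has_real_derivative (2 * pi * of_int j / L) * omega L (- j) z) (at z)"
proof -
  have "j > 0 \<or> j = 0 \<or> j < 0" by auto
  moreover have "((\<lambda>z. sqrt (2 / L) * sin (2 * pi * of_int j * z / L)) has_real_derivative (2 * pi * of_int j / L) * omega L (- j) z) (at z)" if "j > 0"
    using that by (cases "L = 0") (auto simp: omega_def intro!: derivative_eq_intros)
  moreover have "((\<lambda>z. sqrt (2 / L) * cos (2 * pi * of_int j * z / L)) has_real_derivative (2 * pi * of_int j / L) * omega L (- j) z) (at z)" if "j < 0"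
    using that by (cases "L = 0") (auto simp: omega_def intro!: derivative_eq_intros)
  moreover have "omega L j = (if j > 0 then (\<lambda>z. sqrt (2 / L) * sin (2 * pi * of_int j * z / L)) 
      else if j = 0 then (\<lambda>z. 1 / sqrt L) else (\<lambda>z. sqrt (2 / L) * cos (2 * pi * of_int j * z / L)))"
    by (auto simp: omega_def fun_eq_iff)
  ultimately show ?thesis by auto
qed

lemma continuous_on_omega [continuous_intros]:
  "continuous_on S g \<Longrightarrow> continuous_on S (\<lambda>x. omega L j (g x))"
  using DERIV_continuous_on[OF has_field_derivative_at_within[OF omega_DERIV], of UNIV]
  by (rule continuous_on_compose2) auto

lemma abs_omega_le: assumes "L > 0" shows "\<bar>omega L j z\<bar> \<le> sqrt (2 / L)"
proof -
  have "1 / sqrt L = sqrt (1 / L)" by (simp add: real_sqrt_divide)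
  also have "\<dots> \<le> sqrt (2 / L)" using assms by (simp add: divide_right_mono)
  finally have 1: "1 / sqrt L \<le> sqrt (2 / L)" .
  have "sqrt (2 / L) \<ge> 0" using assms by simp
  then show ?thesis using 1 assms
    by (auto simp: omega_def abs_mult intro!: mult_left_le)
qed

lemma omega_sq_sum: assumes "L > 0" "j \<noteq> 0" shows "(omega L j z)\<^sup>2 + (omega L (-j) z)\<^sup>2 = 2 / L"
proof -
  have *: "(sqrt (2 / L) * sin y)\<^sup>2 + (sqrt (2 / L) * cos y)\<^sup>2 = 2 / L" for y
  proof -
    have "(sqrt (2 / L) * sin y)\<^sup>2 + (sqrt (2 / L) * cos y)\<^sup>2 = (2 / L) * ((sin y)\<^sup>2 + (cos y)\<^sup>2)"
      using assms by (simp only: power_mult_distrib distrib_left) simp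
    then show ?thesis by simp
  qed
  show ?thesis
    using assms *[of "2 * pi * of_int j * z / L"] *[of "- (2 * pi * of_int j * z / L)"]
    by (cases "j > 0") (simp_all add: omega_def add.commute)
qed

lemma cos_integral_period:
  assumes "L > 0"
  shows "(LINT z:{0..L}|lborel. cos (2 * pi * of_int n * z / L - c)) = (if n = 0 then L * cos c else 0)"
proof (cases "n = 0")
  case True
  then show ?thesis using assms by (simp add: set_lebesgue_integral_def cos_minus)
next
  case False
  define a where "a = 2 * pi * of_int n / L"
  have a: "a \<noteq> 0" using False assms by (simp add: a_def)
  have "(LINT z:{0..L}|lborel. cos (2 * pi * of_int n * z / L - c)) = (LINT z|lborel. indicator {0..L} z *\<^sub>R cos (a * z - c))"
    by (simp add: set_lebesgue_integral_def a_def)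
  also have "\<dots> = sin (a * L - c) / a - sin (a * 0 - c) / a"
    by (rule integral_FTC_atLeastAtMost)
       (use assms a in \<open>auto intro!: derivative_eq_intros continuous_intros simp flip: has_real_derivative_iff_has_vector_derivative\<close>)
  also have "sin (a * L - c) = sin (- c)"
  proof -
    have "a * L - c = 2 * pi * of_int n - c" using assms by (simp add: a_def)
    moreover have "sin (2 * pi * of_int n) = 0" "cos (2 * pi * of_int n) = 1" by simp_all
    ultimately show ?thesis by (simp only: sin_diff) simp
  qed
  finally show ?thesis using False by simp
qed

text \<open>A uniform formula for sines and cosines: with it the product of two basis functions is treated
  by one trigonometric identity instead of by cases.\<close>

lemma omega_as_cos:
  assumes "L > 0"
  shows "omega L j z = (if j = 0 then 1 / sqrt L else sqrt (2 / L))
           * cos (2 * pi * of_int j * z / L - (if j > 0 then pi / 2 else 0))"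
  using assms by (auto simp: omega_def cos_diff)

lemma omega_orthonormal:
  assumes "L > 0"
  shows "(LINT z:{0..L}|lborel. omega L j z * omega L l z) = (if j = l then 1 else 0)"
proof -
  define c where "c = (\<lambda>j :: int. if j = 0 then 1 / sqrt L else sqrt (2 / L))"
  define \<phi> where "\<phi> = (\<lambda>j :: int. if j > 0 then pi / 2 else 0 :: real)"
  have prod: "omega L j z * omega L l z =
      c j * c l / 2 * cos (2 * pi * of_int (j - l) * z / L - (\<phi> j - \<phi> l))
    + c j * c l / 2 * cos (2 * pi * of_int (j + l) * z / L - (\<phi> j + \<phi> l))" for z
  proof -
    have "cos a * cos b = cos (a - b) / 2 + cos (a + b) / 2" for a b :: real
      by (simp add: cos_diff cos_add field_simps)
    from this[of "2 * pi * of_int j * z / L - \<phi> j" "2 * pi * of_int l * z / L - \<phi> l"]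
    have "omega L j z * omega L l z = c j * c l *
       (cos ((2 * pi * of_int j * z / L - \<phi> j) - (2 * pi * of_int l * z / L - \<phi> l)) / 2
      + cos ((2 * pi * of_int j * z / L - \<phi> j) + (2 * pi * of_int l * z / L - \<phi> l)) / 2)"
      by (simp only: omega_as_cos[OF assms] c_def \<phi>_def) (simp only: mult_ac)
    then show ?thesis
      by (simp add: algebra_simps diff_divide_distrib add_divide_distrib)
  qed
  have int: "set_integrable lborel {0..L} (\<lambda>z. a * cos (2 * pi * of_int n * z / L - b))" for a b n
    by (intro borel_integrable_atLeastAtMost' continuous_intros) (use assms in auto)
  have "(LINT z:{0..L}|lborel. omega L j z * omega L l z)
     = c j * c l / 2 * (if j = l then L * cos (\<phi> j - \<phi> l) else 0)
     + c j * c l / 2 * (if j = - l then L * cos (\<phi> j + \<phi> l) else 0)"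
    unfolding prod set_integral_add(2)[OF int int] set_integral_mult_right cos_integral_period[OF assms]
    by (simp add: eq_neg_iff_add_eq_0)
  also have "\<dots> = (if j = l then 1 else 0)"
  proof -
    have "c 0 * c 0 = 1 / L" "j \<noteq> 0 \<Longrightarrow> c j * c j = 2 / L"
      using assms by (simp_all add: c_def)
    moreover have "j \<noteq> 0 \<Longrightarrow> j = - l \<Longrightarrow> cos (\<phi> j + \<phi> l) = 0" by (auto simp: \<phi>_def)
    moreover have "\<phi> 0 = 0" by (simp add: \<phi>_def)
    ultimately show ?thesis using assms by (cases "j = 0"; cases "j = l") auto
  qed
  finally show ?thesis .
qed

lemma continuous_on_e [continuous_intros]: "continuous_on S (e L k)"
  unfolding e_def by (intro continuous_intros)

lemma borel_measurable_e [measurable]: "e L k \<in> borel_measurable borel"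
  by (intro borel_measurable_continuous_onI continuous_intros)

lemma abs_e_le: assumes "L > 0" shows "\<bar>e L k x\<bar> \<le> 2 / L"
proof -
  have "\<bar>e L k x\<bar> \<le> sqrt (2 / L) * sqrt (2 / L)"
    unfolding e_def abs_mult using assms by (intro mult_mono abs_omega_le) auto
  then show ?thesis using assms by simp
qed

lemma e_orthonormal:
  assumes "L > 0"
  shows "set_integrable lborel (cell L) (\<lambda>x. e L k x * e L l x)"
    and "(LINT x:cell L|lborel. e L k x * e L l x) = (if k = l then 1 else 0)"
proof -
  have eq: "e L k x * e L l x = (\<lambda>z. omega L (fst k) z * omega L (fst l) z) (x $ 1)
      * (\<lambda>z. omega L (snd k) z * omega L (snd l) z) (x $ 2)" for x
    by (simp add: e_def)
  show "set_integrable lborel (cell L) (\<lambda>x. e L k x * e L l x)"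
    unfolding eq by (intro set_integral_cell_prod continuous_intros)
  show "(LINT x:cell L|lborel. e L k x * e L l x) = (if k = l then 1 else 0)"
    unfolding eq by (subst set_integral_cell_prod(2))
      (auto intro!: continuous_intros simp: omega_orthonormal[OF assms] prod_eq_iff)
qed

lemma periodic_e: assumes "L > 0" shows "e L k (x + axis i L) = e L k x"
proof -
  have *: "omega L j (z + L) = omega L j z" for j z
  proof -
    have "2 * pi * of_int j * (z + L) / L = 2 * pi * of_int j * z / L + 2 * pi * of_int j"
      using assms by (simp add: field_simps)
    moreover have "sin (2 * pi * of_int j) = 0" "cos (2 * pi * of_int j) = 1" by simp_all
    ultimately show ?thesis by (simp only: omega_def sin_add cos_add) simp
  qed
  show ?thesis using exhaust_2[of i] by (auto simp: e_def * axis_def)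
qed

definition grad_e :: "real \<Rightarrow> freq \<Rightarrow> real ^ 2 \<Rightarrow> real ^ 2" where
  "grad_e L k x = (2 * pi / L) *\<^sub>R
     ((of_int (fst k) * e L (- fst k, snd k) x) *\<^sub>R axis 1 1
       + (of_int (snd k) * e L (fst k, - snd k) x) *\<^sub>R axis 2 1)"

lemma grad_e_nth:
  "grad_e L k x $ 1 = 2 * pi * of_int (fst k) / L * e L (- fst k, snd k) x"
  "grad_e L k x $ 2 = 2 * pi * of_int (snd k) / L * e L (fst k, - snd k) x"
  by (simp_all add: grad_e_def axis_def)

lemma GDERIV_e: "GDERIV (e L k) x :> grad_e L k x"
proof -
  have g: "GDERIV (\<lambda>x :: real^2. x $ i) x :> axis i 1" for i
    unfolding gderiv_def inner_axis by (simp add: bounded_linear_imp_has_derivative bounded_linear_vec_nth)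
  have "GDERIV (\<lambda>x. omega L (fst k) (x $ 1) * omega L (snd k) (x $ 2)) x :> 
      omega L (fst k) (x $ 1) *\<^sub>R ((2 * pi * of_int (snd k) / L) * omega L (- snd k) (x $ 2)) *\<^sub>R axis 2 1
      + omega L (snd k) (x $ 2) *\<^sub>R ((2 * pi * of_int (fst k) / L) * omega L (- fst k) (x $ 1)) *\<^sub>R axis 1 1"
    by (intro GDERIV_mult GDERIV_DERIV_compose g omega_DERIV)
  then show ?thesis
    unfolding grad_e_def e_def[abs_def]
    by (rule GDERIV_subst) (simp add: vec_eq_iff axis_def forall_2)
qed

lemma grad_eqI: assumes "GDERIV w x :> D" shows "grad w x = D"
proof -
  have "E = D" if "GDERIV w x :> E" for E
  proof -
    have "(\<lambda>h. h \<bullet> E) = (\<lambda>h. h \<bullet> D)"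
      using that assms unfolding gderiv_def by (rule has_derivative_unique)
    then have "(E - D) \<bullet> E = (E - D) \<bullet> D" by metis
    then have "(E - D) \<bullet> (E - D) = 0" by (simp add: inner_diff_right)
    then show ?thesis by simp
  qed
  then show ?thesis using assms unfolding grad_def by blast
qed

text \<open>The explicit gradient is used from here on in place of the definite description in \<^const>\<open>grad\<close>.\<close>

lemma grad_basis: "grad (e L k) x = grad_e L k x"
  by (rule grad_eqI GDERIV_e)+

lemma fabs_nonneg: "fabs k \<ge> 0" by (simp add: fabs_def)
lemma fabs_sq: "(fabs k)\<^sup>2 = (of_int (fst k))\<^sup>2 + (of_int (snd k))\<^sup>2" by (simp add: fabs_def)

lemma fabs_ge_1: assumes "k \<in> freqs" shows "fabs k \<ge> 1"
proof -
  have "fst k \<noteq> 0 \<or> snd k \<noteq> 0" using assms by (cases k) (auto simp: freqs_def)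
  then have "(fst k)\<^sup>2 + (snd k)\<^sup>2 \<ge> 1"
    by (metis add_increasing add_increasing2 int_one_le_iff_zero_less zero_less_power2 zero_le_power2)
  then have "real_of_int ((fst k)\<^sup>2 + (snd k)\<^sup>2) \<ge> 1" by linarith
  then show ?thesis by (simp add: fabs_def)
qed

lemma mu_eq: "mu L k = (2 * pi / L)\<^sup>2 * (fabs k)\<^sup>2"
  by (simp add: mu_def power_mult_distrib power_divide)

lemma sqrt_mu: assumes "L > 0" shows "sqrt (mu L k) = 2 * pi * fabs k / L"
  using assms fabs_nonneg[of k] by (simp add: mu_def)

lemma mu_pos: assumes "L > 0" "k \<in> freqs" shows "mu L k > 0"
  using fabs_ge_1[OF assms(2)] assms by (simp add: mu_def)

lemma norm_vec2: "norm (y :: real^2) = sqrt ((y $ 1)\<^sup>2 + (y $ 2)\<^sup>2)"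
  by (simp add: norm_vec_def L2_set_def UNIV_2)

lemma inner_vec2: "(y :: real^2) \<bullet> z = y $ 1 * z $ 1 + y $ 2 * z $ 2"
  by (simp add: inner_vec_def UNIV_2)

lemma norm_grad_e_le: assumes "L > 0" shows "norm (grad_e L k x) \<le> 2 / L * sqrt (mu L k)"
proof -
  have "(norm (grad_e L k x))\<^sup>2 = (2 * pi / L)\<^sup>2 * ((of_int (fst k))\<^sup>2 * (e L (- fst k, snd k) x)\<^sup>2 
      + (of_int (snd k))\<^sup>2 * (e L (fst k, - snd k) x)\<^sup>2)"
    by (simp add: norm_vec2 grad_e_nth power_mult_distrib power_divide algebra_simps)
  also have "\<dots> \<le> (2 * pi / L)\<^sup>2 * ((of_int (fst k))\<^sup>2 * (2 / L)\<^sup>2 + (of_int (snd k))\<^sup>2 * (2 / L)\<^sup>2)"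
    using abs_e_le[OF assms] assms
    by (intro mult_left_mono add_mono) (auto simp: abs_le_square_iff[symmetric])
  also have "\<dots> = (2 / L * sqrt (mu L k))\<^sup>2"
    using assms by (simp add: sqrt_mu power_mult_distrib power_divide fabs_sq algebra_simps add_divide_distrib)
  finally show ?thesis
    using assms by (intro power2_le_imp_le[of "norm (grad_e L k x)"]) (auto simp: mu_def)
qed

lemma e_Lipschitz: assumes "L > 0" shows "\<bar>e L k x - e L k y\<bar> \<le> 2 / L * sqrt (mu L k) * norm (x - y)"
proof -
  have "norm (e L k x - e L k y) \<le> (2 / L * sqrt (mu L k)) * norm (x - y)"
  proof (rule differentiable_bound[where S = UNIV and f' = "\<lambda>x h. h \<bullet> grad_e L k x"])
    show "onorm (\<lambda>h. h \<bullet> grad_e L k x) \<le> 2 / L * sqrt (mu L k)" for x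
    proof (rule onorm_le)
      fix h
      have "norm (h \<bullet> grad_e L k x) \<le> norm h * norm (grad_e L k x)"
        by (simp add: Cauchy_Schwarz_ineq2)
      also have "\<dots> \<le> norm h * (2 / L * sqrt (mu L k))"
        by (intro mult_left_mono norm_grad_e_le assms) auto
      finally show "norm (h \<bullet> grad_e L k x) \<le> 2 / L * sqrt (mu L k) * norm h" by (simp add: mult_ac)
    qed
  qed (use GDERIV_e[of L k] in \<open>auto simp: gderiv_def\<close>)
  then show ?thesis by simp
qed

lemma continuous_on_grad_e [continuous_intros]: "continuous_on S (grad_e L k)"
  unfolding grad_e_def by (intro continuous_intros)

lemma grad_e_orthogonal:
  assumes "L > 0"
  shows "set_integrable lborel (cell L) (\<lambda>x. grad_e L k x \<bullet> grad_e L l x)"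
    and "(LINT x:cell L|lborel. grad_e L k x \<bullet> grad_e L l x) = (if k = l then mu L k else 0)"
proof -
  define a where "a = (2 * pi / L)\<^sup>2 * of_int (fst k) * of_int (fst l)"
  define b where "b = (2 * pi / L)\<^sup>2 * of_int (snd k) * of_int (snd l)"
  have eq: "grad_e L k x \<bullet> grad_e L l x = a * (e L (- fst k, snd k) x * e L (- fst l, snd l) x)
      + b * (e L (fst k, - snd k) x * e L (fst l, - snd l) x)" for x
    by (simp add: inner_vec2 grad_e_nth a_def b_def power2_eq_square mult_ac)
  have i: "set_integrable lborel (cell L) (\<lambda>x. c * (e L k x * e L l x))" for k l c
    using e_orthonormal(1)[OF assms] by (intro set_integrable_mult_right) auto
  show "set_integrable lborel (cell L) (\<lambda>x. grad_e L k x \<bullet> grad_e L l x)"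
    unfolding eq by (intro set_integral_add i)
  have "(LINT x:cell L|lborel. grad_e L k x \<bullet> grad_e L l x) = (if k = l then a + b else 0)"
    unfolding eq by (subst set_integral_add(2)[OF i i]) (auto simp: e_orthonormal[OF assms] prod_eq_iff)
  also have "\<dots> = (if k = l then mu L k else 0)"
  proof -
    have "a + b = mu L k" if "k = l"
      unfolding mu_eq fabs_sq distrib_left a_def b_def that by (simp add: power2_eq_square)
    then show ?thesis by auto
  qed
  finally show "(LINT x:cell L|lborel. grad_e L k x \<bullet> grad_e L l x) = (if k = l then mu L k else 0)" .
qed

section \<open>Dyadic shells of frequencies and continuously differentiable representatives\<close>

text \<open>Dyadic boxes exhaust the frequencies; a shell is the difference of two consecutive boxes, on which
  \<^const>\<open>fabs\<close> is constant up to a factor 4.\<close>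

definition kbox :: "nat \<Rightarrow> freq set" where
  "kbox N = {k \<in> freqs. \<bar>fst k\<bar> < 2 ^ N \<and> \<bar>snd k\<bar> < 2 ^ N}"

definition shell :: "nat \<Rightarrow> freq set" where
  "shell n = kbox (Suc n) - kbox n"

lemma kbox_subset: "kbox N \<subseteq> {- (2 ^ N) <..< 2 ^ N} \<times> {- (2 ^ N) <..< 2 ^ N}"
  by (auto simp: kbox_def abs_less_iff)

lemma finite_kbox [simp]: "finite (kbox N)"
  by (rule finite_subset[OF kbox_subset]) auto

lemma finite_shell [simp]: "finite (shell n)"
  by (simp add: shell_def)

lemma kbox_freqs: "kbox N \<subseteq> freqs" by (auto simp: kbox_def)
lemma shell_freqs: "shell N \<subseteq> freqs" by (auto simp: kbox_def shell_def)

lemma kbox_0 [simp]: "kbox 0 = {}" by (auto simp: kbox_def freqs_def)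

lemma kbox_mono: "m \<le> n \<Longrightarrow> kbox m \<subseteq> kbox n"
proof -
  assume "m \<le> n"
  then have "(2::int) ^ m \<le> 2 ^ n" by (intro power_increasing) auto
  then show ?thesis by (auto simp: kbox_def intro: less_le_trans)
qed

lemma sum_kbox_shells:
  fixes F :: "freq \<Rightarrow> 'b :: ab_group_add"
  shows "(\<Sum>k\<in>kbox N. F k) = (\<Sum>n<N. \<Sum>k\<in>shell n. F k)"
proof (induction N)
  case (Suc N)
  have "kbox (Suc N) = kbox N \<union> shell N" "kbox N \<inter> shell N = {}"
    using kbox_mono[of N "Suc N"] by (auto simp: shell_def)
  then show ?case using Suc by (simp add: sum.union_disjoint)
qed simp

lemma card_shell_le: "real (card (shell n)) \<le> 16 * 4 ^ n"
proof -
  define I where "I = {- (2 ^ Suc n) <..< (2 ^ Suc n :: int)}"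
  have "card I = nat (2 * 2 ^ Suc n - 1)" by (simp add: I_def)
  then have "int (card I) \<le> 4 * 2 ^ n" by simp
  then have "of_int (int (card I)) \<le> (of_int (4 * 2 ^ n) :: real)" by (simp only: of_int_le_iff)
  then have I: "real (card I) \<le> 4 * 2 ^ n" by simp
  have "shell n \<subseteq> I \<times> I" using kbox_subset[of "Suc n"] by (auto simp: shell_def I_def)
  then have "card (shell n) \<le> card (I \<times> I)"
    by (intro card_mono) (auto simp: I_def)
  then have "real (card (shell n)) \<le> real (card I) * real (card I)"
    by (simp add: card_cartesian_product flip: of_nat_mult)
  also have "\<dots> \<le> (4 * 2 ^ n) * (4 * 2 ^ n)"
    using I by (intro mult_mono) auto
  also have "\<dots> = 16 * (2 * 2) ^ n" by (simp only: power_mult_distrib)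
  finally show ?thesis by simp
qed

lemma abs_le_fabs: "\<bar>real_of_int (fst k)\<bar> \<le> fabs k" "\<bar>real_of_int (snd k)\<bar> \<le> fabs k"
  by (auto simp: fabs_def intro!: real_le_rsqrt)

lemma fabs_shell_ge:
  assumes "k \<in> shell n" shows "2 ^ n \<le> fabs k"
proof -
  have "2 ^ n \<le> \<bar>fst k\<bar> \<or> 2 ^ n \<le> \<bar>snd k\<bar>" using assms by (auto simp: shell_def kbox_def)
  then have "real_of_int (2 ^ n) \<le> \<bar>real_of_int (fst k)\<bar> \<or> real_of_int (2 ^ n) \<le> \<bar>real_of_int (snd k)\<bar>"
    by linarith
  then show ?thesis using abs_le_fabs[of k] by (auto intro: order_trans)
qed

lemma fabs_shell_le:
  assumes "k \<in> shell n" shows "fabs k \<le> 4 * 2 ^ n"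
proof -
  have "\<bar>fst k\<bar> < 2 ^ Suc n" "\<bar>snd k\<bar> < 2 ^ Suc n" using assms by (auto simp: shell_def kbox_def)
  then have "\<bar>real_of_int (fst k)\<bar> \<le> 2 ^ Suc n" "\<bar>real_of_int (snd k)\<bar> \<le> 2 ^ Suc n"
    by (simp_all only: of_int_abs[symmetric]) (metis less_imp_le of_int_le_iff of_int_numeral of_int_power)+
  moreover have "fabs k \<le> \<bar>real_of_int (fst k)\<bar> + \<bar>real_of_int (snd k)\<bar>"
    unfolding fabs_def by (rule sqrt_sum_squares_le_sum_abs)
  ultimately show ?thesis by simp
qed

lemma finite_subset_kbox:
  assumes "finite K" "K \<subseteq> freqs" shows "\<exists>N. K \<subseteq> kbox N"
  using assms
proof (induction K)
  case (insert k K)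
  then obtain N where N: "K \<subseteq> kbox N" by auto
  define m where "m = nat (\<bar>fst k\<bar> + \<bar>snd k\<bar>)"
  have "int m < 2 ^ m"
    using less_exp[of m] by (metis of_nat_less_iff of_nat_numeral of_nat_power)
  then have "\<bar>fst k\<bar> < 2 ^ m" "\<bar>snd k\<bar> < 2 ^ m" by (auto simp: m_def)
  then have "k \<in> kbox m" using insert by (auto simp: kbox_def)
  then have "insert k K \<subseteq> kbox (max m N)"
    using N kbox_mono[of m "max m N"] kbox_mono[of N "max m N"] by auto
  then show ?case by blast
qed auto

lemma sum_le_of_shells:
  fixes F :: "freq \<Rightarrow> real"
  assumes "\<And>k. k \<in> freqs \<Longrightarrow> F k \<ge> 0" and "\<And>n. (\<Sum>k\<in>shell n. F k) \<le> a n" and "summable a"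
    and "finite K" "K \<subseteq> freqs"
  shows "(\<Sum>k\<in>K. F k) \<le> (\<Sum>n. a n)"
proof -
  obtain N where N: "K \<subseteq> kbox N" using finite_subset_kbox[OF assms(4,5)] ..
  have a: "a n \<ge> 0" for n
  proof -
    have "0 \<le> (\<Sum>k\<in>shell n. F k)" using shell_freqs[of n] by (intro sum_nonneg assms(1)) auto
    then show ?thesis using assms(2)[of n] by linarith
  qed
  have "(\<Sum>k\<in>K. F k) \<le> (\<Sum>k\<in>kbox N. F k)"
    using N by (intro sum_mono2 assms(1) subsetD[OF kbox_freqs]) auto
  also have "\<dots> \<le> (\<Sum>n<N. a n)" unfolding sum_kbox_shells by (intro sum_mono assms(2))
  also have "\<dots> \<le> (\<Sum>n. a n)" using a assms(3) by (intro sum_le_suminf) auto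
  finally show ?thesis .
qed

text \<open>The \<open>n\<close>-th shell has at most \<open>16 * 4 ^ n\<close> points, on which \<open>fabs k\<close> is at least \<open>2 ^ n\<close>; hence exponents
  beyond the dimension 2 are summable.\<close>

lemma lattice_sum_bounded:
  assumes "d > 0"
  shows "\<exists>C\<ge>0. \<forall>K. finite K \<longrightarrow> K \<subseteq> freqs \<longrightarrow> (\<Sum>k\<in>K. fabs k powr (- (2 + d))) \<le> C"
proof -
  define a where "a = (\<lambda>n :: nat. 16 * (2 powr (- d)) ^ n)"
  have q: "0 < (2::real) powr (- d)" "(2::real) powr (- d) < 1"
    using assms powr_less_mono[of "- d" 0 2] by auto
  have s: "summable a" unfolding a_def using q by (intro summable_mult summable_geometric) auto
  have "(\<Sum>k\<in>shell n. fabs k powr (- (2 + d))) \<le> a n" for n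
  proof -
    have "(\<Sum>k\<in>shell n. fabs k powr (- (2 + d))) \<le> (\<Sum>k\<in>shell n. (2 ^ n) powr (- (2 + d)))"
      using assms by (intro sum_mono powr_mono2' fabs_shell_ge) auto
    also have "\<dots> = real (card (shell n)) * (2 ^ n) powr (- (2 + d))" by simp
    also have "\<dots> \<le> 16 * 4 ^ n * (2 ^ n) powr (- (2 + d))"
      by (intro mult_right_mono card_shell_le) auto
    also have "\<dots> = a n"
    proof -
      have "(2 ^ n :: real) powr (- (2 + d)) = 2 powr (- (2 * real n) + (- d * real n))"
        by (simp add: powr_realpow[symmetric] powr_powr algebra_simps)
      also have "\<dots> = (2 powr (- 2)) powr real n * (2 powr (- d)) ^ n"
        by (simp only: powr_add powr_powr powr_realpow[symmetric] zero_less_numeral powr_gt_zero mult_minus_left)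
      also have "(2 powr (- 2)) powr real n = (1 / 4 :: real) ^ n"
        by (simp add: powr_realpow[symmetric] powr_minus_divide)
      finally show ?thesis by (simp add: a_def power_divide)
    qed
    finally show ?thesis .
  qed
  then have "finite K \<Longrightarrow> K \<subseteq> freqs \<Longrightarrow> (\<Sum>k\<in>K. fabs k powr (- (2 + d))) \<le> (\<Sum>n. a n)" for K
    using s by (intro sum_le_of_shells) auto
  moreover have "(\<Sum>n. a n) \<ge> 0" using s by (intro suminf_nonneg) (auto simp: a_def)
  ultimately show ?thesis by blast
qed

lemma periodic_int_shift:
  assumes "periodic L w" shows "w (x + axis i (of_int n * L)) = w x"
proof (induction n rule: int_induct[where k = 0])
  case base then show ?case by (simp add: axis_def vec_eq_iff flip: zero_vec_def) 
next
  case (step1 n)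
  have "x + axis i (of_int (n + 1) * L) = (x + axis i (of_int n * L)) + axis i L"
    by (auto simp: vec_eq_iff axis_def algebra_simps)
  then show ?case using assms step1 by (simp only: periodic_def)
next
  case (step2 n)
  have "x + axis i (of_int n * L) = (x + axis i (of_int (n - 1) * L)) + axis i L"
    by (auto simp: vec_eq_iff axis_def algebra_simps)
  then have "w (x + axis i (of_int n * L)) = w (x + axis i (of_int (n - 1) * L))"
    using assms by (simp only: periodic_def)
  then show ?case using step2 by simp
qed

lemma periodic_translate_to_cell:
  assumes "L > 0"
  shows "\<exists>y\<in>cell L. \<forall>w :: real^2 \<Rightarrow> 'b. periodic L w \<longrightarrow> w x = w y"
proof -
  define n where "n = (\<lambda>i. \<lfloor>x $ i / L\<rfloor>)"
  define y where "y = (x + axis 1 (of_int (- n 1) * L)) + axis 2 (of_int (- n 2) * L)"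
  have "y $ i = x $ i - of_int (n i) * L" for i
    using exhaust_2[of i] by (auto simp: y_def axis_def)
  moreover have "0 \<le> x $ i - of_int (n i) * L" "x $ i - of_int (n i) * L \<le> L" for i
  proof -
    have "of_int (n i) \<le> x $ i / L" "x $ i / L \<le> of_int (n i) + 1" unfolding n_def by linarith+
    then show "0 \<le> x $ i - of_int (n i) * L" "x $ i - of_int (n i) * L \<le> L"
      using assms by (simp_all add: field_simps)
  qed
  ultimately have "y \<in> cell L" by (simp add: mem_cell)
  moreover have "w x = w y" if "periodic L w" for w :: "real^2 \<Rightarrow> 'b"
    unfolding y_def using that by (simp only: periodic_int_shift)
  ultimately show ?thesis by blast
qed

text \<open>Two limits in \<open>L\<^sup>2\<close> of the same series agree almost everywhere on the cell. Continuity upgrades this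
  to agreement everywhere on the cell, because a nonempty open set is not null, and periodicity
  carries it over to the plane. This is what makes the definite description in \<^const>\<open>point_grad\<close>
  meaningful.\<close>

lemma series_fun_unique:
  assumes L: "L > 0" and w: "series_fun L c w" "series_fun L c w'"
    and cont: "continuous_on UNIV w" "continuous_on UNIV w'"
    and per: "periodic L w" "periodic L w'"
  shows "w = w'"
proof -
  let ?I = "\<lambda>w K. \<integral>\<^sup>+ x \<in> cell L. ennreal ((norm ((\<Sum>k\<in>K. c k * e L k x) - w x))\<^sup>2) \<partial>lborel"
  have [measurable]: "w \<in> borel_measurable borel" "w' \<in> borel_measurable borel"
    using w by (auto simp: series_fun_def L2_sums_def)
  have "(\<integral>\<^sup>+ x \<in> cell L. ennreal ((w x - w' x)\<^sup>2) \<partial>lborel) \<le> 2 * ?I w K + 2 * ?I w' K" for K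
  proof -
    have ineq: "(a - b)\<^sup>2 \<le> 2 * (s - a)\<^sup>2 + 2 * (s - b)\<^sup>2" for a b s :: real
    proof -
      have "2 * (s - a)\<^sup>2 + 2 * (s - b)\<^sup>2 - (a - b)\<^sup>2 = ((s - a) + (s - b))\<^sup>2"
        by (simp add: power2_eq_square algebra_simps)
      then show ?thesis by (metis diff_ge_0_iff_ge zero_le_power2)
    qed
    have "(\<integral>\<^sup>+ x \<in> cell L. ennreal ((w x - w' x)\<^sup>2) \<partial>lborel)
      \<le> (\<integral>\<^sup>+ x. 2 * (ennreal ((norm ((\<Sum>k\<in>K. c k * e L k x) - w x))\<^sup>2) * indicator (cell L) x)
              + 2 * (ennreal ((norm ((\<Sum>k\<in>K. c k * e L k x) - w' x))\<^sup>2) * indicator (cell L) x) \<partial>lborel)"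
    proof (rule nn_integral_mono)
      fix x :: "real^2"
      define s where "s = (\<Sum>k\<in>K. c k * e L k x)"
      have "ennreal ((w x - w' x)\<^sup>2) \<le> ennreal (2 * (s - w x)\<^sup>2 + 2 * (s - w' x)\<^sup>2)"
        by (rule ennreal_leI) (rule ineq)
      also have "\<dots> = 2 * ennreal ((s - w x)\<^sup>2) + 2 * ennreal ((s - w' x)\<^sup>2)"
        by (simp add: ennreal_plus ennreal_mult)
      finally show "ennreal ((w x - w' x)\<^sup>2) * indicator (cell L) x \<le> 
          2 * (ennreal ((norm ((\<Sum>k\<in>K. c k * e L k x) - w x))\<^sup>2) * indicator (cell L) x)
              + 2 * (ennreal ((norm ((\<Sum>k\<in>K. c k * e L k x) - w' x))\<^sup>2) * indicator (cell L) x)"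
        by (simp add: s_def indicator_def)
    qed
    also have "\<dots> = 2 * ?I w K + 2 * ?I w' K"
      by (subst nn_integral_add) (auto simp: nn_integral_cmult)
    finally show ?thesis .
  qed
  moreover have "((\<lambda>K. 2 * ?I w K + 2 * ?I w' K) \<longlongrightarrow> 2 * 0 + 2 * 0) (finite_subsets_at_top freqs)"
    using w unfolding series_fun_def L2_sums_def by (intro tendsto_add ennreal_tendsto_cmult) auto
  ultimately have "(\<integral>\<^sup>+ x \<in> cell L. ennreal ((w x - w' x)\<^sup>2) \<partial>lborel) \<le> 0"
    by (intro tendsto_lowerbound[of "\<lambda>K. 2 * ?I w K + 2 * ?I w' K" _ "finite_subsets_at_top freqs"])
       (auto simp: always_eventually)
  then have ae: "AE x in lborel. x \<in> cell L \<longrightarrow> w x = w' x"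
    by (simp add: nn_integral_0_iff_AE) (auto elim!: eventually_mono simp: indicator_def split: if_splits)
  define U where "U = {x \<in> box 0 (vec L). w x \<noteq> w' x}"
  have oU: "open U"
  proof -
    have "closed {x. w x = w' x}" using cont by (intro closed_Collect_eq)
    then have "open ((- {x. w x = w' x}) \<inter> box 0 (vec L))" by (intro open_Int) (auto simp: open_Compl)
    moreover have "(- {x. w x = w' x}) \<inter> box 0 (vec L) = U" by (auto simp: U_def)
    ultimately show ?thesis by simp
  qed
  have "U \<in> null_sets lborel"
  proof -
    have "AE x in lborel. x \<notin> U"
      using ae box_subset_cbox[of 0 "vec L :: real^2"] by (auto elim!: eventually_mono simp: U_def cell_def)
    then show ?thesis using oU by (subst AE_iff_null_sets) auto
  qed
  then have "negligible U"
    by (simp add: negligible_iff_null_sets null_sets_completionI)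
  then have "U = {}" using open_not_negligible[OF oU] by blast
  then have "box 0 (vec L) \<subseteq> {x. w x = w' x}" by (auto simp: U_def)
  then have "closure (box 0 (vec L)) \<subseteq> {x. w x = w' x}"
    using cont by (intro closure_minimal closed_Collect_eq) auto
  moreover have "box 0 (vec L :: real^2) \<noteq> {}" using L by (simp add: box_ne_empty Basis_vec2 inner_axis)
  ultimately have eq: "w y = w' y" if "y \<in> cell L" for y
    using that by (auto simp: cell_def closure_box)
  show ?thesis
  proof
    fix x
    obtain y where "y \<in> cell L" "\<forall>w :: real^2 \<Rightarrow> real. periodic L w \<longrightarrow> w x = w y"
      using periodic_translate_to_cell[OF L] by blast
    then have "y \<in> cell L" "w x = w y" "w' x = w' y" using per by blast+
    then show "w x = w' x" using eq[of y] by metis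
  qed
qed


text \<open>Absolute summability of the coefficients makes the series itself converge uniformly and
  unconditionally, which gives the \<open>L\<^sup>2\<close> convergence. The differentiated series need not converge
  absolutely for the noise, so it is only assumed to converge uniformly when its terms are grouped
  into shells; that suffices for differentiation term by term.\<close>

lemma C1_rep_of_shell_bounds:
  assumes L: "L > 0"
    and c: "(\<lambda>k. \<bar>c k\<bar>) summable_on freqs"
    and B: "summable B" "\<And>n x. norm (\<Sum>k\<in>shell n. c k *\<^sub>R grad_e L k x) \<le> B n"
  shows "\<exists>w. C1_rep L c w \<and> (\<forall>x. (\<lambda>N. \<Sum>k\<in>kbox N. c k *\<^sub>R grad_e L k x) \<longlonglongrightarrow> grad w x)"
proof -
  define F where "F = (\<lambda>n x. \<Sum>k\<in>shell n. c k * e L k x)"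
  define H where "H = (\<lambda>n x. \<Sum>k\<in>shell n. c k *\<^sub>R grad_e L k x)"
  define G where "G = (\<lambda>x. \<Sum>n. H n x)"
  define S where "S = infsum (\<lambda>k. \<bar>c k\<bar>) freqs"
  have sum_e: "\<bar>(\<Sum>k\<in>K. c k * e L k x)\<bar> \<le> 2 / L * (\<Sum>k\<in>K. \<bar>c k\<bar>)" for K x
  proof -
    have "\<bar>(\<Sum>k\<in>K. c k * e L k x)\<bar> \<le> (\<Sum>k\<in>K. \<bar>c k\<bar> * (2 / L))"
      by (intro order_trans[OF sum_abs] sum_mono) (simp only: abs_mult, intro mult_left_mono abs_e_le L abs_ge_zero)
    then show ?thesis by (simp add: sum_distrib_left mult.commute sum_divide_distrib)
  qed
  have tail: "(\<Sum>k\<in>K. \<bar>c k\<bar>) \<le> S" if "finite K" "K \<subseteq> freqs" for K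
    unfolding S_def using that c by (intro finite_sum_le_infsum) auto
  have Glim: "uniform_limit UNIV (\<lambda>N x. \<Sum>n<N. H n x) G sequentially"
    unfolding G_def by (rule Weierstrass_m_test[OF _ B(1)]) (use B(2) in \<open>auto simp: H_def\<close>)
  have "summable (\<lambda>n. F n 0)"
  proof (rule summable_comparison_test')
    have "(\<Sum>n<N. \<Sum>k\<in>shell n. \<bar>c k\<bar>) \<le> S" for N
      unfolding sum_kbox_shells[symmetric] by (intro tail kbox_freqs) auto
    then have "summable (\<lambda>n. \<Sum>k\<in>shell n. \<bar>c k\<bar>)"
      by (intro summableI_nonneg_bounded[of _ S] sum_nonneg) auto
    then show "summable (\<lambda>n. 2 / L * (\<Sum>k\<in>shell n. \<bar>c k\<bar>))" by (rule summable_mult)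
    show "norm (F n 0) \<le> 2 / L * (\<Sum>k\<in>shell n. \<bar>c k\<bar>)" if "n \<ge> 0" for n
      using sum_e by (simp add: F_def)
  qed
  then have F0: "(\<lambda>n. F n 0) sums (\<Sum>n. F n 0)" by (rule summable_sums)
  have "\<exists>w. \<forall>x\<in>UNIV. (\<lambda>n. F n x) sums w x \<and> (w has_derivative (\<lambda>h. h \<bullet> G x)) (at x within UNIV)"
  proof (rule has_derivative_series[where f' = "\<lambda>n x h. h \<bullet> H n x"])
    show "(F n has_derivative (\<lambda>h. h \<bullet> H n x)) (at x within UNIV)" for n x
    proof -
      have "((\<lambda>x. c k * e L k x) has_derivative (\<lambda>h. c k * (h \<bullet> grad_e L k x))) (at x)" for k
        using GDERIV_e[of L k x] unfolding gderiv_def by (rule has_derivative_mult_right)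
      then have "((\<lambda>x. \<Sum>k\<in>shell n. c k * e L k x) has_derivative (\<lambda>h. \<Sum>k\<in>shell n. c k * (h \<bullet> grad_e L k x))) (at x)"
        by (intro has_derivative_sum)
      then show ?thesis by (simp add: F_def[abs_def] H_def inner_sum_right)
    qed
    fix \<epsilon> :: real assume "\<epsilon> > 0"
    then have "\<forall>\<^sub>F N in sequentially. \<forall>x\<in>UNIV. dist (\<Sum>n<N. H n x) (G x) < \<epsilon>"
      using Glim unfolding uniform_limit_iff by blast
    then show "\<forall>\<^sub>F N in sequentially. \<forall>x\<in>UNIV. \<forall>h. norm ((\<Sum>n<N. h \<bullet> H n x) - h \<bullet> G x) \<le> \<epsilon> * norm h"
    proof eventually_elim
      case (elim N)
      show ?case
      proof (intro ballI allI)
        fix x h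
        have "norm ((\<Sum>n<N. h \<bullet> H n x) - h \<bullet> G x) = \<bar>h \<bullet> ((\<Sum>n<N. H n x) - G x)\<bar>"
          by (simp add: inner_diff_right inner_sum_right)
        also have "\<dots> \<le> norm h * norm ((\<Sum>n<N. H n x) - G x)" by (rule Cauchy_Schwarz_ineq2)
        also have "\<dots> \<le> norm h * \<epsilon>"
          using elim by (intro mult_left_mono) (auto simp: dist_norm less_imp_le)
        finally show "norm ((\<Sum>n<N. h \<bullet> H n x) - h \<bullet> G x) \<le> \<epsilon> * norm h" by (simp add: mult.commute)
      qed
    qed
  qed (use F0 in auto)
  then obtain w where w: "\<And>x. (\<lambda>n. F n x) sums w x" and "\<And>x. (w has_derivative (\<lambda>h. h \<bullet> G x)) (at x)"
    by auto
  then have wG: "GDERIV w x :> G x" for x by (simp add: gderiv_def)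
  have grad_w: "grad w = G" using grad_eqI[OF wG] by blast
  have wlim: "(\<lambda>N. \<Sum>k\<in>kbox N. c k * e L k x) \<longlonglongrightarrow> w x" for x
    using w[of x] by (simp add: sums_def F_def sum_kbox_shells)
  have glim: "(\<lambda>N. \<Sum>k\<in>kbox N. c k *\<^sub>R grad_e L k x) \<longlonglongrightarrow> G x" for x
    using tendsto_uniform_limitI[OF Glim, of x] by (simp add: H_def sum_kbox_shells)
  have diff: "w differentiable at x" for x
    using wG[of x] by (auto simp: gderiv_def differentiable_def)
  have cG: "continuous_on UNIV G"
    by (rule uniform_limit_theorem[OF _ Glim]) (auto intro!: always_eventually continuous_on_sum continuous_intros simp: H_def)
  have per: "periodic L w"
    unfolding periodic_def
  proof (intro allI)
    fix x i
    show "w (x + axis i L) = w x"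
      using wlim[of "x + axis i L"] wlim[of x] unfolding periodic_e[OF L] by (rule LIMSEQ_unique)
  qed
  have [measurable]: "w \<in> borel_measurable borel"
    by (intro borel_measurable_continuous_onI) (meson continuous_at_imp_continuous_on differentiable_imp_continuous_within diff)
  have close: "\<bar>(\<Sum>k\<in>K. c k * e L k x) - w x\<bar> \<le> 2 / L * (S - (\<Sum>k\<in>K. \<bar>c k\<bar>))" if K: "finite K" "K \<subseteq> freqs" for K x
  proof (rule LIMSEQ_le_const2)
    show "(\<lambda>N. \<bar>(\<Sum>k\<in>K. c k * e L k x) - (\<Sum>k\<in>kbox N. c k * e L k x)\<bar>) \<longlonglongrightarrow> \<bar>(\<Sum>k\<in>K. c k * e L k x) - w x\<bar>"
      by (intro tendsto_intros wlim)
    obtain N0 where N0: "K \<subseteq> kbox N0" using finite_subset_kbox[OF K] ..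
    have "\<bar>(\<Sum>k\<in>K. c k * e L k x) - (\<Sum>k\<in>kbox N. c k * e L k x)\<bar> \<le> 2 / L * (S - (\<Sum>k\<in>K. \<bar>c k\<bar>))" if "N \<ge> N0" for N
    proof -
      have sub: "K \<subseteq> kbox N" using subset_trans[OF N0 kbox_mono[OF that]] .
      have "(\<Sum>k\<in>kbox N. c k * e L k x) - (\<Sum>k\<in>K. c k * e L k x) = (\<Sum>k\<in>kbox N - K. c k * e L k x)"
        using sub by (simp add: sum_diff)
      moreover have "(\<Sum>k\<in>kbox N - K. \<bar>c k\<bar>) = (\<Sum>k\<in>kbox N. \<bar>c k\<bar>) - (\<Sum>k\<in>K. \<bar>c k\<bar>)"
        using sub by (simp add: sum_diff)
      moreover have "(\<Sum>k\<in>kbox N. \<bar>c k\<bar>) \<le> S" by (intro tail kbox_freqs) auto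
      moreover have "2 / L * ((\<Sum>k\<in>kbox N. \<bar>c k\<bar>) - (\<Sum>k\<in>K. \<bar>c k\<bar>)) \<le> 2 / L * (S - (\<Sum>k\<in>K. \<bar>c k\<bar>))"
        using L calculation(3) by (intro mult_left_mono) auto
      ultimately have "\<bar>(\<Sum>k\<in>kbox N. c k * e L k x) - (\<Sum>k\<in>K. c k * e L k x)\<bar> \<le> 2 / L * (S - (\<Sum>k\<in>K. \<bar>c k\<bar>))"
        using sum_e[where K="kbox N - K" and x=x] by (simp only:)
      then show ?thesis by (simp only: abs_minus_commute)
    qed
    then show "\<exists>N. \<forall>n\<ge>N. \<bar>(\<Sum>k\<in>K. c k * e L k x) - (\<Sum>k\<in>kbox n. c k * e L k x)\<bar> \<le> 2 / L * (S - (\<Sum>k\<in>K. \<bar>c k\<bar>))"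
      by blast
  qed
  have "series_fun L c w"
    unfolding series_fun_def L2_sums_def
  proof
    let ?a = "\<lambda>K. ennreal ((2 / L * (S - (\<Sum>k\<in>K. \<bar>c k\<bar>)))\<^sup>2)"
    have "((\<lambda>K. (\<Sum>k\<in>K. \<bar>c k\<bar>)) \<longlongrightarrow> S) (finite_subsets_at_top freqs)"
      using has_sum_infsum[OF c] by (simp add: has_sum_def S_def)
    then have "((\<lambda>K. ?a K) \<longlongrightarrow> ennreal ((2 / L * (S - S))\<^sup>2)) (finite_subsets_at_top freqs)"
      by (intro tendsto_ennrealI tendsto_power tendsto_mult tendsto_diff tendsto_const)
    then have "((\<lambda>K. emeasure lborel (cell L) * ?a K) \<longlongrightarrow> emeasure lborel (cell L) * ennreal ((2 / L * (S - S))\<^sup>2)) (finite_subsets_at_top freqs)"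
      by (rule ennreal_tendsto_cmult[rotated]) (simp add: cell_def emeasure_lborel_cbox_eq)
    then have lim: "((\<lambda>K. ?a K * emeasure lborel (cell L)) \<longlongrightarrow> 0) (finite_subsets_at_top freqs)" by (simp add: mult.commute)
    show "((\<lambda>K. \<integral>\<^sup>+ x \<in> cell L. ennreal ((norm ((\<Sum>k\<in>K. c k * e L k x) - w x))\<^sup>2) \<partial>lborel) \<longlongrightarrow> 0)
       (finite_subsets_at_top freqs)"
    proof (rule tendsto_sandwich[OF _ _ tendsto_const lim])
      show "\<forall>\<^sub>F K in finite_subsets_at_top freqs. (\<integral>\<^sup>+ x \<in> cell L. ennreal ((norm ((\<Sum>k\<in>K. c k * e L k x) - w x))\<^sup>2) \<partial>lborel)
          \<le> ?a K * emeasure lborel (cell L)"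
      proof (rule eventually_finite_subsets_at_top_weakI)
        fix K assume K: "finite K" "K \<subseteq> freqs"
        have "(\<integral>\<^sup>+ x \<in> cell L. ennreal ((norm ((\<Sum>k\<in>K. c k * e L k x) - w x))\<^sup>2) \<partial>lborel)
           \<le> (\<integral>\<^sup>+ x. ?a K * indicator (cell L) x \<partial>lborel)"
          using close[OF K] by (intro nn_integral_mono mult_right_mono ennreal_leI power_mono) auto
        also have "\<dots> = ?a K * emeasure lborel (cell L)" by (rule nn_integral_cmult_indicator) simp
        finally show "(\<integral>\<^sup>+ x \<in> cell L. ennreal ((norm ((\<Sum>k\<in>K. c k * e L k x) - w x))\<^sup>2) \<partial>lborel)
           \<le> ?a K * emeasure lborel (cell L)" .
      qed
    qed auto
  qed measurable
  then have "C1_rep L c w"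
    using per diff cG by (simp add: C1_rep_def C1_fun_def grad_w)
  then show ?thesis using glim unfolding grad_w[symmetric] by blast
qed

lemma point_grad_limit:
  assumes "L > 0" "(\<lambda>k. \<bar>c k\<bar>) summable_on freqs"
    and "summable B" "\<And>n x. norm (\<Sum>k\<in>shell n. c k *\<^sub>R grad_e L k x) \<le> B n"
  shows "(\<lambda>N. \<Sum>k\<in>kbox N. c k *\<^sub>R grad_e L k x) \<longlonglongrightarrow> point_grad L c x"
proof -
  obtain w where w: "C1_rep L c w" and lim: "\<And>x. (\<lambda>N. \<Sum>k\<in>kbox N. c k *\<^sub>R grad_e L k x) \<longlonglongrightarrow> grad w x"
    using C1_rep_of_shell_bounds[OF assms] by blast
  have cont: "continuous_on UNIV w" if "C1_rep L c w" for w
    using that unfolding C1_rep_def C1_fun_def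
    by (meson continuous_at_imp_continuous_on differentiable_imp_continuous_within)
  have "w' = w" if "C1_rep L c w'" for w'
    by (rule series_fun_unique[OF assms(1), of c]) (use that w cont in \<open>auto simp: C1_rep_def\<close>)
  then have "(THE w. C1_rep L c w) = w" using w by (intro the_equality)
  then show ?thesis using lim by (simp add: point_grad_def)
qed

section \<open>Deterministic bounds for the initial value and the drift\<close>

lemma norm_f_le_half: "norm (f y) \<le> 1 / 2"
proof -
  have "0 < 1 + (norm y)\<^sup>2" by (simp add: add_pos_nonneg)
  moreover have "2 * norm y \<le> 1 + (norm y)\<^sup>2"
    using zero_le_power2[of "norm y - 1"] by (simp add: power2_diff)
  ultimately show ?thesis by (simp add: f_def field_simps)
qed

lemma norm_f_le_inverse: "norm y * norm (f y) \<le> 1"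
proof -
  have "0 < 1 + (norm y)\<^sup>2" by (simp add: add_pos_nonneg)
  then show ?thesis by (simp add: f_def field_simps power2_eq_square)
qed

lemma emeasure_cell: "L > 0 \<Longrightarrow> emeasure lborel (cell L) = ennreal (L\<^sup>2)"
  by (simp add: cell_def emeasure_lborel_cbox_eq Basis_vec2 inner_axis axis_eq_axis vec_def ennreal_mult power2_eq_square)

lemma measure_cell: "L > 0 \<Longrightarrow> measure lborel (cell L) = L\<^sup>2"
  by (simp add: measure_def emeasure_cell)

lemma set_integral_finite_sum:
  fixes F :: "'i \<Rightarrow> 'a \<Rightarrow> real"
  assumes "finite J" "\<And>j. j \<in> J \<Longrightarrow> set_integrable M A (F j)"
  shows "set_integrable M A (\<lambda>x. \<Sum>j\<in>J. F j x)"
    and "(LINT x:A|M. (\<Sum>j\<in>J. F j x)) = (\<Sum>j\<in>J. LINT x:A|M. F j x)"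
proof -
  have i: "integrable M (\<lambda>x. indicator A x *\<^sub>R F j x)" if "j \<in> J" for j
    using assms(2)[OF that] by (simp only: set_integrable_def)
  show "set_integrable M A (\<lambda>x. \<Sum>j\<in>J. F j x)"
    unfolding set_integrable_def scaleR_sum_right using i by (rule Bochner_Integration.integrable_sum)
  show "(LINT x:A|M. (\<Sum>j\<in>J. F j x)) = (\<Sum>j\<in>J. LINT x:A|M. F j x)"
    unfolding set_lebesgue_integral_def scaleR_sum_right using i by (rule Bochner_Integration.integral_sum)
qed

text \<open>Bessel's inequality for the orthogonal system of the gradients, obtained by testing the field
  against \<open>P = (\<Sum>k. (N k / mu L k) *\<^sub>R grad_e L k)\<close>: both the pairing of \<open>V\<close> with \<open>P\<close> and the
  squared norm of \<open>P\<close> equal the left-hand side. The field may be any bounded function: if some product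
  is not integrable, its integral is 0 by convention and the index drops out of the sum.\<close>

lemma bessel_bounded_field:
  fixes V :: "real ^ 2 \<Rightarrow> real ^ 2"
  assumes L: "L > 0" and V: "\<And>x. norm (V x) \<le> b"
    and K: "finite K" "K \<subseteq> freqs"
    and N: "\<And>k. N k = (LINT x:cell L|lborel. V x \<bullet> grad_e L k x)"
  shows "(\<Sum>k\<in>K. (N k)\<^sup>2 / mu L k) \<le> b\<^sup>2 * L\<^sup>2"
proof -
  (* Indices outside J contribute 0, since the integral of a non-integrable function is 0. *)
  define J where "J = {k \<in> K. set_integrable lborel (cell L) (\<lambda>x. V x \<bullet> grad_e L k x)}"
  have J: "finite J" "J \<subseteq> freqs" using K by (auto simp: J_def)
  have b: "b \<ge> 0" using V[of 0] norm_ge_zero order_trans by blast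
  define S where "S = (\<Sum>k\<in>J. (N k)\<^sup>2 / mu L k)"
  have "(\<Sum>k\<in>K. (N k)\<^sup>2 / mu L k) = S"
    unfolding S_def
  proof (rule sum.mono_neutral_right)
    show "\<forall>k\<in>K - J. (N k)\<^sup>2 / mu L k = 0"
      by (auto simp: J_def N set_integrable_def set_lebesgue_integral_def not_integrable_integral_eq)
  qed (use K in \<open>auto simp: J_def\<close>)
  define P where "P = (\<lambda>x. \<Sum>k\<in>J. (N k / mu L k) *\<^sub>R grad_e L k x)"
  have S0: "S \<ge> 0" unfolding S_def using mu_pos[OF L] J by (intro sum_nonneg divide_nonneg_pos) auto
  have SP: "S = (LINT x:cell L|lborel. V x \<bullet> P x)"
    and iVP: "set_integrable lborel (cell L) (\<lambda>x. V x \<bullet> P x)"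
  proof -
    have eq: "V x \<bullet> P x = (\<Sum>k\<in>J. N k / mu L k * (V x \<bullet> grad_e L k x))" for x
      by (simp add: P_def inner_sum_right)
    have i: "set_integrable lborel (cell L) (\<lambda>x. N k / mu L k * (V x \<bullet> grad_e L k x))" if "k \<in> J" for k
      using that by (intro set_integrable_mult_right) (auto simp: J_def)
    show "set_integrable lborel (cell L) (\<lambda>x. V x \<bullet> P x)"
      unfolding eq using i by (intro set_integral_finite_sum J(1))
    show "S = (LINT x:cell L|lborel. V x \<bullet> P x)"
      unfolding eq using i by (subst set_integral_finite_sum(2)[OF J(1)]) (auto simp: S_def N power2_eq_square intro!: sum.cong)
  qed
  have PP: "(LINT x:cell L|lborel. (norm (P x))\<^sup>2) = S"
    and iPP: "set_integrable lborel (cell L) (\<lambda>x. (norm (P x))\<^sup>2)"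
  proof -
    have eq: "(norm (P x))\<^sup>2 = (\<Sum>k\<in>J. \<Sum>l\<in>J. (N k / mu L k) * (N l / mu L l) * (grad_e L k x \<bullet> grad_e L l x))" for x
      unfolding power2_norm_eq_inner P_def inner_sum_left inner_sum_right
      by (simp add: mult_ac inner_commute)
    have i: "set_integrable lborel (cell L) (\<lambda>x. (N k / mu L k) * (N l / mu L l) * (grad_e L k x \<bullet> grad_e L l x))" for k l
      by (intro set_integrable_mult_right) (simp add: grad_e_orthogonal[OF L])
    show "set_integrable lborel (cell L) (\<lambda>x. (norm (P x))\<^sup>2)"
      unfolding eq by (intro set_integral_finite_sum J(1) i)
    have "(LINT x:cell L|lborel. (norm (P x))\<^sup>2)
       = (\<Sum>k\<in>J. \<Sum>l\<in>J. (N k / mu L k) * (N l / mu L l) * (if k = l then mu L k else 0))"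
      unfolding eq set_integral_finite_sum(2)[OF J(1) set_integral_finite_sum(1)[OF J(1) i]]
        set_integral_finite_sum(2)[OF J(1) i] set_integral_mult_right grad_e_orthogonal(2)[OF L] ..
    also have "\<dots> = (\<Sum>k\<in>J. (N k / mu L k) * (N k / mu L k) * mu L k)"
      using J(1) by (simp add: if_distrib[where f = "\<lambda>y. _ * y"] sum.delta cong: if_cong)
    also have "\<dots> = S"
      unfolding S_def using mu_pos[OF L] J(2) by (intro sum.cong) (auto simp: power2_eq_square)
    finally show "(LINT x:cell L|lborel. (norm (P x))\<^sup>2) = S" .
  qed
  have "2 * S \<le> b\<^sup>2 * L\<^sup>2 + S"
  proof -
    have i1: "set_integrable lborel (cell L) (\<lambda>x. b\<^sup>2)"
      by (simp add: set_integrable_def emeasure_cell[OF L])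
    have "2 * S = (LINT x:cell L|lborel. 2 * (V x \<bullet> P x))"
      unfolding SP by simp
    also have "\<dots> \<le> (LINT x:cell L|lborel. b\<^sup>2 + (norm (P x))\<^sup>2)"
    proof (rule set_integral_mono)
      fix x
      have "V x \<bullet> P x \<le> norm (V x) * norm (P x)" by (rule norm_cauchy_schwarz)
      also have "\<dots> \<le> b * norm (P x)" using V by (intro mult_right_mono) auto
      finally show "2 * (V x \<bullet> P x) \<le> b\<^sup>2 + (norm (P x))\<^sup>2"
        using zero_le_power2[of "b - norm (P x)"] by (simp add: power2_diff)
    qed (use i1 iPP iVP in auto)
    also have "\<dots> = b\<^sup>2 * L\<^sup>2 + S"
      unfolding set_integral_add(2)[OF i1 iPP] PP by (simp add: measure_cell[OF L] set_lebesgue_integral_def)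
    finally show ?thesis .
  qed
  then show ?thesis using \<open>(\<Sum>k\<in>K. (N k)\<^sup>2 / mu L k) = S\<close> by simp
qed


lemma exp_neg_le_powr:
  fixes x q :: real
  assumes "x > 0" "0 < q" "q \<le> 1" shows "exp (- x) \<le> x powr (- q)"
proof -
  have "q * ln x \<le> x"
  proof (cases "x \<ge> 1")
    case True
    then have "q * ln x \<le> 1 * ln x" using assms by (intro mult_right_mono) auto
    then show ?thesis using ln_le_minus_one[of x] assms by simp
  next
    case False
    then have "q * ln x \<le> 0" using assms by (intro mult_nonneg_nonpos) auto
    then show ?thesis using assms by simp
  qed
  then show ?thesis using assms by (simp add: powr_def)
qed

lemma mu_powr: 
  assumes "L > 0" "k \<in> freqs" 
  shows "mu L k powr s = (2 * pi / L) powr (2 * s) * fabs k powr (2 * s)"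
proof -
  have "mu L k = (2 * pi / L * fabs k) powr 2"
    using assms fabs_ge_1[OF assms(2)] by (subst powr_numeral) (auto simp: mu_def)
  then have "mu L k powr s = (2 * pi / L * fabs k) powr (2 * s)" by (simp only: powr_powr)
  then show ?thesis using assms(1) fabs_nonneg[of k] by (simp only: powr_mult)
qed

text \<open>The Cauchy-Schwarz inequality, with the weights \<open>mu L k powr (- 3 / 2)\<close>, which are multiples of
  \<open>fabs k powr (- 3)\<close> and therefore summable.\<close>

lemma weighted_sum_le:
  assumes L: "L > 0"
  shows "\<exists>D\<ge>0. \<forall>K h b. finite K \<longrightarrow> K \<subseteq> freqs \<longrightarrow> (\<Sum>k\<in>K. (h k)\<^sup>2) \<le> b \<longrightarrow>
           (\<Sum>k\<in>K. mu L k powr (- 3 / 4) * \<bar>h k\<bar>) \<le> D * sqrt b"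
proof -
  obtain C where C: "C \<ge> 0" "\<And>K. finite K \<Longrightarrow> K \<subseteq> freqs \<Longrightarrow> (\<Sum>k\<in>K. fabs k powr (- (2 + 1))) \<le> C"
    using lattice_sum_bounded[of 1] by auto
  define a where "a = (2 * pi / L) powr (- 3)"
  have a: "a \<ge> 0" by (simp add: a_def)
  have "(\<Sum>k\<in>K. mu L k powr (- 3 / 4) * \<bar>h k\<bar>) \<le> sqrt (a * C) * sqrt b"
    if K: "finite K" "K \<subseteq> freqs" and b: "(\<Sum>k\<in>K. (h k)\<^sup>2) \<le> b" for K h b
  proof -
    have "(\<Sum>k\<in>K. (mu L k powr (- 3 / 4))\<^sup>2) = (\<Sum>k\<in>K. a * fabs k powr (- (2 + 1)))"
    proof (rule sum.cong[OF refl])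
      fix k assume "k \<in> K"
      then have k: "k \<in> freqs" using K by auto
      have "(mu L k powr (- 3 / 4))\<^sup>2 = mu L k powr (- 3 / 2)"
        using mu_pos[OF L k] by (simp add: power2_eq_square powr_add[symmetric])
      then show "(mu L k powr (- 3 / 4))\<^sup>2 = a * fabs k powr (- (2 + 1))"
        by (simp add: mu_powr[OF L k] a_def)
    qed
    also have "\<dots> \<le> a * C" unfolding sum_distrib_left[symmetric] using C(2)[OF K] a by (intro mult_left_mono)
    finally have 1: "(\<Sum>k\<in>K. (mu L k powr (- 3 / 4))\<^sup>2) \<le> a * C" .
    have "(\<Sum>k\<in>K. mu L k powr (- 3 / 4) * \<bar>h k\<bar>)\<^sup>2
        \<le> (\<Sum>k\<in>K. (mu L k powr (- 3 / 4))\<^sup>2) * (\<Sum>k\<in>K. \<bar>h k\<bar>\<^sup>2)"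
      by (rule Cauchy_Schwarz_ineq_sum)
    also have "\<dots> \<le> (a * C) * b" using 1 b a C(1) by (intro mult_mono) (auto intro: sum_nonneg)
    finally have "(\<Sum>k\<in>K. mu L k powr (- 3 / 4) * \<bar>h k\<bar>) \<le> sqrt (a * C * b)"
      by (rule real_le_rsqrt)
    then show ?thesis by (simp add: real_sqrt_mult)
  qed
  then show ?thesis using a C(1) by (intro exI[of _ "sqrt (a * C)"]) auto
qed

text \<open>At a positive time the heat semigroup turns a square summable gradient into an absolutely summable
  one.\<close>

lemma semigroup_gradient_bound:
  assumes L: "L > 0" and t: "t > 0" and u0: "in_H L 1 u0"
  shows "\<exists>R\<ge>0. \<forall>K. finite K \<longrightarrow> K \<subseteq> freqs \<longrightarrow>
           (\<Sum>k\<in>K. sqrt (mu L k) * \<bar>semigroup_A L t u0 k\<bar>) \<le> R"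
proof -
  obtain D where D: "D \<ge> 0" "\<And>K h b. finite K \<Longrightarrow> K \<subseteq> freqs \<Longrightarrow> (\<Sum>k\<in>K. (h k)\<^sup>2) \<le> b \<Longrightarrow>
           (\<Sum>k\<in>K. mu L k powr (- 3 / 4) * \<bar>h k\<bar>) \<le> D * sqrt b"
    using weighted_sum_le[OF L] by blast
  define b where "b = infsum (\<lambda>k. mu L k powr 1 * (u0 k)\<^sup>2) freqs"
  define h where "h = (\<lambda>k. sqrt (mu L k) * u0 k)"
  have "b \<ge> 0" unfolding b_def by (intro infsum_nonneg) auto
  have "(\<Sum>k\<in>K. sqrt (mu L k) * \<bar>semigroup_A L t u0 k\<bar>) \<le> t powr (- 3 / 8) * (D * sqrt b)"
    if K: "finite K" "K \<subseteq> freqs" for K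
  proof -
    have "(\<Sum>k\<in>K. (h k)\<^sup>2) = (\<Sum>k\<in>K. mu L k powr 1 * (u0 k)\<^sup>2)"
      using mu_pos[OF L] K by (intro sum.cong) (auto simp: h_def power_mult_distrib less_imp_le)
    also have "\<dots> \<le> b"
      unfolding b_def using u0 K by (intro finite_sum_le_infsum) (auto simp: in_H_def)
    finally have hb: "(\<Sum>k\<in>K. (h k)\<^sup>2) \<le> b" .
    have "(\<Sum>k\<in>K. sqrt (mu L k) * \<bar>semigroup_A L t u0 k\<bar>) \<le> (\<Sum>k\<in>K. t powr (- 3 / 8) * (mu L k powr (- 3 / 4) * \<bar>h k\<bar>))"
    proof (rule sum_mono)
      fix k assume "k \<in> K"
      then have m: "mu L k > 0" using mu_pos[OF L subsetD[OF K(2)]] by simp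
      have "exp (- (t * (mu L k)\<^sup>2)) \<le> (t * (mu L k)\<^sup>2) powr (- (3 / 8))"
        using m t by (intro exp_neg_le_powr) auto
      also have "\<dots> = t powr (- 3 / 8) * mu L k powr (- 3 / 4)"
        using m t by (simp add: powr_mult powr_powr flip: powr_numeral)
      finally have "exp (- (t * (mu L k)\<^sup>2)) * \<bar>h k\<bar> \<le> t powr (- 3 / 8) * mu L k powr (- 3 / 4) * \<bar>h k\<bar>"
        by (intro mult_right_mono) auto
      then show "sqrt (mu L k) * \<bar>semigroup_A L t u0 k\<bar> \<le> t powr (- 3 / 8) * (mu L k powr (- 3 / 4) * \<bar>h k\<bar>)"
        using m by (simp add: semigroup_A_def h_def abs_mult mult_ac)
    qed
    also have "\<dots> = t powr (- 3 / 8) * (\<Sum>k\<in>K. mu L k powr (- 3 / 4) * \<bar>h k\<bar>)"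
      by (simp add: sum_distrib_left)
    also have "\<dots> \<le> t powr (- 3 / 8) * (D * sqrt b)" using D(2)[OF K hb] by (intro mult_left_mono) auto
    finally show ?thesis .
  qed
  then show ?thesis using D(1) \<open>b \<ge> 0\<close> by (intro exI[of _ "t powr (- 3 / 8) * (D * sqrt b)"]) auto
qed

lemma singular_kernel_integral:
  fixes t :: real
  assumes "t > 0"
  shows "set_integrable lborel {0..t} (\<lambda>s. (t - s) powr (- 7 / 8))"
proof -
  have "((\<lambda>s. s powr (- 7 / 8)) has_integral (t powr (- 7 / 8 + 1) / (- 7 / 8 + 1))) {0..t}"
    using assms by (intro has_integral_powr_from_0) auto
  then have "set_integrable lebesgue {0..t} (\<lambda>s. s powr (- 7 / 8))"
    by (intro nonnegative_absolutely_integrable_1) (auto simp: has_integral_integrable)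
  then have "integrable lborel (\<lambda>s. indicator {0..t} s *\<^sub>R s powr (- 7 / 8))"
    unfolding set_integrable_def by (subst (asm) integrable_completion) auto
  then have "integrable lborel (\<lambda>s. indicator {0..t} (t + (-1) * s) *\<^sub>R (t + (-1) * s) powr (- 7 / 8))"
    by (subst lborel_integrable_real_affine_iff) auto
  moreover have "indicator {0..t} (t + (-1) * s) = (indicator {0..t} s :: real)" for s
    by (auto simp: indicator_def)
  ultimately show ?thesis by (simp add: set_integrable_def)
qed

text \<open>The bound is uniform over all paths \<open>v\<close>, since only \<open>norm (f y) \<le> 1 / 2\<close> is used. The pointwise bound
  of \<open>N k\<close> by a constant times \<open>sqrt (mu L k)\<close> alone would give a logarithmically divergent sum over \<open>k\<close>; Bessel's
  inequality at each time \<open>s\<close> supplies the missing decay. The sum is taken inside the time integral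
  over those \<open>k\<close> whose integrand is integrable, the other terms being 0 by convention.\<close>

lemma drift_gradient_bound:
  assumes L: "L > 0" and t: "t > 0"
  shows "\<exists>R\<ge>0. \<forall>v K. finite K \<longrightarrow> K \<subseteq> freqs \<longrightarrow>
     (\<Sum>k\<in>K. sqrt (mu L k) * \<bar>LINT s:{0..t}|lborel. semigroup_A L (t - s) (nonlinearity L (v s)) k\<bar>) \<le> R"
proof -
  obtain D where D: "D \<ge> 0" "\<And>K h b. finite K \<Longrightarrow> K \<subseteq> freqs \<Longrightarrow> (\<Sum>k\<in>K. (h k)\<^sup>2) \<le> b \<Longrightarrow>
           (\<Sum>k\<in>K. mu L k powr (- 3 / 4) * \<bar>h k\<bar>) \<le> D * sqrt b"
    using weighted_sum_le[OF L] by blast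
  define E where "E = D * sqrt ((1 / 2)\<^sup>2 * L\<^sup>2)"
  have E: "E \<ge> 0" using D(1) by (simp add: E_def)
  define R where "R = (LINT s:{0..t}|lborel. E * (t - s) powr (- 7 / 8))"
  have iE: "set_integrable lborel {0..t} (\<lambda>s. E * (t - s) powr (- 7 / 8))"
    by (intro set_integrable_mult_right singular_kernel_integral t)
  have "R \<ge> 0" unfolding R_def set_lebesgue_integral_def using E
    by (intro integral_nonneg_AE always_eventually) (auto simp: indicator_def)
  have "(\<Sum>k\<in>K. sqrt (mu L k) * \<bar>LINT s:{0..t}|lborel. semigroup_A L (t - s) (nonlinearity L (v s)) k\<bar>) \<le> R"
    if K: "finite K" "K \<subseteq> freqs" for v K
  proof -
    define G where "G = (\<lambda>k s. semigroup_A L (t - s) (nonlinearity L (v s)) k)"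
    define J where "J = {k \<in> K. set_integrable lborel {0..t} (G k)}"
    have J: "finite J" "J \<subseteq> freqs" using K by (auto simp: J_def)
    have "(\<Sum>k\<in>K. sqrt (mu L k) * \<bar>LINT s:{0..t}|lborel. G k s\<bar>) = (\<Sum>k\<in>J. sqrt (mu L k) * \<bar>LINT s:{0..t}|lborel. G k s\<bar>)"
    proof (rule sum.mono_neutral_right)
      show "\<forall>k\<in>K - J. sqrt (mu L k) * \<bar>LINT s:{0..t}|lborel. G k s\<bar> = 0"
        by (auto simp: J_def set_integrable_def set_lebesgue_integral_def not_integrable_integral_eq)
    qed (use K in \<open>auto simp: J_def\<close>)
    also have "\<dots> \<le> (\<Sum>k\<in>J. sqrt (mu L k) * (LINT s:{0..t}|lborel. \<bar>G k s\<bar>))"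
    proof (intro sum_mono mult_left_mono)
      fix k assume "k \<in> J"
      show "\<bar>LINT s:{0..t}|lborel. G k s\<bar> \<le> (LINT s:{0..t}|lborel. \<bar>G k s\<bar>)"
        unfolding set_lebesgue_integral_def
        by (rule order_trans[OF integral_abs_bound]) (simp add: abs_mult)
    qed (auto simp: mu_def)
    also have "\<dots> = (LINT s:{0..t}|lborel. (\<Sum>k\<in>J. sqrt (mu L k) * \<bar>G k s\<bar>))"
    proof -
      have "set_integrable lborel {0..t} (\<lambda>s. sqrt (mu L k) * \<bar>G k s\<bar>)" if "k \<in> J" for k
        using that by (intro set_integrable_mult_right set_integrable_abs) (auto simp: J_def)
      then show ?thesis by (simp add: set_integral_finite_sum(2)[OF J(1)])
    qed
    also have "\<dots> \<le> R"
      unfolding R_def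
    proof (rule set_integral_mono_AE)
      show "set_integrable lborel {0..t} (\<lambda>s. \<Sum>k\<in>J. sqrt (mu L k) * \<bar>G k s\<bar>)"
        by (intro set_integral_finite_sum J set_integrable_mult_right set_integrable_abs) (auto simp: J_def)
      (* At s = t the kernel is 0 powr (- 7 / 8) = 0, which could violate the bound. *)
      have "AE s in lborel. s \<noteq> t" by (rule AE_lborel_singleton)
      then show "AE s \<in> {0..t} in lborel. (\<Sum>k\<in>J. sqrt (mu L k) * \<bar>G k s\<bar>) \<le> E * (t - s) powr (- 7 / 8)"
      proof (eventually_elim, intro impI)
        fix s assume "s \<noteq> t" "s \<in> {0..t}"
        then have r: "t - s > 0" by auto
        define N where "N = nonlinearity L (v s)"
        define h where "h = (\<lambda>k. N k / sqrt (mu L k))"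
        have "(\<Sum>k\<in>J. (N k)\<^sup>2 / mu L k) \<le> (1 / 2)\<^sup>2 * L\<^sup>2"
          by (rule bessel_bounded_field[OF L norm_f_le_half J]) (simp add: N_def nonlinearity_def grad_basis)
        moreover have "(h k)\<^sup>2 = (N k)\<^sup>2 / mu L k" if "k \<in> J" for k
          using mu_pos[OF L, of k] J that by (auto simp: h_def power_divide less_imp_le)
        ultimately have hb: "(\<Sum>k\<in>J. (h k)\<^sup>2) \<le> (1 / 2)\<^sup>2 * L\<^sup>2" by simp
        have "(\<Sum>k\<in>J. sqrt (mu L k) * \<bar>G k s\<bar>) \<le> (\<Sum>k\<in>J. (t - s) powr (- 7 / 8) * (mu L k powr (- 3 / 4) * \<bar>h k\<bar>))"
        proof (rule sum_mono)
          fix k assume "k \<in> J"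
          then have m: "mu L k > 0" using mu_pos[OF L subsetD[OF J(2)]] by simp
          have "exp (- ((t - s) * (mu L k)\<^sup>2)) \<le> ((t - s) * (mu L k)\<^sup>2) powr (- (7 / 8))"
            using m r by (intro exp_neg_le_powr) auto
          also have "\<dots> = (t - s) powr (- 7 / 8) * mu L k powr (- 7 / 4)"
            using m r by (simp add: powr_mult powr_powr flip: powr_numeral)
          finally have "exp (- ((t - s) * (mu L k)\<^sup>2)) * (mu L k * \<bar>h k\<bar>) \<le> (t - s) powr (- 7 / 8) * mu L k powr (- 7 / 4) * (mu L k * \<bar>h k\<bar>)"
            using m by (intro mult_right_mono) auto
          moreover have "mu L k powr (- 7 / 4) * mu L k = mu L k powr (- 3 / 4)"
            using m powr_add[of "mu L k" "- 7 / 4" 1] by simp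
          moreover have "sqrt (mu L k) * \<bar>G k s\<bar> = exp (- ((t - s) * (mu L k)\<^sup>2)) * (mu L k * \<bar>h k\<bar>)"
          proof -
            have "sqrt (mu L k) * \<bar>N k\<bar> = mu L k * \<bar>h k\<bar>"
              using m by (simp add: h_def field_simps abs_divide flip: real_sqrt_mult)
            moreover have "\<bar>G k s\<bar> = exp (- ((t - s) * (mu L k)\<^sup>2)) * \<bar>N k\<bar>"
              unfolding G_def semigroup_A_def N_def abs_mult by (simp only: minus_mult_left abs_exp_cancel)
            ultimately show ?thesis
              using mult.left_commute[of "sqrt (mu L k)" "exp (- ((t - s) * (mu L k)\<^sup>2))" "\<bar>N k\<bar>"] by simp
          qed
          ultimately show "sqrt (mu L k) * \<bar>G k s\<bar> \<le> (t - s) powr (- 7 / 8) * (mu L k powr (- 3 / 4) * \<bar>h k\<bar>)"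
            by (simp add: mult.assoc) (metis mult.assoc)
        qed
        also have "\<dots> = (t - s) powr (- 7 / 8) * (\<Sum>k\<in>J. mu L k powr (- 3 / 4) * \<bar>h k\<bar>)"
          by (simp add: sum_distrib_left)
        also have "\<dots> \<le> (t - s) powr (- 7 / 8) * E"
          unfolding E_def using D(2)[OF J hb] by (intro mult_left_mono) auto
        finally show "(\<Sum>k\<in>J. sqrt (mu L k) * \<bar>G k s\<bar>) \<le> E * (t - s) powr (- 7 / 8)" by (simp add: mult.commute)
      qed
    qed (use iE in auto)
    finally show ?thesis by (simp add: G_def)
  qed
  then show ?thesis using \<open>R \<ge> 0\<close> by blast
qed

section \<open>Centred Gaussian variables and their limits in mean square\<close>

lemma tendsto_ennreal_zeroI:
  fixes a :: "'b \<Rightarrow> ennreal"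
  assumes "\<And>c :: real. c > 0 \<Longrightarrow> eventually (\<lambda>m. a m \<le> ennreal c) F"
  shows "(a \<longlongrightarrow> 0) F"
proof (rule order_tendstoI)
  fix x :: ennreal assume "0 < x"
  then obtain c where c: "c > 0" "ennreal c < x"
    by (metis ennreal_0 ennreal_less_zero_iff gr_zeroI linorder_not_less dense ennreal_cases not_less_zero top.not_eq_extremum)
  then show "eventually (\<lambda>m. a m < x) F"
    using assms[of c] by (auto elim!: eventually_mono)
qed auto

lemma char_normal_density:
  assumes "\<sigma> > 0"
  shows "char (density lborel (normal_density 0 \<sigma>)) u = of_real (exp (- (\<sigma>\<^sup>2 * u\<^sup>2 / 2)))"
proof -
  have d: "distributed std_normal_distribution lborel (\<lambda>x. x) std_normal_density"
    unfolding distributed_def by (simp add: distr_id2)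
  interpret S: real_distribution std_normal_distribution by (rule real_dist_normal_dist)
  have "distributed std_normal_distribution lborel (\<lambda>x. 0 + \<sigma> * x) (normal_density (0 + \<sigma> * 0) (\<bar>\<sigma>\<bar> * 1))"
    by (rule S.normal_density_affine[OF d]) (use assms in auto)
  then have eq: "distr std_normal_distribution lborel (\<lambda>x. \<sigma> * x) = density lborel (normal_density 0 \<sigma>)"
    using assms by (simp add: distributed_def)
  have "char (density lborel (normal_density 0 \<sigma>)) u = (CLINT x|distr std_normal_distribution lborel (\<lambda>x. \<sigma> * x). iexp (u * x))"
    by (simp add: char_def eq)
  also have "\<dots> = (CLINT x|std_normal_distribution. iexp (u * (\<sigma> * x)))"
    by (subst integral_distr) auto
  also have "\<dots> = char std_normal_distribution (u * \<sigma>)"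
    by (simp add: char_def mult_ac)
  finally show ?thesis
    by (simp add: char_std_normal_distribution power_mult_distrib mult_ac)
qed

definition moment_const :: "nat \<Rightarrow> real" where
  "moment_const m = fact (2 * m) / (2 ^ m * fact m)"

context prob_space
begin

text \<open>Centred Gaussian variables described by their characteristic functions. The parameter is the
  variance and it may be 0, so that the class is closed under finite sums and limits in mean square
  without a case distinction for degenerate laws.\<close>

definition gaussian :: "real \<Rightarrow> ('a \<Rightarrow> real) \<Rightarrow> bool" where
  "gaussian v Y \<longleftrightarrow> v \<ge> 0 \<and> random_variable borel Y \<and>
     (\<forall>u. char (distr M borel Y) u = of_real (exp (- (v * u\<^sup>2 / 2))))"

lemma gaussian_normal:
  assumes "distributed M lborel Y (normal_density 0 \<sigma>)" "\<sigma> > 0"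
  shows "gaussian (\<sigma>\<^sup>2) Y"
proof -
  have "random_variable lborel Y" using assms by (simp add: distributed_def)
  then have m: "random_variable borel Y" by simp
  have "distr M borel Y = density lborel (normal_density 0 \<sigma>)"
    using assms(1) unfolding distributed_def by (metis distr_cong sets_lborel)
  then show ?thesis using m assms by (simp add: gaussian_def char_normal_density)
qed

lemma gaussian_zero: "gaussian 0 (\<lambda>_. 0)"
  unfolding gaussian_def char_def by (subst integral_distr) (simp_all add: prob_space)

lemma gaussian_scale:
  assumes "gaussian v Y" shows "gaussian (c\<^sup>2 * v) (\<lambda>\<omega>. c * Y \<omega>)"
proof -
  have [measurable]: "random_variable borel Y" using assms by (simp add: gaussian_def)
  have "char (distr M borel (\<lambda>\<omega>. c * Y \<omega>)) u = char (distr M borel Y) (c * u)" for u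
    by (simp add: char_def integral_distr mult_ac)
  then show ?thesis using assms by (simp add: gaussian_def power_mult_distrib mult_ac)
qed

lemma gaussian_indep_sum:
  assumes "indep_vars (\<lambda>_. borel) Y I" "finite I" "\<And>i. i \<in> I \<Longrightarrow> gaussian (v i) (Y i)"
  shows "gaussian (\<Sum>i\<in>I. v i) (\<lambda>\<omega>. \<Sum>i\<in>I. Y i \<omega>)"
proof -
  have "char (distr M borel (\<lambda>\<omega>. \<Sum>i\<in>I. Y i \<omega>)) u = of_real (exp (- ((\<Sum>i\<in>I. v i) * u\<^sup>2 / 2)))" for u
  proof -
    have "char (distr M borel (\<lambda>\<omega>. \<Sum>i\<in>I. Y i \<omega>)) u = (\<Prod>i\<in>I. of_real (exp (- (v i * u\<^sup>2 / 2))))"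
      unfolding char_distr_sum[OF assms(1)] using assms(3) by (intro prod.cong) (auto simp: gaussian_def)
    also have "\<dots> = of_real (exp (\<Sum>i\<in>I. - (v i * u\<^sup>2 / 2)))"
      using assms(2) by (simp add: exp_sum)
    finally show ?thesis by (simp add: sum_negf sum_distrib_right sum_divide_distrib)
  qed
  moreover have "random_variable borel (\<lambda>\<omega>. \<Sum>i\<in>I. Y i \<omega>)"
    using assms(3) by (intro borel_measurable_sum) (auto simp: gaussian_def)
  moreover have "(\<Sum>i\<in>I. v i) \<ge> 0" using assms(3) by (intro sum_nonneg) (auto simp: gaussian_def)
  ultimately show ?thesis by (simp add: gaussian_def)
qed

lemma nn_integral_abs_le_mean_square:
  fixes Y :: "'a \<Rightarrow> real"
  assumes [measurable]: "random_variable borel Y" and "c > 0"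
  shows "(\<integral>\<^sup>+ \<omega>. ennreal \<bar>Y \<omega>\<bar> \<partial>M) \<le> ennreal c + ennreal (1 / c) * (\<integral>\<^sup>+ \<omega>. ennreal ((Y \<omega>)\<^sup>2) \<partial>M)"
proof -
  have *: "\<bar>y\<bar> \<le> c + (1 / c) * y\<^sup>2" for y :: real
  proof (cases "\<bar>y\<bar> \<le> c")
    case True
    have "(1 / c) * y\<^sup>2 \<ge> 0" using assms by simp
    then show ?thesis using True by linarith
  next
    case False
    then have "\<bar>y\<bar> * c \<le> \<bar>y\<bar> * \<bar>y\<bar>" by (intro mult_left_mono) auto
    then have "\<bar>y\<bar> \<le> (1 / c) * y\<^sup>2" using assms by (simp add: field_simps power2_eq_square)
    then show ?thesis using assms by simp
  qed
  have "(\<integral>\<^sup>+ \<omega>. ennreal \<bar>Y \<omega>\<bar> \<partial>M) \<le> (\<integral>\<^sup>+ \<omega>. ennreal c + ennreal (1 / c) * ennreal ((Y \<omega>)\<^sup>2) \<partial>M)"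
    using assms * by (intro nn_integral_mono) (simp add: ennreal_mult[symmetric] ennreal_plus[symmetric] del: ennreal_plus)
  also have "\<dots> = ennreal c + ennreal (1 / c) * (\<integral>\<^sup>+ \<omega>. ennreal ((Y \<omega>)\<^sup>2) \<partial>M)"
    by (subst nn_integral_add) (auto simp: nn_integral_cmult emeasure_space_1)
  finally show ?thesis .
qed

lemma char_diff_le:
  assumes Y [measurable]: "random_variable borel Y" and Z [measurable]: "random_variable borel Z"
  shows "ennreal (norm (char (distr M borel Y) u - char (distr M borel Z) u))
          \<le> ennreal \<bar>u\<bar> * (\<integral>\<^sup>+ \<omega>. ennreal \<bar>Y \<omega> - Z \<omega>\<bar> \<partial>M)"
proof -
  have i: "integrable M (\<lambda>\<omega>. iexp (u * Y \<omega>))" if "random_variable borel Y" for Y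
    using that by (intro integrable_iexp) auto
  (* The map x \<mapsto> exp (i * u * x) is Lipschitz with constant |u|. *)
  have lip: "norm (iexp (u * a) - iexp (u * b)) \<le> \<bar>u\<bar> * \<bar>a - b\<bar>" for a b :: real
  proof -
    have "iexp (u * a) - iexp (u * b) = iexp (u * b) * (iexp (u * (a - b)) - 1)"
    proof -
      have "iexp (u * a) = iexp (u * b) * iexp (u * (a - b))"
      proof -
        have "\<i> * complex_of_real (u * b) + \<i> * complex_of_real (u * (a - b)) = \<i> * complex_of_real (u * a)"
          by (simp add: algebra_simps)
        then show ?thesis by (metis exp_add)
      qed
      then show ?thesis by (simp add: algebra_simps)
    qed
    also have "norm \<dots> = norm (iexp (u * (a - b)) - 1)"
      by (simp add: norm_mult del: of_real_mult)
    also have "\<dots> \<le> \<bar>u * (a - b)\<bar>"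
      using iexp_approx1[of "u * (a - b)" 0] by simp
    finally show ?thesis by (simp add: abs_mult)
  qed
  have "char (distr M borel Y) u - char (distr M borel Z) u = (CLINT \<omega>|M. iexp (u * Y \<omega>) - iexp (u * Z \<omega>))"
    using i[OF Y] i[OF Z] by (subst Bochner_Integration.integral_diff) (auto simp: char_def integral_distr)
  also have "ennreal (norm \<dots>) \<le> (\<integral>\<^sup>+ \<omega>. ennreal (norm (iexp (u * Y \<omega>) - iexp (u * Z \<omega>))) \<partial>M)"
    by (rule integral_norm_bound_ennreal) (intro Bochner_Integration.integrable_diff i Y Z)
  also have "\<dots> \<le> (\<integral>\<^sup>+ \<omega>. ennreal \<bar>u\<bar> * ennreal \<bar>Y \<omega> - Z \<omega>\<bar> \<partial>M)"
    using lip by (intro nn_integral_mono) (simp add: ennreal_mult[symmetric])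
  also have "\<dots> = ennreal \<bar>u\<bar> * (\<integral>\<^sup>+ \<omega>. ennreal \<bar>Y \<omega> - Z \<omega>\<bar> \<partial>M)"
    by (rule nn_integral_cmult) measurable
  finally show ?thesis .
qed

lemma mean_square_imp_mean:
  assumes [measurable]: "\<And>m. random_variable borel (Y m)"
    and lim: "(\<lambda>m. \<integral>\<^sup>+ \<omega>. ennreal ((Y m \<omega>)\<^sup>2) \<partial>M) \<longlonglongrightarrow> 0"
  shows "(\<lambda>m. \<integral>\<^sup>+ \<omega>. ennreal \<bar>Y m \<omega>\<bar> \<partial>M) \<longlonglongrightarrow> 0"
proof (rule tendsto_ennreal_zeroI)
  fix c :: real assume c: "c > 0"
  have "eventually (\<lambda>m. (\<integral>\<^sup>+ \<omega>. ennreal ((Y m \<omega>)\<^sup>2) \<partial>M) < ennreal ((c/2)\<^sup>2)) sequentially"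
    using c by (intro order_tendstoD(2)[OF lim]) auto
  then show "eventually (\<lambda>m. (\<integral>\<^sup>+ \<omega>. ennreal \<bar>Y m \<omega>\<bar> \<partial>M) \<le> ennreal c) sequentially"
  proof eventually_elim
    case (elim m)
    have "(\<integral>\<^sup>+ \<omega>. ennreal \<bar>Y m \<omega>\<bar> \<partial>M) \<le> ennreal (c/2) + ennreal (1 / (c/2)) * (\<integral>\<^sup>+ \<omega>. ennreal ((Y m \<omega>)\<^sup>2) \<partial>M)"
      using c by (intro nn_integral_abs_le_mean_square) auto
    also have "\<dots> \<le> ennreal (c/2) + ennreal (1 / (c/2)) * ennreal ((c/2)\<^sup>2)"
      using elim by (intro add_left_mono mult_left_mono) auto
    also have "\<dots> = ennreal c"
      using c by (simp add: ennreal_mult[symmetric] ennreal_plus[symmetric] power2_eq_square del: ennreal_plus)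
    finally show ?case .
  qed
qed

text \<open>Convergence in mean square implies convergence in mean, hence of the characteristic functions.\<close>

lemma gaussian_mean_square_limit:
  assumes g: "\<And>m. gaussian (v m) (Y m)" and v: "v \<longlonglongrightarrow> w"
    and Z [measurable]: "random_variable borel Z"
    and lim: "(\<lambda>m. \<integral>\<^sup>+ \<omega>. ennreal ((Y m \<omega> - Z \<omega>)\<^sup>2) \<partial>M) \<longlonglongrightarrow> 0"
  shows "gaussian w Z"
proof -
  have [measurable]: "random_variable borel (Y m)" for m using g[of m] by (simp add: gaussian_def)
  have w: "w \<ge> 0" by (rule LIMSEQ_le_const[OF v]) (use g in \<open>auto simp: gaussian_def\<close>)
  have lim1: "(\<lambda>m. \<integral>\<^sup>+ \<omega>. ennreal \<bar>Y m \<omega> - Z \<omega>\<bar> \<partial>M) \<longlonglongrightarrow> 0"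
    by (rule mean_square_imp_mean[OF _ lim]) measurable
  have "char (distr M borel Z) u = of_real (exp (- (w * u\<^sup>2 / 2)))" for u
  proof (rule LIMSEQ_unique)
    show "(\<lambda>m. char (distr M borel (Y m)) u) \<longlonglongrightarrow> of_real (exp (- (w * u\<^sup>2 / 2)))"
    proof -
      have "(\<lambda>m. of_real (exp (- (v m * u\<^sup>2 / 2))) :: complex) \<longlonglongrightarrow> of_real (exp (- (w * u\<^sup>2 / 2)))"
        using v by (intro tendsto_of_real tendsto_exp tendsto_minus tendsto_divide tendsto_mult tendsto_const) auto
      moreover have "char (distr M borel (Y m)) u = of_real (exp (- (v m * u\<^sup>2 / 2)))" for m
        using g[of m] unfolding gaussian_def by blast
      ultimately show ?thesis by (simp only:)
    qed
    have c: "(\<lambda>m. ennreal \<bar>u\<bar> * (\<integral>\<^sup>+ \<omega>. ennreal \<bar>Y m \<omega> - Z \<omega>\<bar> \<partial>M)) \<longlonglongrightarrow> 0"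
      using ennreal_tendsto_cmult[OF _ lim1, of "ennreal \<bar>u\<bar>"] by simp
    have "(\<lambda>m. ennreal (norm (char (distr M borel (Y m)) u - char (distr M borel Z) u))) \<longlonglongrightarrow> 0"
      by (rule tendsto_sandwich[OF _ _ tendsto_const c])
        (intro always_eventually allI char_diff_le zero_le; measurable)+
    then have "(\<lambda>m. ennreal (norm (char (distr M borel (Y m)) u - char (distr M borel Z) u))) \<longlonglongrightarrow> ennreal 0"
      by simp
    then have "(\<lambda>m. norm (char (distr M borel (Y m)) u - char (distr M borel Z) u)) \<longlonglongrightarrow> 0"
      by (rule tendsto_ennrealD) auto
    then show "(\<lambda>m. char (distr M borel (Y m)) u) \<longlonglongrightarrow> char (distr M borel Z) u"
      by (subst Lim_null) (rule tendsto_norm_zero_cancel)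
  qed
  then show ?thesis using w by (simp add: gaussian_def)
qed

lemma gaussian_distr:
  assumes "gaussian v Y" "v > 0"
  shows "distributed M lborel Y (normal_density 0 (sqrt v))"
proof -
  have [measurable]: "random_variable borel Y" using assms by (simp add: gaussian_def)
  have 1: "real_distribution (distr M borel Y)"
    by (rule real_distribution_distr) measurable
  interpret N: prob_space "density lborel (\<lambda>x. ennreal (normal_density 0 (sqrt v) x))"
    using assms by (intro prob_space_normal_density) auto
  have 2: "real_distribution (density lborel (normal_density 0 (sqrt v)))"
    by unfold_locales auto
  have "distr M borel Y = density lborel (normal_density 0 (sqrt v))"
    using 1 2 by (rule Levy_uniqueness) (use assms in \<open>auto simp: fun_eq_iff char_normal_density gaussian_def\<close>)
  moreover have "distr M lborel Y = distr M borel Y" by (rule distr_cong) auto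
  ultimately show ?thesis by (simp add: distributed_def)
qed

lemma gaussian_even_moment:
  assumes "gaussian v Y" "m > 0"
  shows "(\<integral>\<^sup>+ \<omega>. ennreal ((Y \<omega>) ^ (2 * m)) \<partial>M) = ennreal (moment_const m * v ^ m)"
proof (cases "v = 0")
  case False
  then have v: "v > 0" using assms by (simp add: gaussian_def)
  have "(\<integral>\<^sup>+ \<omega>. ennreal ((Y \<omega>) ^ (2 * m)) \<partial>M) = (\<integral>\<^sup>+ x. ennreal (normal_density 0 (sqrt v) x) * ennreal (x ^ (2 * m)) \<partial>lborel)"
    by (rule distributed_nn_integral[OF gaussian_distr[OF assms(1) v], symmetric]) measurable
  also have "\<dots> = (\<integral>\<^sup>+ x. ennreal (normal_density 0 (sqrt v) x * (x - 0) ^ (2 * m)) \<partial>lborel)"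
    by (simp add: ennreal_mult)
  also have "\<dots> = ennreal (fact (2 * m) / ((2 / (sqrt v)\<^sup>2) ^ m * fact m))"
  proof -
    have "has_bochner_integral lborel (\<lambda>x. normal_density 0 (sqrt v) x * (x - 0) ^ (2 * m)) (fact (2 * m) / ((2 / (sqrt v)\<^sup>2) ^ m * fact m))"
      using v by (intro normal_moment_even) auto
    then show ?thesis
      by (subst nn_integral_eq_integral) (auto simp: has_bochner_integral_iff)
  qed
  also have "fact (2 * m) / ((2 / (sqrt v)\<^sup>2) ^ m * fact m) = moment_const m * v ^ m"
    using v by (simp add: moment_const_def power_divide)
  finally show ?thesis .
next
  case True
  have [measurable]: "random_variable borel Y" using assms by (simp add: gaussian_def)
  have 1: "real_distribution (distr M borel Y)" "real_distribution (distr M borel (\<lambda>_. 0 :: real))"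
    by (rule real_distribution_distr, measurable)+
  have "distr M borel Y = distr M borel (\<lambda>_. 0 :: real)"
    using 1 by (rule Levy_uniqueness)
      (use assms gaussian_zero True in \<open>auto simp: fun_eq_iff gaussian_def\<close>)
  then have "(\<integral>\<^sup>+ x. ennreal (x ^ (2 * m)) \<partial>distr M borel Y) = (\<integral>\<^sup>+ x. ennreal (x ^ (2 * m)) \<partial>distr M borel (\<lambda>_. 0 :: real))"
    by simp
  then have "(\<integral>\<^sup>+ \<omega>. ennreal ((Y \<omega>) ^ (2 * m)) \<partial>M) = (\<integral>\<^sup>+ \<omega>. ennreal (0 ^ (2 * m)) \<partial>M)"
    by (subst (asm) (1 2) nn_integral_distr) simp_all
  then show ?thesis using True \<open>m > 0\<close> by (simp add: power_0_left)
qed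

lemma gaussian_abs_moment:
  assumes "gaussian v Y"
  shows "(\<integral>\<^sup>+ \<omega>. ennreal \<bar>Y \<omega>\<bar> \<partial>M) \<le> ennreal (2 * sqrt v)"
proof -
  have [measurable]: "random_variable borel Y" using assms by (simp add: gaussian_def)
  have "v \<ge> 0" using assms by (simp add: gaussian_def)
  have 2: "(\<integral>\<^sup>+ \<omega>. ennreal ((Y \<omega>)\<^sup>2) \<partial>M) = ennreal v"
    using gaussian_even_moment[OF assms, of 1] by (simp add: moment_const_def)
  show ?thesis
  proof (cases "v = 0")
    case True
    then have "AE \<omega> in M. Y \<omega> = 0" using 2 by (auto simp: nn_integral_0_iff_AE elim!: eventually_mono)
    then have "AE \<omega> in M. ennreal \<bar>Y \<omega>\<bar> = 0" by (auto elim!: eventually_mono)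
    then have "(\<integral>\<^sup>+ \<omega>. ennreal \<bar>Y \<omega>\<bar> \<partial>M) = 0" by (subst nn_integral_0_iff_AE) auto
    then show ?thesis by simp
  next
    case False
    then have v: "v > 0" using \<open>v \<ge> 0\<close> by simp
    have "(\<integral>\<^sup>+ \<omega>. ennreal \<bar>Y \<omega>\<bar> \<partial>M) \<le> ennreal (sqrt v) + ennreal (1 / sqrt v) * ennreal v"
      unfolding 2[symmetric] using v by (intro nn_integral_abs_le_mean_square) auto
    also have "\<dots> = ennreal (sqrt v + 1 / sqrt v * v)"
      using v by (subst ennreal_mult[symmetric]; simp; subst ennreal_plus[symmetric]; simp)
    also have "sqrt v + 1 / sqrt v * v = 2 * sqrt v"
      using v by (simp add: field_simps real_sqrt_mult[symmetric])
    finally show ?thesis .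
  qed
qed

text \<open>The normal density is bounded by the inverse of the standard deviation.\<close>

lemma gaussian_small_ball:
  assumes "gaussian v Y" "v > 0" "R \<ge> 0"
  shows "emeasure M {\<omega>\<in>space M. \<bar>Y \<omega>\<bar> < R} \<le> ennreal (2 * R / sqrt v)"
proof -
  have [measurable]: "random_variable borel Y" using assms by (simp add: gaussian_def)
  have le: "normal_density 0 (sqrt v) x \<le> 1 / sqrt v" for x
  proof -
    have "normal_density 0 (sqrt v) x \<le> 1 / sqrt (2 * pi * v) * 1"
      unfolding normal_density_def using assms by (intro mult_mono) auto
    also have "\<dots> \<le> 1 / sqrt v"
      using assms pi_gt3 by (auto intro!: divide_left_mono mult_pos_pos simp: mult_le_cancel_right1)
    finally show ?thesis .
  qed
  have "emeasure M {\<omega>\<in>space M. \<bar>Y \<omega>\<bar> < R} = emeasure M (Y -` {-R<..<R} \<inter> space M)"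
    by (rule arg_cong[where f = "emeasure M"]) auto
  also have "\<dots> = (\<integral>\<^sup>+ x. ennreal (normal_density 0 (sqrt v) x) * indicator {-R<..<R} x \<partial>lborel)"
    by (rule distributed_emeasure[OF gaussian_distr[OF assms(1,2)]]) simp
  also have "\<dots> \<le> (\<integral>\<^sup>+ x. ennreal (1 / sqrt v) * indicator {-R<..<R} x \<partial>lborel)"
    using le by (intro nn_integral_mono mult_right_mono) (auto intro: ennreal_leI)
  also have "\<dots> = ennreal (1 / sqrt v) * ennreal (2 * R)"
    using assms by (subst nn_integral_cmult_indicator) auto
  also have "\<dots> = ennreal (2 * R / sqrt v)"
    using assms by (simp add: ennreal_mult[symmetric])
  finally show ?thesis .
qed

end

section \<open>Wiener integrals are jointly Gaussian\<close>

definition step_var :: "nat \<Rightarrow> (nat \<Rightarrow> real) \<Rightarrow> (nat \<Rightarrow> real) \<Rightarrow> real" where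
  "step_var n \<tau> c = (\<Sum>i<n. (c i)\<^sup>2 * (\<tau> (Suc i) - \<tau> i))"

lemma mono_nonneg:
  fixes \<tau> :: "nat \<Rightarrow> real"
  assumes "mono \<tau>" "0 \<le> \<tau> 0" shows "0 \<le> \<tau> i"
  using monoD[OF assms(1), of 0 i] assms(2) by simp

context prob_space
begin

lemma wiener_increment_gaussian:
  assumes B: "wiener_process B" and "0 \<le> s" "s \<le> t"
  shows "gaussian (t - s) (\<lambda>\<omega>. B t \<omega> - B s \<omega>)"
proof (cases "s = t")
  case True
  then show ?thesis using gaussian_zero by simp
next
  case False
  have "\<forall>s t. 0 \<le> s \<longrightarrow> s < t \<longrightarrow>
      distributed M lborel (\<lambda>\<omega>. B t \<omega> - B s \<omega>) (normal_density 0 (sqrt (t - s)))"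
    using B unfolding wiener_process_def by (elim conjE)
  moreover have "s < t" using False assms by simp
  ultimately have "distributed M lborel (\<lambda>\<omega>. B t \<omega> - B s \<omega>) (normal_density 0 (sqrt (t - s)))"
    using \<open>0 \<le> s\<close> by blast
  from gaussian_normal[OF this] show ?thesis using False assms by simp
qed

lemma step_integral_gaussian:
  assumes B: "wiener_process B" and "mono \<tau>" "0 \<le> \<tau> 0"
  shows "gaussian (step_var n \<tau> c) (step_integral B n \<tau> c)"
proof -
  have ind: "indep_vars (\<lambda>_. borel) (\<lambda>i \<omega>. B (\<tau> (Suc i)) \<omega> - B (\<tau> i) \<omega>) {..<n}"
  proof -
    have "\<forall>(\<tau> :: nat \<Rightarrow> real) n. 0 \<le> \<tau> 0 \<longrightarrow> mono \<tau> \<longrightarrow>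
        indep_vars (\<lambda>_. borel) (\<lambda>i \<omega>. B (\<tau> (Suc i)) \<omega> - B (\<tau> i) \<omega>) {..<n}"
      using B unfolding wiener_process_def by (elim conjE)
    then show ?thesis using assms(2,3) by blast
  qed
  have "indep_vars (\<lambda>_. borel) (\<lambda>i. (\<lambda>x. c i * x) \<circ> (\<lambda>\<omega>. B (\<tau> (Suc i)) \<omega> - B (\<tau> i) \<omega>)) {..<n}"
    by (rule indep_vars_compose[OF ind]) auto
  then have ind': "indep_vars (\<lambda>_. borel) (\<lambda>i \<omega>. c i * (B (\<tau> (Suc i)) \<omega> - B (\<tau> i) \<omega>)) {..<n}"
    by (simp add: comp_def)
  have "gaussian ((c i)\<^sup>2 * (\<tau> (Suc i) - \<tau> i)) (\<lambda>\<omega>. c i * (B (\<tau> (Suc i)) \<omega> - B (\<tau> i) \<omega>))" for i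
    by (rule gaussian_scale[OF wiener_increment_gaussian[OF B mono_nonneg[OF assms(2,3)] monoD[OF assms(2)]]]) simp
  then show ?thesis
    unfolding step_integral_def[abs_def] step_var_def by (rule gaussian_indep_sum[OF ind' finite_lessThan])
qed

text \<open>A step integral is a measurable function of the restricted path of its Wiener process, so the
  independence of the processes passes on to the step integrals.\<close>

lemma step_integrals_indep:
  assumes "iid_wiener \<beta>" and "K \<subseteq> freqs"
    and "\<And>k. k \<in> K \<Longrightarrow> mono (\<tau> k) \<and> 0 \<le> \<tau> k 0"
  shows "indep_vars (\<lambda>_. borel) (\<lambda>k. step_integral (\<beta> k) (n k) (\<tau> k) (c k)) K"
proof -
  have ind: "indep_vars (\<lambda>_. Pi\<^sub>M {0..} (\<lambda>_. borel)) (\<lambda>k \<omega>. \<lambda>t\<in>{0..}. \<beta> k t \<omega>) K"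
    using assms by (auto simp: iid_wiener_def intro: indep_vars_subset)
  define \<Phi> where "\<Phi> = (\<lambda>k (y :: real \<Rightarrow> real). \<Sum>i<n k. c k i * (y (\<tau> k (Suc i)) - y (\<tau> k i)))"
  have m: "\<Phi> k \<in> borel_measurable (Pi\<^sub>M {0..} (\<lambda>_. borel))" if "k \<in> K" for k
  proof -
    have "\<tau> k i \<in> {0..}" for i using mono_nonneg[of "\<tau> k" i] assms(3)[OF that] by auto
    then show ?thesis unfolding \<Phi>_def
      by (intro borel_measurable_sum borel_measurable_times borel_measurable_diff measurable_component_singleton) auto
  qed
  have "indep_vars (\<lambda>_. borel) (\<lambda>k. \<Phi> k \<circ> (\<lambda>\<omega>. \<lambda>t\<in>{0..}. \<beta> k t \<omega>)) K"
    by (rule indep_vars_compose[OF ind]) (rule m)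
  moreover have "(\<Phi> k \<circ> (\<lambda>\<omega>. \<lambda>t\<in>{0..}. \<beta> k t \<omega>)) = step_integral (\<beta> k) (n k) (\<tau> k) (c k)" if "k \<in> K" for k
  proof -
    have "\<tau> k i \<in> {0..}" for i using mono_nonneg[of "\<tau> k" i] assms(3)[OF that] by auto
    then show ?thesis by (auto simp: \<Phi>_def step_integral_def fun_eq_iff restrict_def)
  qed
  ultimately show ?thesis by (subst indep_vars_cong[OF refl _ refl]) (auto simp: )
qed

lemma step_integral_sum_gaussian:
  assumes "iid_wiener \<beta>" and "finite K" "K \<subseteq> freqs"
    and "\<And>k. k \<in> K \<Longrightarrow> mono (\<tau> k) \<and> 0 \<le> \<tau> k 0"
  shows "gaussian (\<Sum>k\<in>K. (d k)\<^sup>2 * step_var (n k) (\<tau> k) (c k))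
           (\<lambda>\<omega>. \<Sum>k\<in>K. d k * step_integral (\<beta> k) (n k) (\<tau> k) (c k) \<omega>)"
proof (rule gaussian_indep_sum)
  have "indep_vars (\<lambda>_. borel) (\<lambda>k. (\<lambda>x. d k * x) \<circ> step_integral (\<beta> k) (n k) (\<tau> k) (c k)) K"
    by (rule indep_vars_compose[OF step_integrals_indep[OF assms(1,3,4)]]) auto
  then show "indep_vars (\<lambda>_. borel) (\<lambda>k \<omega>. d k * step_integral (\<beta> k) (n k) (\<tau> k) (c k) \<omega>) K"
    by (simp add: comp_def)
  show "gaussian ((d k)\<^sup>2 * step_var (n k) (\<tau> k) (c k)) (\<lambda>\<omega>. d k * step_integral (\<beta> k) (n k) (\<tau> k) (c k) \<omega>)"
    if "k \<in> K" for k
    using assms that by (intro gaussian_scale step_integral_gaussian) (auto simp: iid_wiener_def)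
qed fact

end

text \<open>The intervals of a step function are disjoint, so that mixed products vanish.\<close>

lemma step_fun_square:
  assumes "mono \<tau>"
  shows "(step_fun n \<tau> c s)\<^sup>2 = (\<Sum>i<n. (c i)\<^sup>2 * indicator {\<tau> i<..\<tau> (Suc i)} s)"
proof (induction n)
  case (Suc n)
  have z: "step_fun n \<tau> c s * indicator {\<tau> n<..\<tau> (Suc n)} s = 0"
  proof -
    have "indicator {\<tau> i<..\<tau> (Suc i)} s * indicator {\<tau> n<..\<tau> (Suc n)} s = (0 :: real)" if "i < n" for i
      using monoD[OF assms, of "Suc i" n] that by (auto simp: indicator_def)
    then show ?thesis unfolding step_fun_def sum_distrib_right by (intro sum.neutral) (simp only: mult.assoc, simp)
  qed
  have "(step_fun (Suc n) \<tau> c s)\<^sup>2 = (step_fun n \<tau> c s)\<^sup>2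
      + 2 * c n * (step_fun n \<tau> c s * indicator {\<tau> n<..\<tau> (Suc n)} s)
      + (c n)\<^sup>2 * indicator {\<tau> n<..\<tau> (Suc n)} s"
    by (simp add: step_fun_def power2_eq_square algebra_simps indicator_def)
  then show ?case using Suc z by simp
qed (simp add: step_fun_def)

lemma step_fun_L2:
  assumes "mono \<tau>" "0 \<le> \<tau> 0" "\<tau> n \<le> t"
  shows "set_integrable lborel {0..t} (\<lambda>s. (step_fun n \<tau> c s)\<^sup>2)"
    and "(LINT s:{0..t}|lborel. (step_fun n \<tau> c s)\<^sup>2) = step_var n \<tau> c"
proof -
  have eq: "indicator {0..t} s *\<^sub>R (step_fun n \<tau> c s)\<^sup>2 = (\<Sum>i<n. (c i)\<^sup>2 * indicator {\<tau> i<..\<tau> (Suc i)} s)" for s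
  proof (cases "s \<in> {0..t}")
    case False
    have "indicator {\<tau> i<..\<tau> (Suc i)} s = (0 :: real)" if "i < n" for i
    proof -
      have "0 \<le> \<tau> i" "\<tau> (Suc i) \<le> t"
        using that assms monoD[OF assms(1), of 0 i] monoD[OF assms(1), of "Suc i" n] by auto
      then show ?thesis using False by (auto simp: indicator_def)
    qed
    then show ?thesis using False by simp
  qed (simp add: step_fun_square[OF assms(1)])
  have i: "integrable lborel (\<lambda>s. (c i)\<^sup>2 * indicator {\<tau> i<..\<tau> (Suc i)} s)" for i
    using assms(1) by (intro integrable_mult_right integrable_real_indicator) (auto simp: mono_def)
  show "set_integrable lborel {0..t} (\<lambda>s. (step_fun n \<tau> c s)\<^sup>2)"
    unfolding set_integrable_def eq by (intro Bochner_Integration.integrable_sum i)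
  have "\<tau> i \<le> \<tau> (Suc i)" for i using assms(1) by (simp add: mono_def)
  then show "(LINT s:{0..t}|lborel. (step_fun n \<tau> c s)\<^sup>2) = step_var n \<tau> c"
    unfolding set_lebesgue_integral_def eq step_var_def
    by (subst Bochner_Integration.integral_sum[OF i]) simp
qed

lemma step_fun_measurable [measurable]: "step_fun n \<tau> c \<in> borel_measurable borel"
  unfolding step_fun_def[abs_def] by measurable

text \<open>This is the continuity of the squared norm in \<open>L\<^sup>2\<close>. The splitting with a parameter \<open>\<eta>\<close> keeps the
  argument linear in the squared distance.\<close>

lemma step_var_limit:
  fixes n :: "nat \<Rightarrow> nat"
  assumes \<tau>: "\<And>m. mono (\<tau> m)" "\<And>m. 0 \<le> \<tau> m 0" "\<And>m. \<tau> m (n m) \<le> t"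
    and g: "set_integrable lborel {0..t} (\<lambda>s. (g s)\<^sup>2)" and gm [measurable]: "g \<in> borel_measurable borel"
    and lim: "(\<lambda>m. \<integral>\<^sup>+ s \<in> {0..t}. ennreal ((step_fun (n m) (\<tau> m) (c m) s - g s)\<^sup>2) \<partial>lborel) \<longlonglongrightarrow> 0"
  shows "(\<lambda>m. step_var (n m) (\<tau> m) (c m)) \<longlonglongrightarrow> (LINT s:{0..t}|lborel. (g s)\<^sup>2)"
proof -
  define p where "p = (\<lambda>m s. indicator {0..t} s * step_fun (n m) (\<tau> m) (c m) s)"
  define h where "h = (\<lambda>s. indicator {0..t} s * g s)"
  have sq: "indicator {0..t} s *\<^sub>R (y :: real)\<^sup>2 = (indicator {0..t} s * y)\<^sup>2" for s :: real and y
    by (simp add: indicator_def)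
  have ip: "integrable lborel (\<lambda>s. (p m s)\<^sup>2)" and vp: "(LINT s|lborel. (p m s)\<^sup>2) = step_var (n m) (\<tau> m) (c m)" for m
    using step_fun_L2[OF \<tau>, of m "c m"] unfolding set_integrable_def set_lebesgue_integral_def sq p_def by auto
  have ih: "integrable lborel (\<lambda>s. (h s)\<^sup>2)" and vh: "(LINT s|lborel. (h s)\<^sup>2) = (LINT s:{0..t}|lborel. (g s)\<^sup>2)"
    using g unfolding set_integrable_def set_lebesgue_integral_def sq h_def by auto
  have [measurable]: "p m \<in> borel_measurable borel" "h \<in> borel_measurable borel" for m
    unfolding p_def h_def by measurable
  have id: "integrable lborel (\<lambda>s. (p m s - h s)\<^sup>2)" for m
  proof (rule Bochner_Integration.integrable_bound)
    show "integrable lborel (\<lambda>s. 2 * (p m s)\<^sup>2 + 2 * (h s)\<^sup>2)" using ip ih by auto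
    have "(a - b)\<^sup>2 \<le> 2 * a\<^sup>2 + 2 * b\<^sup>2" for a b :: real
      using zero_le_power2[of "a + b"] by (simp add: power2_eq_square algebra_simps)
    then show "AE s in lborel. norm ((p m s - h s)\<^sup>2) \<le> norm (2 * (p m s)\<^sup>2 + 2 * (h s)\<^sup>2)" by auto
  qed measurable
  define D where "D = (\<lambda>m. LINT s|lborel. (p m s - h s)\<^sup>2)"
  have "(\<integral>\<^sup>+ s \<in> {0..t}. ennreal ((step_fun (n m) (\<tau> m) (c m) s - g s)\<^sup>2) \<partial>lborel) = ennreal (D m)" for m
  proof -
    have "(\<integral>\<^sup>+ s \<in> {0..t}. ennreal ((step_fun (n m) (\<tau> m) (c m) s - g s)\<^sup>2) \<partial>lborel)
        = (\<integral>\<^sup>+ s. ennreal ((p m s - h s)\<^sup>2) \<partial>lborel)"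
      by (intro nn_integral_cong) (simp add: p_def h_def indicator_def)
    then show ?thesis using id by (simp add: D_def nn_integral_eq_integral)
  qed
  then have D: "D \<longlonglongrightarrow> 0"
    using lim tendsto_ennrealD[of D 0 sequentially] by (simp add: D_def)
  have bound: "\<bar>step_var (n m) (\<tau> m) (c m) - (LINT s|lborel. (h s)\<^sup>2)\<bar> \<le> (1 + 1 / \<eta>) * D m + \<eta> * (LINT s|lborel. (h s)\<^sup>2)" if "\<eta> > 0" for m and \<eta> :: real
  proof -
    have pt: "\<bar>a\<^sup>2 - b\<^sup>2\<bar> \<le> (1 + 1 / \<eta>) * (a - b)\<^sup>2 + \<eta> * b\<^sup>2" for a b :: real
    proof -
      have "(x - \<eta> * y)\<^sup>2 / \<eta> = x\<^sup>2 / \<eta> - 2 * (x * y) + \<eta> * y\<^sup>2" for x y :: real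
        using \<open>\<eta> > 0\<close> by (simp add: field_simps power2_eq_square)
      from this[of "\<bar>a - b\<bar>" "\<bar>b\<bar>"]
      have "(\<bar>a - b\<bar> - \<eta> * \<bar>b\<bar>)\<^sup>2 / \<eta> = (a - b)\<^sup>2 / \<eta> - 2 * (\<bar>a - b\<bar> * \<bar>b\<bar>) + \<eta> * b\<^sup>2"
        by simp
      moreover have "0 \<le> (\<bar>a - b\<bar> - \<eta> * \<bar>b\<bar>)\<^sup>2 / \<eta>" using \<open>\<eta> > 0\<close> by simp
      ultimately have 1: "2 * (\<bar>a - b\<bar> * \<bar>b\<bar>) \<le> (a - b)\<^sup>2 / \<eta> + \<eta> * b\<^sup>2" by simp
      have "a\<^sup>2 - b\<^sup>2 = (a - b)\<^sup>2 + 2 * ((a - b) * b)" by (simp add: power2_eq_square algebra_simps)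
      then have "\<bar>a\<^sup>2 - b\<^sup>2\<bar> \<le> (a - b)\<^sup>2 + 2 * (\<bar>a - b\<bar> * \<bar>b\<bar>)"
        using abs_triangle_ineq[of "(a - b)\<^sup>2" "2 * ((a - b) * b)"] by (simp add: abs_mult)
      then show ?thesis using 1 by (simp add: distrib_right)
    qed
    have "\<bar>step_var (n m) (\<tau> m) (c m) - (LINT s|lborel. (h s)\<^sup>2)\<bar> = \<bar>LINT s|lborel. (p m s)\<^sup>2 - (h s)\<^sup>2\<bar>"
      using ip ih by (simp add: vp)
    also have "\<dots> \<le> (LINT s|lborel. \<bar>(p m s)\<^sup>2 - (h s)\<^sup>2\<bar>)"
      by (rule integral_abs_bound)
    also have "\<dots> \<le> (LINT s|lborel. (1 + 1 / \<eta>) * (p m s - h s)\<^sup>2 + \<eta> * (h s)\<^sup>2)"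
      using ip ih id pt by (intro integral_mono) auto
    also have "\<dots> = (1 + 1 / \<eta>) * D m + \<eta> * (LINT s|lborel. (h s)\<^sup>2)"
      using ih id by (simp add: D_def)
    finally show ?thesis .
  qed
  define H where "H = (LINT s|lborel. (h s)\<^sup>2)"
  have H: "H \<ge> 0" by (simp add: H_def)
  have "(\<lambda>m. step_var (n m) (\<tau> m) (c m)) \<longlonglongrightarrow> H"
  proof (rule LIMSEQ_I)
    fix r :: real assume r: "r > 0"
    define \<eta> where "\<eta> = r / (2 * (H + 1))"
    have \<eta>: "\<eta> > 0" "\<eta> * H < r / 2"
    proof -
      show "\<eta> > 0" using r H by (simp add: \<eta>_def)
      then have "\<eta> * H < \<eta> * (H + 1)" by simp
      also have "\<dots> = r / 2" using H by (simp add: \<eta>_def field_simps)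
      finally show "\<eta> * H < r / 2" .
    qed
    have "(\<lambda>m. (1 + 1 / \<eta>) * D m) \<longlonglongrightarrow> (1 + 1 / \<eta>) * 0" by (intro tendsto_intros D)
    then have "\<forall>\<^sub>F m in sequentially. (1 + 1 / \<eta>) * D m < r / 2"
      using r by (intro order_tendstoD) auto
    then have "\<forall>\<^sub>F m in sequentially. norm (step_var (n m) (\<tau> m) (c m) - H) < r"
    proof eventually_elim
      case (elim m)
      then show ?case using bound[OF \<eta>(1), of m] \<eta>(2) unfolding H_def[symmetric] real_norm_def by linarith
    qed
    then show "\<exists>N. \<forall>m\<ge>N. norm (step_var (n m) (\<tau> m) (c m) - H) < r"
      by (simp add: eventually_sequentially)
  qed
  then show ?thesis by (simp add: H_def vh)
qed

context prob_space
begin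

text \<open>The approximating step integrals for the finitely many \<open>k\<close> are combined first, where
  independence is at hand, and only then the limit is taken.\<close>

lemma wiener_integrals_gaussian:
  assumes \<beta>: "iid_wiener \<beta>" and K: "finite K" "K \<subseteq> freqs"
    and X: "\<And>k. k \<in> K \<Longrightarrow> wiener_integral M (\<beta> k) t (g k) (X k)"
    and g: "\<And>k. k \<in> K \<Longrightarrow> set_integrable lborel {0..t} (\<lambda>s. (g k s)\<^sup>2)"
      "\<And>k. k \<in> K \<Longrightarrow> g k \<in> borel_measurable borel"
  shows "gaussian (\<Sum>k\<in>K. (d k)\<^sup>2 * (LINT s:{0..t}|lborel. (g k s)\<^sup>2)) (\<lambda>\<omega>. \<Sum>k\<in>K. d k * X k \<omega>)"
proof -
  define Q where "Q = (\<lambda>k (n :: nat \<Rightarrow> nat, \<tau> :: nat \<Rightarrow> nat \<Rightarrow> real, c :: nat \<Rightarrow> nat \<Rightarrow> real).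
      (\<forall>m. mono (\<tau> m) \<and> 0 \<le> \<tau> m 0 \<and> \<tau> m (n m) \<le> t) \<and>
        (\<lambda>m. \<integral>\<^sup>+ s \<in> {0..t}. ennreal ((step_fun (n m) (\<tau> m) (c m) s - g k s)\<^sup>2) \<partial>lborel) \<longlonglongrightarrow> 0 \<and>
        (\<lambda>m. \<integral>\<^sup>+ \<omega>. ennreal ((step_integral (\<beta> k) (n m) (\<tau> m) (c m) \<omega> - X k \<omega>)\<^sup>2) \<partial>M) \<longlonglongrightarrow> 0)"
  have "\<forall>k\<in>K. \<exists>q. Q k q"
  proof
    fix k assume "k \<in> K"
    from X[OF this] show "\<exists>q. Q k q"
      unfolding wiener_integral_def Q_def split_paired_Ex prod.case by (elim conjE)
  qed
  then obtain q where q: "\<And>k. k \<in> K \<Longrightarrow> Q k (q k)" using bchoice[of K Q] by blast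
  define n where "n = (\<lambda>k. fst (q k))"
  define \<tau> where "\<tau> = (\<lambda>k. fst (snd (q k)))"
  define c where "c = (\<lambda>k. snd (snd (q k)))"
  have Q: "Q k (n k, \<tau> k, c k)" if "k \<in> K" for k using q[OF that] by (simp add: n_def \<tau>_def c_def)
  have \<tau>: "mono (\<tau> k m)" "0 \<le> \<tau> k m 0" "\<tau> k m (n k m) \<le> t" if "k \<in> K" for k m
    using Q[OF that] unfolding Q_def prod.case by blast+
  have lim1: "(\<lambda>m. \<integral>\<^sup>+ s \<in> {0..t}. ennreal ((step_fun (n k m) (\<tau> k m) (c k m) s - g k s)\<^sup>2) \<partial>lborel) \<longlonglongrightarrow> 0" if "k \<in> K" for k
    using Q[OF that] unfolding Q_def prod.case by (elim conjE)
  have lim2: "(\<lambda>m. \<integral>\<^sup>+ \<omega>. ennreal ((step_integral (\<beta> k) (n k m) (\<tau> k m) (c k m) \<omega> - X k \<omega>)\<^sup>2) \<partial>M) \<longlonglongrightarrow> 0" if "k \<in> K" for k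
    using Q[OF that] unfolding Q_def prod.case by (elim conjE)
  define Y where "Y = (\<lambda>k m. step_integral (\<beta> k) (n k m) (\<tau> k m) (c k m))"
  have wp: "wiener_process (\<beta> k)" if "k \<in> K" for k using \<beta> K that by (auto simp: iid_wiener_def)
  have Ym: "random_variable borel (Y k m)" if "k \<in> K" for k m
    using step_integral_gaussian[OF wp[OF that] \<tau>(1,2)[OF that]] unfolding Y_def gaussian_def by blast
  have Xm: "random_variable borel (X k)" if "k \<in> K" for k using X[OF that] by (simp add: wiener_integral_def)
  show ?thesis
  proof (rule gaussian_mean_square_limit)
    show "gaussian (\<Sum>k\<in>K. (d k)\<^sup>2 * step_var (n k m) (\<tau> k m) (c k m)) (\<lambda>\<omega>. \<Sum>k\<in>K. d k * Y k m \<omega>)" for m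
      unfolding Y_def by (intro step_integral_sum_gaussian[OF \<beta> K] conjI \<tau>)
    show "(\<lambda>m. \<Sum>k\<in>K. (d k)\<^sup>2 * step_var (n k m) (\<tau> k m) (c k m)) \<longlonglongrightarrow> (\<Sum>k\<in>K. (d k)\<^sup>2 * (LINT s:{0..t}|lborel. (g k s)\<^sup>2))"
      by (intro tendsto_sum tendsto_mult tendsto_const step_var_limit[OF \<tau> g lim1])
    show "random_variable borel (\<lambda>\<omega>. \<Sum>k\<in>K. d k * X k \<omega>)"
      using Xm by (intro borel_measurable_sum borel_measurable_times) auto
    define a where "a = (\<lambda>k m. \<integral>\<^sup>+ \<omega>. ennreal ((Y k m \<omega> - X k \<omega>)\<^sup>2) \<partial>M)"
    have le: "(\<integral>\<^sup>+ \<omega>. ennreal (((\<Sum>k\<in>K. d k * Y k m \<omega>) - (\<Sum>k\<in>K. d k * X k \<omega>))\<^sup>2) \<partial>M)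
        \<le> (\<Sum>k\<in>K. ennreal (real (card K) * (d k)\<^sup>2) * a k m)" for m
    proof -
      have "((\<Sum>k\<in>K. d k * Y k m \<omega>) - (\<Sum>k\<in>K. d k * X k \<omega>))\<^sup>2 \<le> (\<Sum>k\<in>K. real (card K) * (d k)\<^sup>2 * (Y k m \<omega> - X k \<omega>)\<^sup>2)" for \<omega>
      proof -
        have "((\<Sum>k\<in>K. d k * Y k m \<omega>) - (\<Sum>k\<in>K. d k * X k \<omega>))\<^sup>2 = (\<Sum>k\<in>K. d k * (Y k m \<omega> - X k \<omega>))\<^sup>2"
          by (simp add: sum_subtractf right_diff_distrib)
        also have "\<dots> \<le> (\<Sum>k\<in>K. 1\<^sup>2) * (\<Sum>k\<in>K. (d k * (Y k m \<omega> - X k \<omega>))\<^sup>2)"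
          using Cauchy_Schwarz_ineq_sum[of "\<lambda>_. 1" "\<lambda>k. d k * (Y k m \<omega> - X k \<omega>)" K] by simp
        finally show ?thesis by (simp add: sum_distrib_left power_mult_distrib mult.assoc)
      qed
      then have "(\<integral>\<^sup>+ \<omega>. ennreal (((\<Sum>k\<in>K. d k * Y k m \<omega>) - (\<Sum>k\<in>K. d k * X k \<omega>))\<^sup>2) \<partial>M)
         \<le> (\<integral>\<^sup>+ \<omega>. (\<Sum>k\<in>K. ennreal (real (card K) * (d k)\<^sup>2) * ennreal ((Y k m \<omega> - X k \<omega>)\<^sup>2)) \<partial>M)"
        by (intro nn_integral_mono) (simp add: ennreal_mult[symmetric] ennreal_leI)
      also have "\<dots> = (\<Sum>k\<in>K. \<integral>\<^sup>+ \<omega>. ennreal (real (card K) * (d k)\<^sup>2) * ennreal ((Y k m \<omega> - X k \<omega>)\<^sup>2) \<partial>M)"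
        using Ym Xm by (intro nn_integral_sum) auto
      also have "\<dots> = (\<Sum>k\<in>K. ennreal (real (card K) * (d k)\<^sup>2) * a k m)"
        unfolding a_def using Ym Xm by (intro sum.cong nn_integral_cmult refl) auto
      finally show ?thesis .
    qed
    have "(\<lambda>m. \<Sum>k\<in>K. ennreal (real (card K) * (d k)\<^sup>2) * a k m) \<longlonglongrightarrow> (\<Sum>k\<in>K. ennreal (real (card K) * (d k)\<^sup>2) * 0)"
      by (intro tendsto_sum ennreal_tendsto_cmult) (simp_all add: a_def Y_def lim2)
    then have lim0: "(\<lambda>m. \<Sum>k\<in>K. ennreal (real (card K) * (d k)\<^sup>2) * a k m) \<longlonglongrightarrow> 0" by simp
    show "(\<lambda>m. \<integral>\<^sup>+ \<omega>. ennreal (((\<Sum>k\<in>K. d k * Y k m \<omega>) - (\<Sum>k\<in>K. d k * X k \<omega>))\<^sup>2) \<partial>M) \<longlonglongrightarrow> 0"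
      by (rule tendsto_sandwich[OF _ _ tendsto_const lim0]) (intro always_eventually allI le zero_le)+
  qed
qed

end

lemma exp_square_integral:
  fixes a t :: real
  assumes "a > 0" "t \<ge> 0"
  shows "set_integrable lborel {0..t} (\<lambda>s. (exp (- (t - s) * a))\<^sup>2)"
    and "(LINT s:{0..t}|lborel. (exp (- (t - s) * a))\<^sup>2) = (1 - exp (- 2 * t * a)) / (2 * a)"
proof -
  show "set_integrable lborel {0..t} (\<lambda>s. (exp (- (t - s) * a))\<^sup>2)"
    by (intro borel_integrable_atLeastAtMost' continuous_intros)
  have "(LINT s|lborel. indicator {0..t} s *\<^sub>R (exp (- (t - s) * a))\<^sup>2)
     = exp (- 2 * (t - t) * a) / (2 * a) - exp (- 2 * (t - 0) * a) / (2 * a)"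
  proof (rule integral_FTC_atLeastAtMost)
    show "((\<lambda>s. exp (- 2 * (t - s) * a) / (2 * a)) has_vector_derivative (exp (- (t - s) * a))\<^sup>2) (at s within {0..t})" for s
      unfolding has_real_derivative_iff_has_vector_derivative[symmetric] exp_double[symmetric]
      using assms by (auto intro!: derivative_eq_intros simp: algebra_simps)
  qed (use assms in \<open>auto intro!: continuous_intros\<close>)
  then show "(LINT s:{0..t}|lborel. (exp (- (t - s) * a))\<^sup>2) = (1 - exp (- 2 * t * a)) / (2 * a)"
    by (simp add: set_lebesgue_integral_def diff_divide_distrib)
qed

section \<open>Uniform convergence of Gaussian Fourier series\<close>

lemma cell_grid_approx:
  assumes L: "L > 0" and m: "m > 0" and x: "x \<in> cell L"
  shows "\<exists>i\<le>m. \<exists>j\<le>m. norm (x - vector [L * real i / real m, L * real j / real m]) \<le> 2 * L / real m"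
proof -
  have *: "\<exists>i\<le>m. \<bar>z - L * real i / real m\<bar> \<le> L / real m" if z: "0 \<le> z" "z \<le> L" for z
  proof -
    define y where "y = z * real m / L"
    have y: "0 \<le> y" "y \<le> real m" using z L m by (auto simp: y_def field_simps)
    define i where "i = nat \<lfloor>y\<rfloor>"
    have i: "real i \<le> y" "y \<le> real i + 1" using y by (auto simp: i_def)
    then have "i \<le> m" using y by linarith
    moreover have "z - L * real i / real m = (y - real i) * (L / real m)"
      using L m by (simp add: y_def field_simps)
    then have "\<bar>z - L * real i / real m\<bar> \<le> 1 * (L / real m)"
      using i L m by (simp only: abs_mult) (intro mult_mono, auto)
    ultimately show ?thesis by auto
  qed
  obtain i where i: "i \<le> m" "\<bar>x $ 1 - L * real i / real m\<bar> \<le> L / real m" using *[of "x $ 1"] x by (auto simp: mem_cell)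
  obtain j where j: "j \<le> m" "\<bar>x $ 2 - L * real j / real m\<bar> \<le> L / real m" using *[of "x $ 2"] x by (auto simp: mem_cell)
  have "norm (x - vector [L * real i / real m, L * real j / real m])
     \<le> \<bar>x $ 1 - L * real i / real m\<bar> + \<bar>x $ 2 - L * real j / real m\<bar>"
    using norm_le_l1_cart[of "x - vector [L * real i / real m, L * real j / real m]"] by (simp add: UNIV_2 vector_2)
  also have "\<dots> \<le> 2 * L / real m" using i j by simp
  finally show ?thesis using i j by blast
qed

text \<open>A value that exceeds \<open>r\<close> is dominated by a high power of its ratio to \<open>r\<close>. This inequality replaces
  a union bound over the grid by a sum of moments.\<close>

lemma abs_le_moment:
  fixes y r :: real
  assumes "r > 0" "m > 0" "r \<le> 1"
  shows "\<bar>y\<bar> \<le> r + y ^ (2 * m) / r ^ (2 * m)"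
proof (cases "\<bar>y\<bar> \<le> r")
  case True
  have "0 \<le> y ^ (2 * m) / r ^ (2 * m)" using assms by (intro divide_nonneg_nonneg) (auto simp: power_mult)
  then show ?thesis using True by linarith
next
  case False
  then have 1: "1 \<le> \<bar>y\<bar> / r" using assms by simp
  have "\<bar>y\<bar> \<le> \<bar>y\<bar> / r" using assms mult_right_mono[of r 1 "\<bar>y\<bar>"] by (simp add: field_simps)
  also have "\<dots> \<le> (\<bar>y\<bar> / r) ^ (2 * m)" using 1 assms by (intro self_le_power) auto
  also have "\<dots> = y ^ (2 * m) / r ^ (2 * m)" by (simp add: power_divide power_even_abs)
  finally show ?thesis using assms by simp
qed

context prob_space
begin

lemma AE_summable_of_mean:
  fixes Y :: "nat \<Rightarrow> 'a \<Rightarrow> real"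
  assumes [measurable]: "\<And>n. random_variable borel (Y n)" and Y: "\<And>n \<omega>. 0 \<le> Y n \<omega>"
    and a: "\<And>n. (\<integral>\<^sup>+ \<omega>. ennreal (Y n \<omega>) \<partial>M) \<le> ennreal (a n)" "summable a" "\<And>n. 0 \<le> a n"
  shows "AE \<omega> in M. summable (\<lambda>n. Y n \<omega>)"
proof -
  have "(\<integral>\<^sup>+ \<omega>. (\<Sum>n. ennreal (Y n \<omega>)) \<partial>M) = (\<Sum>n. \<integral>\<^sup>+ \<omega>. ennreal (Y n \<omega>) \<partial>M)"
    by (rule nn_integral_suminf) measurable
  also have "\<dots> \<le> (\<Sum>n. ennreal (a n))" by (intro suminf_le a(1)) auto
  also have "\<dots> = ennreal (\<Sum>n. a n)" using a by (intro suminf_ennreal2) auto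
  finally have "(\<integral>\<^sup>+ \<omega>. (\<Sum>n. ennreal (Y n \<omega>)) \<partial>M) \<noteq> \<infinity>"
    using le_less_trans[OF _ ennreal_less_top] by (metis infinity_ennreal_def less_irrefl)
  then have "AE \<omega> in M. (\<Sum>n. ennreal (Y n \<omega>)) \<noteq> \<infinity>"
    by (intro nn_integral_PInf_AE) auto
  then show ?thesis
    by eventually_elim (intro summable_suminf_not_top Y, simp)
qed

text \<open>The joint law of independent centred Gaussian coefficients with variances \<open>v\<close>, encoded by the laws of
  their finite linear combinations.\<close>

definition gaussian_family :: "(freq \<Rightarrow> 'a \<Rightarrow> real) \<Rightarrow> (freq \<Rightarrow> real) \<Rightarrow> bool" where
  "gaussian_family \<xi> v \<longleftrightarrow> (\<forall>K d. finite K \<longrightarrow> K \<subseteq> freqs \<longrightarrow>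
     gaussian (\<Sum>k\<in>K. (d k)\<^sup>2 * v k) (\<lambda>\<omega>. \<Sum>k\<in>K. d k * \<xi> k \<omega>))"

lemma gaussian_family_single:
  assumes "gaussian_family \<xi> v" "k \<in> freqs" shows "gaussian (v k) (\<xi> k)"
  using assms(1)[unfolded gaussian_family_def, rule_format, of "{k}" "\<lambda>_. 1"] assms(2) by simp

lemma gaussian_family_abs_mean:
  assumes \<xi>: "gaussian_family \<xi> v" and v: "\<And>n k. k \<in> shell n \<Longrightarrow> v k \<le> (S / 4 ^ n)\<^sup>2" and S: "S \<ge> 0" and D: "D \<ge> 0"
    and c: "\<And>k. k \<in> shell n \<Longrightarrow> 0 \<le> c k \<and> c k \<le> D"
  shows "(\<integral>\<^sup>+ \<omega>. ennreal (\<Sum>k\<in>shell n. c k * \<bar>\<xi> k \<omega>\<bar>) \<partial>M) \<le> ennreal (32 * S * D)"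
proof -
  have fr: "k \<in> freqs" if "k \<in> shell n" for k using that shell_freqs by blast
  have m: "random_variable borel (\<xi> k)" if "k \<in> shell n" for k
    using gaussian_family_single[OF \<xi> fr[OF that]] by (simp add: gaussian_def)
  have "(\<integral>\<^sup>+ \<omega>. ennreal (\<Sum>k\<in>shell n. c k * \<bar>\<xi> k \<omega>\<bar>) \<partial>M)
      = (\<integral>\<^sup>+ \<omega>. (\<Sum>k\<in>shell n. ennreal (c k) * ennreal \<bar>\<xi> k \<omega>\<bar>) \<partial>M)"
    using c by (intro nn_integral_cong) (simp add: ennreal_mult[symmetric])
  also have "\<dots> = (\<Sum>k\<in>shell n. \<integral>\<^sup>+ \<omega>. ennreal (c k) * ennreal \<bar>\<xi> k \<omega>\<bar> \<partial>M)"
    using m by (intro nn_integral_sum) auto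
  also have "\<dots> = (\<Sum>k\<in>shell n. ennreal (c k) * (\<integral>\<^sup>+ \<omega>. ennreal \<bar>\<xi> k \<omega>\<bar> \<partial>M))"
    using m by (intro sum.cong nn_integral_cmult refl) auto
  also have "\<dots> \<le> (\<Sum>k\<in>shell n. ennreal (D * (2 * (S / 4 ^ n))))"
  proof (rule sum_mono)
    fix k assume k: "k \<in> shell n"
    have "sqrt (v k) \<le> S / 4 ^ n" using v[OF k] S by (intro real_le_lsqrt) auto
    then have "(\<integral>\<^sup>+ \<omega>. ennreal \<bar>\<xi> k \<omega>\<bar> \<partial>M) \<le> ennreal (2 * (S / 4 ^ n))"
      using gaussian_abs_moment[OF gaussian_family_single[OF \<xi> fr[OF k]]]
      by (rule_tac order_trans[OF _ ennreal_leI]) auto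
    then have "ennreal (c k) * (\<integral>\<^sup>+ \<omega>. ennreal \<bar>\<xi> k \<omega>\<bar> \<partial>M) \<le> ennreal D * ennreal (2 * (S / 4 ^ n))"
      using c[OF k] by (intro mult_mono ennreal_leI) auto
    then show "ennreal (c k) * (\<integral>\<^sup>+ \<omega>. ennreal \<bar>\<xi> k \<omega>\<bar> \<partial>M) \<le> ennreal (D * (2 * (S / 4 ^ n)))"
      by (subst ennreal_mult) (use D S in auto)
  qed
  also have "\<dots> = ennreal (real (card (shell n)) * (D * (2 * (S / 4 ^ n))))"
    using D S by (subst sum_ennreal) auto
  also have "\<dots> \<le> ennreal (32 * S * D)"
  proof (rule ennreal_leI)
    have "real (card (shell n)) * (D * (2 * (S / 4 ^ n))) \<le> 16 * 4 ^ n * (D * (2 * (S / 4 ^ n)))"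
      using D S by (intro mult_right_mono card_shell_le) auto
    then show "real (card (shell n)) * (D * (2 * (S / 4 ^ n))) \<le> 32 * S * D" by (simp add: mult_ac)
  qed
  finally show ?thesis .
qed


text \<open>On the \<open>n\<close>-th shell there are at most \<open>16 * 4 ^ n\<close> coefficients, each with mean absolute value
  at most of order \<open>q ^ n / 4 ^ n\<close>.\<close>

lemma gaussian_family_coeffs_summable:
  assumes \<xi>: "gaussian_family \<xi> v" and v: "\<And>n k. k \<in> shell n \<Longrightarrow> v k \<le> (S / 4 ^ n)\<^sup>2" and S: "S \<ge> 0"
    and b: "\<And>n k. k \<in> shell n \<Longrightarrow> \<bar>b k\<bar> \<le> B * q ^ n" and q: "0 < q" "q < 1" and B: "B \<ge> 0"
  shows "AE \<omega> in M. (\<lambda>k. \<bar>b k * \<xi> k \<omega>\<bar>) summable_on freqs"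
proof -
  define Y where "Y = (\<lambda>n \<omega>. \<Sum>k\<in>shell n. \<bar>b k\<bar> * \<bar>\<xi> k \<omega>\<bar>)"
  have m: "random_variable borel (\<xi> k)" if "k \<in> shell n" for k n
    using gaussian_family_single[OF \<xi>, of k] shell_freqs that by (auto simp: gaussian_def)
  have "AE \<omega> in M. summable (\<lambda>n. Y n \<omega>)"
  proof (rule AE_summable_of_mean)
    show "random_variable borel (Y n)" for n
      unfolding Y_def using m by (intro borel_measurable_sum) auto
    show "0 \<le> Y n \<omega>" for n \<omega> unfolding Y_def by (intro sum_nonneg) auto
    show "(\<integral>\<^sup>+ \<omega>. ennreal (Y n \<omega>) \<partial>M) \<le> ennreal (32 * S * (B * q ^ n))" for n
      unfolding Y_def using b B q S by (intro gaussian_family_abs_mean[OF \<xi> v]) auto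
    show "summable (\<lambda>n. 32 * S * (B * q ^ n))"
      using q by (intro summable_mult summable_geometric) auto
  qed (use S B q in auto)
  then show ?thesis
  proof eventually_elim
    case (elim \<omega>)
    show ?case
    proof (rule nonneg_bdd_above_summable_on)
      have "(\<Sum>k\<in>K. \<bar>b k * \<xi> k \<omega>\<bar>) \<le> (\<Sum>n. Y n \<omega>)" if "finite K" "K \<subseteq> freqs" for K
        using elim that by (intro sum_le_of_shells) (auto simp: Y_def abs_mult)
      then show "bdd_above (sum (\<lambda>k. \<bar>b k * \<xi> k \<omega>\<bar>) ` {K. K \<subseteq> freqs \<and> finite K})"
        by (intro bdd_aboveI[of _ "\<Sum>n. Y n \<omega>"]) auto
    qed auto
  qed
qed

text \<open>The \<open>n\<close>-th shell sum \<open>P n\<close> has at every point a variance at most of order \<open>q ^ (2 * n)\<close>. On a grid with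
  spacing \<open>L / 8 ^ n\<close> its absolute value is dominated by \<open>r n = q powr (n / 2)\<close> plus the sum over
  the grid of \<open>P n y ^ (2 * m) / r n ^ (2 * m)\<close>. The latter has mean of order
  \<open>(64 * q ^ m) ^ n\<close>, which is summable for large \<open>m\<close>. Off the grid the crude Lipschitz bound, whose
  mean is of order \<open>4 ^ n\<close>, is compensated by the spacing. So all suprema are dominated by the terms
  of an almost surely convergent series.\<close>

lemma gaussian_family_shell_sup:
  assumes L: "L > 0"
    and \<xi>: "gaussian_family \<xi> v" and v: "\<And>n k. k \<in> shell n \<Longrightarrow> 0 \<le> v k \<and> v k \<le> (S / 4 ^ n)\<^sup>2" and S: "S \<ge> 0"
    and b: "\<And>n k. k \<in> shell n \<Longrightarrow> \<bar>b k\<bar> \<le> B * q ^ n" and q: "0 < q" "q < 1" and B: "B \<ge> 0"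
    and \<phi>: "\<And>n k x. k \<in> shell n \<Longrightarrow> \<bar>\<phi> k x\<bar> \<le> A * 2 ^ n"
      "\<And>n k x y. k \<in> shell n \<Longrightarrow> \<bar>\<phi> k x - \<phi> k y\<bar> \<le> A * 4 ^ n * norm (x - y)" and A: "A \<ge> 0"
  shows "AE \<omega> in M. \<exists>C. summable C \<and> (\<forall>n. \<forall>x\<in>cell L. \<bar>\<Sum>k\<in>shell n. b k * \<phi> k x * \<xi> k \<omega>\<bar> \<le> C n)"
proof -
  define P where "P = (\<lambda>n x \<omega>. \<Sum>k\<in>shell n. b k * \<phi> k x * \<xi> k \<omega>)"
  define V where "V = 16 * (B * A * S)\<^sup>2"
  have V: "V \<ge> 0" by (simp add: V_def)
  have fr: "k \<in> freqs" if "k \<in> shell n" for k n using that shell_freqs by blast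
  have m: "random_variable borel (\<xi> k)" if "k \<in> shell n" for k n
    using gaussian_family_single[OF \<xi> fr[OF that]] by (simp add: gaussian_def)
  have Pm [measurable]: "random_variable borel (P n x)" for n x
    unfolding P_def using m by (intro borel_measurable_sum) auto
  have Pg: "\<exists>w. 0 \<le> w \<and> w \<le> V * (q ^ n)\<^sup>2 \<and> gaussian w (P n x)" for n x
  proof (intro exI conjI)
    show "gaussian (\<Sum>k\<in>shell n. (b k * \<phi> k x)\<^sup>2 * v k) (P n x)"
      using \<xi> shell_freqs[of n] unfolding gaussian_family_def P_def by simp
    show "0 \<le> (\<Sum>k\<in>shell n. (b k * \<phi> k x)\<^sup>2 * v k)" using v by (intro sum_nonneg) auto
    have "(\<Sum>k\<in>shell n. (b k * \<phi> k x)\<^sup>2 * v k) \<le> (\<Sum>k\<in>shell n. (B * q ^ n * (A * 2 ^ n))\<^sup>2 * (S / 4 ^ n)\<^sup>2)"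
    proof (rule sum_mono)
      fix k assume k: "k \<in> shell n"
      have "\<bar>b k * \<phi> k x\<bar> \<le> B * q ^ n * (A * 2 ^ n)"
        unfolding abs_mult using b[OF k] \<phi>(1)[OF k] B q by (intro mult_mono) auto
      then have "(b k * \<phi> k x)\<^sup>2 \<le> (B * q ^ n * (A * 2 ^ n))\<^sup>2"
        by (metis abs_ge_zero power2_abs power_mono)
      then show "(b k * \<phi> k x)\<^sup>2 * v k \<le> (B * q ^ n * (A * 2 ^ n))\<^sup>2 * (S / 4 ^ n)\<^sup>2"
        using v[OF k] by (intro mult_mono) auto
    qed
    also have "\<dots> = real (card (shell n)) * ((B * q ^ n * (A * 2 ^ n))\<^sup>2 * (S / 4 ^ n)\<^sup>2)" by simp
    also have "\<dots> \<le> 16 * 4 ^ n * ((B * q ^ n * (A * 2 ^ n))\<^sup>2 * (S / 4 ^ n)\<^sup>2)"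
      by (intro mult_right_mono card_shell_le) auto
    also have "\<dots> = V * (q ^ n)\<^sup>2"
    proof -
      have four: "(4::real) ^ n = 2 ^ n * 2 ^ n" by (simp flip: power_mult_distrib)
      show ?thesis unfolding four V_def by (simp add: power2_eq_square field_simps)
    qed
    finally show "(\<Sum>k\<in>shell n. (b k * \<phi> k x)\<^sup>2 * v k) \<le> V * (q ^ n)\<^sup>2" .
  qed
  obtain p where p: "q ^ p < 1 / 128" using real_arch_pow_inv[of "1/128" q] q by auto
  (* The n-th grid has of the order of 64 ^ n points, so 128 leaves a factor (1 / 2) ^ n for summability. *)
  define m where "m = Suc p"
  have m0: "m > 0" by (simp add: m_def)
  have qm: "128 * q ^ m \<le> 1"
  proof -
    have "q ^ m \<le> q ^ p" using q by (intro power_decreasing) (auto simp: m_def)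
    then show ?thesis using p by simp
  qed
  define r where "r = (\<lambda>n :: nat. sqrt q ^ n)"
  have r: "0 < r n" "r n \<le> 1" "(r n)\<^sup>2 = q ^ n" for n
  proof -
    show "0 < r n" "r n \<le> 1" using q by (simp_all add: r_def power_le_one)
    have "(r n)\<^sup>2 = (sqrt q * sqrt q) ^ n" unfolding r_def power2_eq_square by (simp only: power_mult_distrib)
    then show "(r n)\<^sup>2 = q ^ n" using q by simp
  qed
  define \<Gamma> where "\<Gamma> = (\<lambda>n :: nat. (\<lambda>(i, j). vector [L * real i / 8 ^ n, L * real j / 8 ^ n] :: real^2) ` ({..(8::nat) ^ n} \<times> {..(8::nat) ^ n}))"
  have \<Gamma>: "finite (\<Gamma> n)" "real (card (\<Gamma> n)) \<le> 4 * 64 ^ n" for n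
  proof -
    show "finite (\<Gamma> n)" by (simp add: \<Gamma>_def)
    have "card (\<Gamma> n) \<le> card ({..(8::nat) ^ n} \<times> {..(8::nat) ^ n})" unfolding \<Gamma>_def by (rule card_image_le) auto
    also have "\<dots> = (8 ^ n + 1) * (8 ^ n + 1)" by (simp add: card_cartesian_product)
    also have "\<dots> \<le> (2 * 8 ^ n) * (2 * 8 ^ n)" by (intro mult_mono) auto
    also have "\<dots> = 4 * (8 * 8) ^ n" by (simp only: power_mult_distrib)
    finally have "card (\<Gamma> n) \<le> 4 * 64 ^ n" by simp
    then have "real (card (\<Gamma> n)) \<le> real (4 * 64 ^ n)" by (rule of_nat_mono)
    then show "real (card (\<Gamma> n)) \<le> 4 * 64 ^ n" by simp
  qed
  define Y1 where "Y1 = (\<lambda>n \<omega>. (\<Sum>y\<in>\<Gamma> n. P n y \<omega> ^ (2 * m)) / r n ^ (2 * m))"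
  define Y2 where "Y2 = (\<lambda>n \<omega>. \<Sum>k\<in>shell n. (\<bar>b k\<bar> * A * (2 * L) / 2 ^ n) * \<bar>\<xi> k \<omega>\<bar>)"
  have ev: "0 \<le> z ^ (2 * m)" for z :: real by (simp add: power_mult)
  have 1: "AE \<omega> in M. summable (\<lambda>n. Y1 n \<omega>)"
  proof (rule AE_summable_of_mean)
    show "random_variable borel (Y1 n)" for n unfolding Y1_def by measurable
    show "0 \<le> Y1 n \<omega>" for n \<omega>
      unfolding Y1_def using r(1)[of n] ev by (intro divide_nonneg_nonneg sum_nonneg) auto
    have mc: "moment_const m \<ge> 0" by (simp add: moment_const_def)
    show "(\<integral>\<^sup>+ \<omega>. ennreal (Y1 n \<omega>) \<partial>M) \<le> ennreal (4 * moment_const m * V ^ m * (1 / 2) ^ n)" for n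
    proof -
      have "(\<integral>\<^sup>+ \<omega>. ennreal (Y1 n \<omega>) \<partial>M) = (\<integral>\<^sup>+ \<omega>. (\<Sum>y\<in>\<Gamma> n. ennreal (1 / r n ^ (2 * m)) * ennreal (P n y \<omega> ^ (2 * m))) \<partial>M)"
        using ev r(1)[of n] by (intro nn_integral_cong)
          (simp add: Y1_def sum_divide_distrib ennreal_mult[symmetric])
      also have "\<dots> = (\<Sum>y\<in>\<Gamma> n. \<integral>\<^sup>+ \<omega>. ennreal (1 / r n ^ (2 * m)) * ennreal (P n y \<omega> ^ (2 * m)) \<partial>M)"
        by (rule nn_integral_sum) measurable
      also have "\<dots> = (\<Sum>y\<in>\<Gamma> n. ennreal (1 / r n ^ (2 * m)) * (\<integral>\<^sup>+ \<omega>. ennreal (P n y \<omega> ^ (2 * m)) \<partial>M))"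
        by (intro sum.cong nn_integral_cmult refl) measurable
      also have "\<dots> \<le> (\<Sum>y\<in>\<Gamma> n. ennreal (moment_const m * V ^ m * (q ^ m) ^ n))"
      proof (rule sum_mono)
        fix y
        obtain w where w: "0 \<le> w" "w \<le> V * (q ^ n)\<^sup>2" "gaussian w (P n y)" using Pg by blast
        have "(\<integral>\<^sup>+ \<omega>. ennreal (P n y \<omega> ^ (2 * m)) \<partial>M) = ennreal (moment_const m * w ^ m)"
          by (rule gaussian_even_moment[OF w(3) m0])
        also have "\<dots> \<le> ennreal (moment_const m * (V * (q ^ n)\<^sup>2) ^ m)"
          using w mc by (intro ennreal_leI mult_left_mono power_mono) auto
        finally have "ennreal (1 / r n ^ (2 * m)) * (\<integral>\<^sup>+ \<omega>. ennreal (P n y \<omega> ^ (2 * m)) \<partial>M)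
            \<le> ennreal (1 / r n ^ (2 * m)) * ennreal (moment_const m * (V * (q ^ n)\<^sup>2) ^ m)"
          by (intro mult_left_mono) auto
        also have "\<dots> = ennreal (1 / r n ^ (2 * m) * (moment_const m * (V * (q ^ n)\<^sup>2) ^ m))"
          using r(1)[of n] mc V q by (intro ennreal_mult[symmetric]) auto
        also have "1 / r n ^ (2 * m) * (moment_const m * (V * (q ^ n)\<^sup>2) ^ m) = moment_const m * V ^ m * (q ^ m) ^ n"
        proof -
          have "r n ^ (2 * m) = (q ^ n) ^ m" unfolding power_mult r(3) ..
          moreover have "((q ^ n)\<^sup>2) ^ m = (q ^ n) ^ m * (q ^ n) ^ m" by (simp add: power2_eq_square power_mult_distrib)
          moreover have "(q ^ n) ^ m \<noteq> 0" using q by simp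
          moreover have "(q ^ n) ^ m = (q ^ m) ^ n" by (simp add: power_mult[symmetric] mult.commute)
          ultimately show ?thesis by (simp add: power_mult_distrib)
        qed
        finally show "ennreal (1 / r n ^ (2 * m)) * (\<integral>\<^sup>+ \<omega>. ennreal (P n y \<omega> ^ (2 * m)) \<partial>M)
            \<le> ennreal (moment_const m * V ^ m * (q ^ m) ^ n)" .
      qed
      also have "\<dots> = ennreal (real (card (\<Gamma> n)) * (moment_const m * V ^ m * (q ^ m) ^ n))"
        using mc V q by (subst sum_ennreal) auto
      also have "\<dots> \<le> ennreal (4 * moment_const m * V ^ m * (1 / 2) ^ n)"
      proof (rule ennreal_leI)
        have "real (card (\<Gamma> n)) * (moment_const m * V ^ m * (q ^ m) ^ n) \<le> 4 * 64 ^ n * (moment_const m * V ^ m * (q ^ m) ^ n)"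
          using mc V q by (intro mult_right_mono \<Gamma>) auto
        also have "\<dots> = 4 * moment_const m * V ^ m * (64 * q ^ m) ^ n" by (simp add: power_mult_distrib mult_ac)
        also have "\<dots> \<le> 4 * moment_const m * V ^ m * (1 / 2) ^ n"
          using mc V q qm by (intro mult_left_mono power_mono) auto
        finally show "real (card (\<Gamma> n)) * (moment_const m * V ^ m * (q ^ m) ^ n) \<le> 4 * moment_const m * V ^ m * (1 / 2) ^ n" .
      qed
      finally show ?thesis .
    qed
    show "summable (\<lambda>n. 4 * moment_const m * V ^ m * (1 / 2) ^ n)"
      by (intro summable_mult summable_geometric) auto
    show "0 \<le> 4 * moment_const m * V ^ m * (1 / 2) ^ n" for n using mc V by auto
  qed
  have 2: "AE \<omega> in M. summable (\<lambda>n. Y2 n \<omega>)"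
  proof (rule AE_summable_of_mean)
    show "random_variable borel (Y2 n)" for n
      unfolding Y2_def using \<open>\<And>n k. k \<in> shell n \<Longrightarrow> random_variable borel (\<xi> k)\<close>
      by (intro borel_measurable_sum) auto
    show "0 \<le> Y2 n \<omega>" for n \<omega> unfolding Y2_def using A L by (intro sum_nonneg) auto
    show "(\<integral>\<^sup>+ \<omega>. ennreal (Y2 n \<omega>) \<partial>M) \<le> ennreal (32 * S * (B * A * (2 * L) * (1 / 2) ^ n))" for n
      unfolding Y2_def
    proof (rule gaussian_family_abs_mean[OF \<xi> _ S])
      show "0 \<le> B * A * (2 * L) * (1 / 2) ^ n" using A B L by auto
      fix k assume k: "k \<in> shell n"
      have "\<bar>b k\<bar> \<le> B * q ^ n" by (rule b[OF k])
      also have "\<dots> \<le> B * 1" using B q by (intro mult_left_mono power_le_one) auto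
      finally have "\<bar>b k\<bar> * (A * (2 * L) / 2 ^ n) \<le> B * (A * (2 * L) / 2 ^ n)"
        using A L by (intro mult_right_mono) auto
      then show "0 \<le> \<bar>b k\<bar> * A * (2 * L) / 2 ^ n \<and> \<bar>b k\<bar> * A * (2 * L) / 2 ^ n \<le> B * A * (2 * L) * (1 / 2) ^ n"
        using A L by (simp add: power_divide mult.assoc)
    qed (use v in auto)
    show "summable (\<lambda>n. 32 * S * (B * A * (2 * L) * (1 / 2) ^ n))"
      by (intro summable_mult summable_geometric) auto
    show "0 \<le> 32 * S * (B * A * (2 * L) * (1 / 2) ^ n)" for n using S A B L by auto
  qed
  have sr: "summable r" unfolding r_def using q by (intro summable_geometric) auto
  from 1 2 show ?thesis
  proof eventually_elim
    case (elim \<omega>)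
    have "\<bar>P n x \<omega>\<bar> \<le> r n + Y1 n \<omega> + Y2 n \<omega>" if x: "x \<in> cell L" for n x
    proof -
      obtain i j where ij: "i \<le> 8 ^ n" "j \<le> 8 ^ n" and d: "norm (x - vector [L * real i / real (8 ^ n), L * real j / real (8 ^ n)]) \<le> 2 * L / real (8 ^ n)"
        using cell_grid_approx[OF L _ x, of "8 ^ n"] by auto
      define y :: "real^2" where "y = vector [L * real i / 8 ^ n, L * real j / 8 ^ n]"
      have y: "y \<in> \<Gamma> n" using ij by (force simp: \<Gamma>_def y_def)
      have dy: "norm (x - y) \<le> 2 * L / 8 ^ n" using d by (simp add: y_def)
      have "\<bar>P n y \<omega>\<bar> \<le> r n + P n y \<omega> ^ (2 * m) / r n ^ (2 * m)"
        by (intro abs_le_moment r m0)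
      also have "P n y \<omega> ^ (2 * m) / r n ^ (2 * m) \<le> Y1 n \<omega>"
        unfolding Y1_def using r(1)[of n] ev \<Gamma>(1) y
        by (intro divide_right_mono member_le_sum) auto
      finally have a: "\<bar>P n y \<omega>\<bar> \<le> r n + Y1 n \<omega>" by simp
      have "\<bar>P n x \<omega> - P n y \<omega>\<bar> = \<bar>\<Sum>k\<in>shell n. b k * (\<phi> k x - \<phi> k y) * \<xi> k \<omega>\<bar>"
        by (simp add: P_def sum_subtractf algebra_simps)
      also have "\<dots> \<le> (\<Sum>k\<in>shell n. \<bar>b k * (\<phi> k x - \<phi> k y) * \<xi> k \<omega>\<bar>)" by (rule sum_abs)
      also have "\<dots> \<le> Y2 n \<omega>"
        unfolding Y2_def
      proof (rule sum_mono)
        fix k assume k: "k \<in> shell n"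
        have "\<bar>\<phi> k x - \<phi> k y\<bar> \<le> A * 4 ^ n * norm (x - y)" by (rule \<phi>(2)[OF k])
        also have "\<dots> \<le> A * 4 ^ n * (2 * L / 8 ^ n)" using A by (intro mult_left_mono dy) auto
        also have "\<dots> = A * (2 * L) / 2 ^ n"
        proof -
          have "(8::real) ^ n = 4 ^ n * 2 ^ n" by (simp flip: power_mult_distrib)
          then show ?thesis by simp
        qed
        finally have "\<bar>b k\<bar> * \<bar>\<phi> k x - \<phi> k y\<bar> * \<bar>\<xi> k \<omega>\<bar> \<le> \<bar>b k\<bar> * (A * (2 * L) / 2 ^ n) * \<bar>\<xi> k \<omega>\<bar>"
          by (intro mult_right_mono mult_left_mono) auto
        then show "\<bar>b k * (\<phi> k x - \<phi> k y) * \<xi> k \<omega>\<bar> \<le> \<bar>b k\<bar> * A * (2 * L) / 2 ^ n * \<bar>\<xi> k \<omega>\<bar>"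
          by (simp add: abs_mult mult.assoc)
      qed
      finally show ?thesis using a by linarith
    qed
    moreover have "summable (\<lambda>n. r n + Y1 n \<omega> + Y2 n \<omega>)"
      using sr elim by (intro summable_add)
    ultimately show ?case unfolding P_def by (intro exI[of _ "\<lambda>n. r n + Y1 n \<omega> + Y2 n \<omega>"]) auto
  qed
qed

end

section \<open>The gradient of the noise and of the solution\<close>

text \<open>The variance of the Wiener integral of \<open>\<lambda>s. exp (- (t - s) * (mu L k)\<^sup>2)\<close> over \<open>{0..t}\<close>.\<close>

definition noise_var :: "real \<Rightarrow> real \<Rightarrow> freq \<Rightarrow> real" where
  "noise_var L t k = (1 - exp (- 2 * t * (mu L k)\<^sup>2)) / (2 * (mu L k)\<^sup>2)"

lemma noise_var_nonneg: "t \<ge> 0 \<Longrightarrow> noise_var L t k \<ge> 0"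
  by (simp add: noise_var_def)

lemma noise_var_shell_le:
  assumes L: "L > 0" and t: "t \<ge> 0" and k: "k \<in> shell n"
  shows "noise_var L t k \<le> ((L / (2 * pi))\<^sup>2 / 4 ^ n)\<^sup>2"
proof -
  have m: "mu L k > 0" using mu_pos[OF L] k shell_freqs by blast
  have "(2 ^ n)\<^sup>2 \<le> (fabs k)\<^sup>2" using fabs_shell_ge[OF k] by (intro power_mono) auto
  moreover have "((2::real) ^ n)\<^sup>2 = 4 ^ n" unfolding power2_eq_square by (simp flip: power_mult_distrib)
  ultimately have "(2 * pi / L)\<^sup>2 * 4 ^ n \<le> mu L k"
    unfolding mu_eq by (intro mult_left_mono) auto
  then have "1 / mu L k \<le> 1 / ((2 * pi / L)\<^sup>2 * 4 ^ n)"
    using L by (intro divide_left_mono mult_pos_pos m) auto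
  also have "\<dots> = (L / (2 * pi))\<^sup>2 / 4 ^ n" by (simp add: power_divide)
  finally have 1: "(1 / mu L k)\<^sup>2 \<le> ((L / (2 * pi))\<^sup>2 / 4 ^ n)\<^sup>2"
    using m by (intro power_mono) auto
  have "noise_var L t k \<le> 1 / (2 * (mu L k)\<^sup>2)"
    unfolding noise_var_def using m by (intro divide_right_mono) auto
  also have "\<dots> \<le> (1 / mu L k)\<^sup>2" using m by (simp add: power_divide field_simps)
  finally show ?thesis using 1 by simp
qed

lemma noise_var_ge:
  assumes L: "L > 0" and t: "t > 0"
  shows "\<exists>c>0. \<forall>k\<in>freqs. c / (mu L k)\<^sup>2 \<le> noise_var L t k"
proof -
  define m where "m = (2 * pi / L)\<^sup>2"
  have m: "m > 0" using L by (simp add: m_def)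
  define c where "c = (1 - exp (- 2 * t * m\<^sup>2)) / 2"
  have "c > 0" using t m by (simp add: c_def)
  moreover have "c / (mu L k)\<^sup>2 \<le> noise_var L t k" if k: "k \<in> freqs" for k
  proof -
    have "m * 1 \<le> mu L k" unfolding mu_eq m_def using fabs_ge_1[OF k] by (intro mult_left_mono) (auto simp: one_le_power)
    then have "m\<^sup>2 \<le> (mu L k)\<^sup>2" using m by (intro power_mono) auto
    then have "exp (- 2 * t * (mu L k)\<^sup>2) \<le> exp (- 2 * t * m\<^sup>2)" using t by simp
    then have "c \<le> (1 - exp (- 2 * t * (mu L k)\<^sup>2)) / 2" by (simp add: c_def)
    then have "c / (mu L k)\<^sup>2 \<le> (1 - exp (- 2 * t * (mu L k)\<^sup>2)) / 2 / (mu L k)\<^sup>2" by (intro divide_right_mono) auto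
    then show ?thesis by (simp add: noise_var_def)
  qed
  ultimately show ?thesis by blast
qed

text \<open>Over the four sign changes of a frequency the squared sines and cosines add up to constants,
  so the dependence on \<open>x\<close> disappears.\<close>

lemma sign_orbit_sum:
  fixes i j :: int
  assumes L: "L > 0" and "i > 0" "j > 0"
  shows "(\<Sum>s\<in>{1, -1}. \<Sum>r\<in>{1, -1}. (grad_e L (s * i, r * j) x $ 1)\<^sup>2) = (2 * pi * i / L)\<^sup>2 * (2 / L)\<^sup>2"
proof -
  have "(\<Sum>s\<in>{1, -1}. \<Sum>r\<in>{1, -1}. (grad_e L (s * i, r * j) x $ 1)\<^sup>2)
     = (2 * pi * i / L)\<^sup>2 * (((omega L i (x $ 1))\<^sup>2 + (omega L (- i) (x $ 1))\<^sup>2) * ((omega L j (x $ 2))\<^sup>2 + (omega L (- j) (x $ 2))\<^sup>2))"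
    by (simp add: grad_e_nth e_def power_mult_distrib power_divide algebra_simps)
  also have "\<dots> = (2 * pi * i / L)\<^sup>2 * (2 / L)\<^sup>2"
    using assms by (simp only: omega_sq_sum power2_eq_square[of "2 / L"])
  finally show ?thesis .
qed

text \<open>In the sector \<open>1 \<le> j \<le> i\<close> each sign orbit contributes at least a constant times \<open>1 / i\<^sup>2\<close>; summing over
  \<open>j\<close> leaves the harmonic series.\<close>

lemma gradient_variance_unbounded:
  assumes L: "L > 0" and t: "t > 0"
  shows "\<exists>K. finite K \<and> K \<subseteq> freqs \<and> (\<forall>x. H \<le> (\<Sum>k\<in>K. (grad_e L k x $ 1)\<^sup>2 * noise_var L t k))"
proof -
  obtain c where c: "c > 0" "\<And>k. k \<in> freqs \<Longrightarrow> c / (mu L k)\<^sup>2 \<le> noise_var L t k"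
    using noise_var_ge[OF L t] by blast
  define c0 where "c0 = c / (L\<^sup>2 * (2 * pi / L)\<^sup>2)"
  have c0: "c0 > 0" using c L by (simp add: c0_def)
  have "\<forall>\<^sub>F N in sequentially. H / c0 \<le> harm N"
    using harm_at_top by (simp add: filterlim_at_top)
  then obtain N where N: "H / c0 \<le> harm N" by (auto simp: eventually_sequentially)
  define Q where "Q = (SIGMA i:{1..N}. {1..i})"
  define S where "S = {1, -1 :: int}"
  define h where "h = (\<lambda>((i, j), s, r). (s * int i, r * int j))"
  define K where "K = h ` (Q \<times> S \<times> S)"
  have fin: "finite Q" "finite S" by (auto simp: Q_def S_def)
  have inj: "inj_on h (Q \<times> S \<times> S)"
    by (rule inj_onI) (auto simp: Q_def S_def h_def)
  have K: "finite K" "K \<subseteq> freqs"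
    using fin by (auto simp: K_def h_def Q_def S_def freqs_def)
  have "H \<le> (\<Sum>k\<in>K. (grad_e L k x $ 1)\<^sup>2 * noise_var L t k)" for x
  proof -
    have orbit: "c0 / real i ^ 2 \<le> (\<Sum>s\<in>S. \<Sum>r\<in>S. (grad_e L (h ((i, j), s, r)) x $ 1)\<^sup>2 * noise_var L t (h ((i, j), s, r)))"
      if ij: "(i, j) \<in> Q" for i j
    proof -
      have ij': "1 \<le> j" "j \<le> i" "i > 0" using ij by (auto simp: Q_def)
      define b where "b = c / ((2 * pi / L)\<^sup>2 * (2 * (real i)\<^sup>2))\<^sup>2"
      have b: "b \<le> noise_var L t (h ((i, j), s, r))" if "s \<in> S" "r \<in> S" for s r
      proof -
        define k where "k = h ((i, j), s, r)"
        have k: "k \<in> freqs" using K(2) ij that by (auto simp: K_def k_def)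
        have "(fabs k)\<^sup>2 = (real i)\<^sup>2 + (real j)\<^sup>2"
          using that by (auto simp: fabs_sq k_def h_def S_def)
        also have "\<dots> \<le> 2 * (real i)\<^sup>2" using ij' by (simp add: power_mono)
        finally have "mu L k \<le> (2 * pi / L)\<^sup>2 * (2 * (real i)\<^sup>2)" unfolding mu_eq by (intro mult_left_mono) auto
        then have "b \<le> c / (mu L k)\<^sup>2"
          unfolding b_def using c(1) mu_pos[OF L k] L ij' by (intro divide_left_mono power_mono mult_pos_pos zero_less_power) auto
        also have "\<dots> \<le> noise_var L t k" by (rule c(2)[OF k])
        finally show ?thesis by (simp add: k_def)
      qed
      have "c0 / real i ^ 2 = (2 * pi * int i / L)\<^sup>2 * (2 / L)\<^sup>2 * b"
        using ij' L by (simp add: c0_def b_def power_mult_distrib power_divide field_simps power2_eq_square)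
      also have "\<dots> = (\<Sum>s\<in>S. \<Sum>r\<in>S. (grad_e L (s * int i, r * int j) x $ 1)\<^sup>2) * b"
        unfolding S_def using sign_orbit_sum[OF L, of "int i" "int j" x] ij' by simp
      also have "\<dots> = (\<Sum>s\<in>S. \<Sum>r\<in>S. (grad_e L (h ((i, j), s, r)) x $ 1)\<^sup>2 * b)"
        by (simp add: sum_distrib_right h_def)
      also have "\<dots> \<le> (\<Sum>s\<in>S. \<Sum>r\<in>S. (grad_e L (h ((i, j), s, r)) x $ 1)\<^sup>2 * noise_var L t (h ((i, j), s, r)))"
        using b by (intro sum_mono mult_left_mono) auto
      finally show ?thesis .
    qed
    have "H \<le> c0 * harm N" using N c0 by (simp add: field_simps)
    also have "\<dots> = (\<Sum>i\<in>{1..N}. \<Sum>j\<in>{1..i}. c0 / real i ^ 2)"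
      by (simp add: harm_def sum_distrib_left power2_eq_square field_simps)
    also have "\<dots> = (\<Sum>(i, j)\<in>Q. c0 / real i ^ 2)" unfolding Q_def by (subst sum.Sigma) auto
    also have "\<dots> \<le> (\<Sum>(i, j)\<in>Q. \<Sum>s\<in>S. \<Sum>r\<in>S. (grad_e L (h ((i, j), s, r)) x $ 1)\<^sup>2 * noise_var L t (h ((i, j), s, r)))"
      by (rule sum_mono) (use orbit in auto)
    also have "\<dots> = (\<Sum>q\<in>Q. \<Sum>p\<in>S \<times> S. (grad_e L (h (q, p)) x $ 1)\<^sup>2 * noise_var L t (h (q, p)))"
      by (simp add: sum.cartesian_product case_prod_beta)
    also have "\<dots> = (\<Sum>z\<in>Q \<times> S \<times> S. (grad_e L (h z) x $ 1)\<^sup>2 * noise_var L t (h z))"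
      by (simp add: sum.cartesian_product case_prod_beta)
    also have "\<dots> = (\<Sum>k\<in>K. (grad_e L k x $ 1)\<^sup>2 * noise_var L t k)"
      unfolding K_def using sum.reindex[OF inj, of "\<lambda>k. (grad_e L k x $ 1)\<^sup>2 * noise_var L t k"] by simp
    finally show ?thesis .
  qed
  then show ?thesis using K by blast
qed

lemma grad_e_shell_bounds:
  assumes L: "L > 0"
  shows "\<exists>A\<ge>0. \<forall>n. \<forall>k\<in>shell n. \<forall>i x y. \<bar>grad_e L k x $ i\<bar> \<le> A * 2 ^ n \<and>
     \<bar>grad_e L k x $ i - grad_e L k y $ i\<bar> \<le> A * 4 ^ n * norm (x - y)"
proof -
  define g where "g = 2 * pi / L"
  have g: "g > 0" using L by (simp add: g_def)
  define A where "A = 2 / L * (g * 4) + 2 / L * (g * 4) * (g * 4)"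
  have A: "A \<ge> 0" "2 / L * (g * 4) \<le> A" "2 / L * (g * 4) * (g * 4) \<le> A" using L g by (auto simp: A_def)
  have "\<bar>grad_e L k x $ i\<bar> \<le> A * 2 ^ n \<and> \<bar>grad_e L k x $ i - grad_e L k y $ i\<bar> \<le> A * 4 ^ n * norm (x - y)"
    if k: "k \<in> shell n" for n k i x y
  proof -
    have sm: "sqrt (mu L l) \<le> g * (4 * 2 ^ n)" if "fabs l = fabs k" for l
      unfolding sqrt_mu[OF L] that using fabs_shell_le[OF k] L by (simp add: g_def field_simps)
    have "\<bar>grad_e L k x $ i\<bar> \<le> norm (grad_e L k x)" by (rule component_le_norm_cart)
    also have "\<dots> \<le> 2 / L * (g * (4 * 2 ^ n))"
      using L sm by (intro order_trans[OF norm_grad_e_le[OF L]] mult_left_mono) auto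
    also have "\<dots> = 2 / L * (g * 4) * 2 ^ n" by simp
    also have "\<dots> \<le> A * 2 ^ n" using A by (intro mult_right_mono) auto
    finally have 1: "\<bar>grad_e L k x $ i\<bar> \<le> A * 2 ^ n" .
    obtain z l where zl: "\<bar>z\<bar> \<le> fabs k" "fabs l = fabs k" "\<And>x. grad_e L k x $ i = g * z * e L l x"
    proof (cases "i = 1")
      case True
      show thesis
        by (rule that[of "of_int (fst k)" "(- fst k, snd k)"])
          (auto simp: True grad_e_nth g_def abs_le_fabs, simp add: fabs_def)
    next
      case False
      then have i: "i = 2" using exhaust_2 by blast
      show thesis
        by (rule that[of "of_int (snd k)" "(fst k, - snd k)"])
          (auto simp: i grad_e_nth g_def abs_le_fabs, simp add: fabs_def)
    qed
    have "\<bar>grad_e L k x $ i - grad_e L k y $ i\<bar> = g * \<bar>z\<bar> * \<bar>e L l x - e L l y\<bar>"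
      unfolding zl(3) using g by (simp add: abs_mult flip: right_diff_distrib)
    also have "\<dots> \<le> g * (4 * 2 ^ n) * (2 / L * (g * (4 * 2 ^ n)) * norm (x - y))"
    proof (intro mult_mono)
      show "\<bar>z\<bar> \<le> 4 * 2 ^ n" using zl(1) fabs_shell_le[OF k] by linarith
      have "\<bar>e L l x - e L l y\<bar> \<le> 2 / L * sqrt (mu L l) * norm (x - y)" by (rule e_Lipschitz[OF L])
      also have "\<dots> \<le> 2 / L * (g * (4 * 2 ^ n)) * norm (x - y)"
        using L sm[OF zl(2)] by (intro mult_right_mono mult_left_mono) auto
      finally show "\<bar>e L l x - e L l y\<bar> \<le> 2 / L * (g * (4 * 2 ^ n)) * norm (x - y)" .
    qed (use g L in auto)
    also have "\<dots> = 2 / L * (g * 4) * (g * 4) * 4 ^ n * norm (x - y)"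
    proof -
      have "(4::real) ^ n = 2 ^ n * 2 ^ n" by (simp flip: power_mult_distrib)
      then show ?thesis by simp
    qed
    also have "\<dots> \<le> A * 4 ^ n * norm (x - y)" using A by (intro mult_right_mono) auto
    finally show ?thesis using 1 by blast
  qed
  then show ?thesis using A(1) by blast
qed

context prob_space
begin

lemma stoch_convolution_gaussian:
  assumes L: "L > 0" and \<beta>: "iid_wiener \<beta>" and Z: "stoch_convolution M L T \<beta> a Z" and t: "t \<in> {0<..T}"
  shows "\<exists>\<xi>. gaussian_family \<xi> (noise_var L t) \<and> (\<forall>k\<in>freqs. \<forall>\<omega>\<in>space M. Z t \<omega> k = a k * \<xi> k \<omega>)"
proof -
  have "\<forall>k\<in>freqs. \<exists>X. wiener_integral M (\<beta> k) t (\<lambda>s. exp (- (t - s) * (mu L k)\<^sup>2)) X \<and> (\<forall>\<omega>\<in>space M. Z t \<omega> k = a k * X \<omega>)"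
    using Z t unfolding stoch_convolution_def by auto
  from bchoice[OF this] obtain \<xi> where
    \<xi>: "\<And>k. k \<in> freqs \<Longrightarrow> wiener_integral M (\<beta> k) t (\<lambda>s. exp (- (t - s) * (mu L k)\<^sup>2)) (\<xi> k)"
      "\<And>k. k \<in> freqs \<Longrightarrow> \<forall>\<omega>\<in>space M. Z t \<omega> k = a k * \<xi> k \<omega>" by blast
  have "gaussian_family \<xi> (noise_var L t)"
    unfolding gaussian_family_def
  proof (intro allI impI)
    fix K :: "freq set" and d :: "freq \<Rightarrow> real"
    assume K: "finite K" "K \<subseteq> freqs"
    have m: "(mu L k)\<^sup>2 > 0" if "k \<in> K" for k using mu_pos[OF L, of k] K that by auto
    have "gaussian (\<Sum>k\<in>K. (d k)\<^sup>2 * (LINT s:{0..t}|lborel. (exp (- (t - s) * (mu L k)\<^sup>2))\<^sup>2)) (\<lambda>\<omega>. \<Sum>k\<in>K. d k * \<xi> k \<omega>)"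
    proof (rule wiener_integrals_gaussian[OF \<beta> K])
      fix k assume k: "k \<in> K"
      show "wiener_integral M (\<beta> k) t (\<lambda>s. exp (- (t - s) * (mu L k)\<^sup>2)) (\<xi> k)" using \<xi>(1) K k by blast
      show "set_integrable lborel {0..t} (\<lambda>s. (exp (- (t - s) * (mu L k)\<^sup>2))\<^sup>2)"
        using t m[OF k] by (intro exp_square_integral(1)) auto
      show "(\<lambda>s. exp (- (t - s) * (mu L k)\<^sup>2)) \<in> borel_measurable borel" by measurable
    qed
    also have "(\<Sum>k\<in>K. (d k)\<^sup>2 * (LINT s:{0..t}|lborel. (exp (- (t - s) * (mu L k)\<^sup>2))\<^sup>2)) = (\<Sum>k\<in>K. (d k)\<^sup>2 * noise_var L t k)"
      using m t by (intro sum.cong refl, subst exp_square_integral(2)) (auto simp: noise_var_def)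
    finally show "gaussian (\<Sum>k\<in>K. (d k)\<^sup>2 * noise_var L t k) (\<lambda>\<omega>. \<Sum>k\<in>K. d k * \<xi> k \<omega>)" .
  qed
  then show ?thesis using \<xi>(2) by blast
qed

text \<open>The exponent \<open>\<delta>\<close> enters only through the ratio \<open>q = 2 powr (- \<delta>) < 1\<close> of the geometric decay over the
  shells. The supremum over the cell extends to the plane by periodicity.\<close>

lemma noise_regular:
  assumes L: "L > 0" and t: "t > 0" and \<xi>: "gaussian_family \<xi> (noise_var L t)"
    and a: "\<delta> > 0" "C > 0" "\<And>k. k \<in> freqs \<Longrightarrow> \<bar>a k\<bar> \<le> C * fabs k powr (- \<delta>)"
  shows "AE \<omega> in M. (\<lambda>k. \<bar>a k * \<xi> k \<omega>\<bar>) summable_on freqs \<and>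
     (\<exists>B. summable B \<and> (\<forall>n x. norm (\<Sum>k\<in>shell n. (a k * \<xi> k \<omega>) *\<^sub>R grad_e L k x) \<le> B n))"
proof -
  define q where "q = 2 powr (- \<delta>)"
  have q: "0 < q" "q < 1" using a(1) powr_less_mono[of "- \<delta>" 0 2] by (auto simp: q_def)
  have b: "\<bar>a k\<bar> \<le> C * q ^ n" if "k \<in> shell n" for n k
  proof -
    have "\<bar>a k\<bar> \<le> C * fabs k powr (- \<delta>)" using a(3) that shell_freqs by blast
    also have "\<dots> \<le> C * (2 ^ n) powr (- \<delta>)"
      using a fabs_shell_ge[OF that] by (intro mult_left_mono powr_mono2') auto
    also have "(2 ^ n :: real) powr (- \<delta>) = q ^ n"
      by (simp add: q_def powr_realpow[symmetric] powr_powr mult.commute)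
    finally show ?thesis .
  qed
  define S where "S = (L / (2 * pi))\<^sup>2"
  have S: "S \<ge> 0" by (simp add: S_def)
  have v: "0 \<le> noise_var L t k \<and> noise_var L t k \<le> (S / 4 ^ n)\<^sup>2" if "k \<in> shell n" for n k
    using noise_var_shell_le[OF L _ that, of t] noise_var_nonneg[of t] t by (simp add: S_def)
  obtain A where A: "A \<ge> 0" "\<And>n k i x y. k \<in> shell n \<Longrightarrow> \<bar>grad_e L k x $ i\<bar> \<le> A * 2 ^ n"
     "\<And>n k i x y. k \<in> shell n \<Longrightarrow> \<bar>grad_e L k x $ i - grad_e L k y $ i\<bar> \<le> A * 4 ^ n * norm (x - y)"
    using grad_e_shell_bounds[OF L] by blast
  have C: "C \<ge> 0" using a by simp
  have sup: "AE \<omega> in M. \<exists>B. summable B \<and> (\<forall>n. \<forall>x\<in>cell L. \<bar>\<Sum>k\<in>shell n. a k * grad_e L k x $ i * \<xi> k \<omega>\<bar> \<le> B n)" for i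
    by (rule gaussian_family_shell_sup[OF L \<xi> v S b q C A(2) A(3) A(1)])
  have "AE \<omega> in M. (\<lambda>k. \<bar>a k * \<xi> k \<omega>\<bar>) summable_on freqs"
    by (rule gaussian_family_coeffs_summable[OF \<xi> _ S b q C]) (use v in auto)
  with sup[of 1] sup[of 2] show ?thesis
  proof eventually_elim
    case (elim \<omega>)
    obtain B1 where B1: "summable B1" "\<And>n x. x \<in> cell L \<Longrightarrow> \<bar>\<Sum>k\<in>shell n. a k * grad_e L k x $ 1 * \<xi> k \<omega>\<bar> \<le> B1 n"
      using elim(1) by blast
    obtain B2 where B2: "summable B2" "\<And>n x. x \<in> cell L \<Longrightarrow> \<bar>\<Sum>k\<in>shell n. a k * grad_e L k x $ 2 * \<xi> k \<omega>\<bar> \<le> B2 n"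
      using elim(2) by blast
    have "norm (\<Sum>k\<in>shell n. (a k * \<xi> k \<omega>) *\<^sub>R grad_e L k x) \<le> B1 n + B2 n" for n x
    proof -
      define W where "W = (\<lambda>x. \<Sum>k\<in>shell n. (a k * \<xi> k \<omega>) *\<^sub>R grad_e L k x)"
      have "periodic L W" unfolding periodic_def W_def grad_e_def periodic_e[OF L] by simp
      moreover obtain y where y: "y \<in> cell L" "\<forall>w :: real^2 \<Rightarrow> real^2. periodic L w \<longrightarrow> w x = w y"
        using periodic_translate_to_cell[OF L] by blast
      ultimately have "W x = W y" by blast
      moreover have "norm (W y) \<le> \<bar>W y $ 1\<bar> + \<bar>W y $ 2\<bar>" using norm_le_l1_cart[of "W y"] by (simp add: UNIV_2)
      moreover have "W y $ i = (\<Sum>k\<in>shell n. a k * grad_e L k y $ i * \<xi> k \<omega>)" for i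
        by (simp add: W_def mult_ac)
      ultimately show ?thesis using B1(2)[OF y(1), of n] B2(2)[OF y(1), of n] by (simp add: W_def)
    qed
    then show ?case using elim(3) summable_add[OF B1(1) B2(1)] by (intro conjI exI[of _ "\<lambda>n. B1 n + B2 n"]) auto
  qed
qed


text \<open>Split according to whether \<open>norm (U \<omega>)\<close> is at least \<open>m\<close>. If it is, \<open>norm (f (U \<omega>)) \<le> 1 / m\<close>. If it is
  not, then eventually \<open>\<bar>S N \<omega>\<bar> < m + R\<close>, so the event lies in the lower limit of events whose
  probabilities are controlled by the small ball estimate, and Fatou's lemma applies.\<close>

lemma expectation_f_le_small_ball:
  fixes U :: "'a \<Rightarrow> real ^ 2"
  assumes m: "m > 0" and p: "p \<ge> 1" and R: "R \<ge> 0"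
    and g: "\<And>N. gaussian (v N) (S N)" and w: "w > 0" "\<forall>\<^sub>F N in sequentially. w \<le> v N"
    and lim: "AE \<omega> in M. \<exists>Y. Y \<longlonglongrightarrow> U \<omega> \<and> (\<forall>N. \<bar>Y N $ 1 - S N \<omega>\<bar> \<le> R)"
  shows "(\<integral>\<^sup>+ \<omega>. ennreal (norm (f (U \<omega>)) powr p) \<partial>M) \<le> ennreal (1 / m + 2 * (m + R) / sqrt w)"
proof -
  have [measurable]: "random_variable borel (S N)" for N using g[of N] by (simp add: gaussian_def)
  define I where "I = (\<lambda>N \<omega>. indicator {\<omega> \<in> space M. \<bar>S N \<omega>\<bar> < m + R} \<omega> :: ennreal)"
  have [measurable]: "I N \<in> borel_measurable M" for N unfolding I_def by measurable
  have le1: "norm (f y) powr p \<le> norm (f y)" for y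
  proof (cases "f y = 0")
    case False
    then have "norm (f y) powr p \<le> norm (f y) powr 1"
      using norm_f_le_half[of y] p by (intro powr_mono') auto
    then show ?thesis using False by simp
  qed simp
  have "(\<integral>\<^sup>+ \<omega>. ennreal (norm (f (U \<omega>)) powr p) \<partial>M) \<le> (\<integral>\<^sup>+ \<omega>. ennreal (1 / m) + liminf (\<lambda>N. I N \<omega>) \<partial>M)"
  proof (rule nn_integral_mono_AE)
    from lim AE_space show "AE \<omega> in M. ennreal (norm (f (U \<omega>)) powr p) \<le> ennreal (1 / m) + liminf (\<lambda>N. I N \<omega>)"
    proof eventually_elim
      case (elim \<omega>)
      show ?case
      proof (cases "norm (U \<omega>) < m")
        case True
        obtain Y where Y: "Y \<longlonglongrightarrow> U \<omega>" "\<And>N. \<bar>Y N $ 1 - S N \<omega>\<bar> \<le> R" using elim(1) by blast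
        have "(\<lambda>N. norm (Y N)) \<longlonglongrightarrow> norm (U \<omega>)" by (intro tendsto_norm Y)
        then have "\<forall>\<^sub>F N in sequentially. norm (Y N) < m" using True by (rule order_tendstoD)
        then have "\<forall>\<^sub>F N in sequentially. 1 \<le> I N \<omega>"
        proof eventually_elim
          case (elim N)
          have "\<bar>Y N $ 1\<bar> < m" using elim component_le_norm_cart[of "Y N" 1] by simp
          then have "\<bar>S N \<omega>\<bar> < m + R" using Y(2)[of N] by linarith
          then show ?case using \<open>\<omega> \<in> space M\<close> by (simp add: I_def)
        qed
        then have "1 \<le> liminf (\<lambda>N. I N \<omega>)" by (rule Liminf_bounded)
        moreover have "ennreal (norm (f (U \<omega>)) powr p) \<le> 1"
          using order_trans[OF le1 norm_f_le_half, of "U \<omega>"] by (simp flip: ennreal_1 del: ennreal_1) 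
        ultimately show ?thesis by (meson add_increasing order_trans zero_le)
      next
        case False
        then have "m * norm (f (U \<omega>)) \<le> norm (U \<omega>) * norm (f (U \<omega>))" by (intro mult_right_mono) auto
        also have "\<dots> \<le> 1" by (rule norm_f_le_inverse)
        finally have "norm (f (U \<omega>)) \<le> 1 / m" using m by (simp add: field_simps)
        then have "ennreal (norm (f (U \<omega>)) powr p) \<le> ennreal (1 / m)"
          using le1[of "U \<omega>"] by (intro ennreal_leI) linarith
        then show ?thesis by (simp add: add_increasing2)
      qed
    qed
  qed
  also have "\<dots> = ennreal (1 / m) + (\<integral>\<^sup>+ \<omega>. liminf (\<lambda>N. I N \<omega>) \<partial>M)"
    by (subst nn_integral_add) (auto simp: emeasure_space_1)
  also have "(\<integral>\<^sup>+ \<omega>. liminf (\<lambda>N. I N \<omega>) \<partial>M) \<le> liminf (\<lambda>N. \<integral>\<^sup>+ \<omega>. I N \<omega> \<partial>M)"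
    by (rule nn_integral_liminf) measurable
  also have "\<dots> \<le> limsup (\<lambda>N. \<integral>\<^sup>+ \<omega>. I N \<omega> \<partial>M)" by (rule Liminf_le_Limsup) simp
  also have "\<dots> \<le> ennreal (2 * (m + R) / sqrt w)"
  proof (rule Limsup_bounded)
    show "\<forall>\<^sub>F N in sequentially. (\<integral>\<^sup>+ \<omega>. I N \<omega> \<partial>M) \<le> ennreal (2 * (m + R) / sqrt w)"
      using w(2)
    proof eventually_elim
      case (elim N)
      have "(\<integral>\<^sup>+ \<omega>. I N \<omega> \<partial>M) = emeasure M {\<omega> \<in> space M. \<bar>S N \<omega>\<bar> < m + R}"
        unfolding I_def by (rule nn_integral_indicator) measurable
      also have "\<dots> \<le> ennreal (2 * (m + R) / sqrt (v N))"
        using elim w(1) m R by (intro gaussian_small_ball[OF g]) auto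
      also have "\<dots> \<le> ennreal (2 * (m + R) / sqrt w)"
        using elim w(1) m R by (intro ennreal_leI divide_left_mono) auto
      finally show ?case .
    qed
  qed
  finally have "(\<integral>\<^sup>+ \<omega>. ennreal (norm (f (U \<omega>)) powr p) \<partial>M) \<le> ennreal (1 / m) + ennreal (2 * (m + R) / sqrt w)"
    by (simp add: add_left_mono)
  also have "\<dots> = ennreal (1 / m + 2 * (m + R) / sqrt w)"
    using m R w(1) by (intro ennreal_plus[symmetric]) auto
  finally show ?thesis .
qed

text \<open>The constant is chosen before the noise and the solution, hence it is independent of \<open>\<epsilon>\<close>.\<close>

lemma mild_solution_decomposition:
  assumes L: "L > 0" and t: "t \<in> {0<..T}" and u0: "in_H L 1 u0"
  shows "\<exists>R\<ge>0. \<forall>Z u. mild_solution M L T u0 Z u \<longrightarrow> (AE \<omega> in M. \<exists>d. (\<forall>k\<in>freqs. u t \<omega> k = d k + Z t \<omega> k) \<and>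
      (\<forall>K. finite K \<longrightarrow> K \<subseteq> freqs \<longrightarrow> (\<Sum>k\<in>K. sqrt (mu L k) * \<bar>d k\<bar>) \<le> R))"
proof -
  have t': "t > 0" using t by simp
  obtain R1 where R1: "R1 \<ge> 0" "\<And>K. finite K \<Longrightarrow> K \<subseteq> freqs \<Longrightarrow> (\<Sum>k\<in>K. sqrt (mu L k) * \<bar>semigroup_A L t u0 k\<bar>) \<le> R1"
    using semigroup_gradient_bound[OF L t' u0] by blast
  obtain R2 where R2: "R2 \<ge> 0" "\<And>v K. finite K \<Longrightarrow> K \<subseteq> freqs \<Longrightarrow>
     (\<Sum>k\<in>K. sqrt (mu L k) * \<bar>LINT s:{0..t}|lborel. semigroup_A L (t - s) (nonlinearity L (v s)) k\<bar>) \<le> R2"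
    using drift_gradient_bound[OF L t'] by blast
  have "AE \<omega> in M. \<exists>d. (\<forall>k\<in>freqs. u t \<omega> k = d k + Z t \<omega> k) \<and>
      (\<forall>K. finite K \<longrightarrow> K \<subseteq> freqs \<longrightarrow> (\<Sum>k\<in>K. sqrt (mu L k) * \<bar>d k\<bar>) \<le> R1 + R2)"
    if u: "mild_solution M L T u0 Z u" for Z u
  proof -
    have "\<forall>t\<in>{0..T}. AE \<omega> in M. \<forall>k\<in>freqs.
        u t \<omega> k = semigroup_A L t u0 k
          + (LINT s:{0..t}|lborel. semigroup_A L (t - s) (nonlinearity L (u s \<omega>)) k) + Z t \<omega> k"
      using u unfolding mild_solution_def by (elim conjE)
    moreover have "t \<in> {0..T}" using t by simp
    ultimately have "AE \<omega> in M. \<forall>k\<in>freqs. u t \<omega> k = semigroup_A L t u0 k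
          + (LINT s:{0..t}|lborel. semigroup_A L (t - s) (nonlinearity L (u s \<omega>)) k) + Z t \<omega> k" by (rule bspec)
    then show ?thesis
    proof eventually_elim
      case (elim \<omega>)
      define d2 where "d2 = (\<lambda>k. LINT s:{0..t}|lborel. semigroup_A L (t - s) (nonlinearity L (u s \<omega>)) k)"
      define d where "d = (\<lambda>k. semigroup_A L t u0 k + d2 k)"
      have "(\<Sum>k\<in>K. sqrt (mu L k) * \<bar>d k\<bar>) \<le> R1 + R2" if K: "finite K" "K \<subseteq> freqs" for K
      proof -
        have "(\<Sum>k\<in>K. sqrt (mu L k) * \<bar>d k\<bar>) \<le> (\<Sum>k\<in>K. sqrt (mu L k) * \<bar>semigroup_A L t u0 k\<bar> + sqrt (mu L k) * \<bar>d2 k\<bar>)"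
          unfolding d_def distrib_left[symmetric]
          by (intro sum_mono mult_left_mono abs_triangle_ineq) (simp add: mu_def)
        also have "\<dots> \<le> R1 + R2"
          unfolding sum.distrib d2_def using R1(2)[OF K] R2(2)[OF K] by (intro add_mono) auto
        finally show ?thesis .
      qed
      moreover have "\<forall>k\<in>freqs. u t \<omega> k = d k + Z t \<omega> k" using elim by (simp add: d_def d2_def)
      ultimately show ?case by blast
    qed
  qed
  then show ?thesis using R1(1) R2(1) by (intro exI[of _ "R1 + R2"]) auto
qed

text \<open>Partial sums are compared instead of limits: at every stage the first component of the gradient
  is a finite Gaussian sum up to an error that is bounded uniformly in \<open>N\<close>.\<close>

lemma point_grad_decomposition:
  assumes L: "L > 0" and R: "R \<ge> 0"
    and d: "\<And>K. finite K \<Longrightarrow> K \<subseteq> freqs \<Longrightarrow> (\<Sum>k\<in>K. sqrt (mu L k) * \<bar>d k\<bar>) \<le> R"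
    and z: "(\<lambda>k. \<bar>z k\<bar>) summable_on freqs" "summable B"
      "\<And>n x. norm (\<Sum>k\<in>shell n. z k *\<^sub>R grad_e L k x) \<le> B n"
    and c: "\<And>k. k \<in> freqs \<Longrightarrow> c k = d k + z k"
  shows "\<exists>Y. Y \<longlonglongrightarrow> point_grad L c x \<and> (\<forall>N. \<bar>Y N $ 1 - (\<Sum>k\<in>kbox N. z k * grad_e L k x $ 1)\<bar> \<le> 2 / L * R)"
proof (intro exI conjI allI)
  have drift: "norm (\<Sum>k\<in>K. d k *\<^sub>R grad_e L k x) \<le> 2 / L * (\<Sum>k\<in>K. sqrt (mu L k) * \<bar>d k\<bar>)" for K x
  proof -
    have "norm (\<Sum>k\<in>K. d k *\<^sub>R grad_e L k x) \<le> (\<Sum>k\<in>K. \<bar>d k\<bar> * (2 / L * sqrt (mu L k)))"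
      by (intro order_trans[OF norm_sum] sum_mono) (simp only: norm_scaleR, intro mult_left_mono norm_grad_e_le L abs_ge_zero)
    then show ?thesis by (simp add: sum_distrib_left mult_ac)
  qed
  have split: "(\<Sum>k\<in>K. c k *\<^sub>R grad_e L k x) = (\<Sum>k\<in>K. d k *\<^sub>R grad_e L k x) + (\<Sum>k\<in>K. z k *\<^sub>R grad_e L k x)"
    if "K \<subseteq> freqs" for K x
    unfolding sum.distrib[symmetric] using c that by (intro sum.cong refl) (auto simp: scaleR_left_distrib)
  show "(\<lambda>N. \<Sum>k\<in>kbox N. c k *\<^sub>R grad_e L k x) \<longlonglongrightarrow> point_grad L c x"
  proof (rule point_grad_limit[OF L])
    have "(\<lambda>k. \<bar>d k\<bar>) summable_on freqs"
    proof (rule nonneg_bdd_above_summable_on)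
      have "(\<Sum>k\<in>K. \<bar>d k\<bar>) \<le> L / (2 * pi) * R" if K: "finite K" "K \<subseteq> freqs" for K
      proof -
        have "(\<Sum>k\<in>K. \<bar>d k\<bar>) \<le> (\<Sum>k\<in>K. L / (2 * pi) * (sqrt (mu L k) * \<bar>d k\<bar>))"
        proof (rule sum_mono)
          fix k assume "k \<in> K"
          then have "1 \<le> fabs k" using K fabs_ge_1 by blast
          then have "1 * \<bar>d k\<bar> \<le> fabs k * \<bar>d k\<bar>" by (intro mult_right_mono) auto
          then show "\<bar>d k\<bar> \<le> L / (2 * pi) * (sqrt (mu L k) * \<bar>d k\<bar>)" using L by (simp add: sqrt_mu)
        qed
        also have "\<dots> \<le> L / (2 * pi) * R"
          unfolding sum_distrib_left[symmetric] using L by (intro mult_left_mono d K) auto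
        finally show ?thesis .
      qed
      then show "bdd_above (sum (\<lambda>k. \<bar>d k\<bar>) ` {K. K \<subseteq> freqs \<and> finite K})"
        by (intro bdd_aboveI[of _ "L / (2 * pi) * R"]) auto
    qed auto
    then have "(\<lambda>k. \<bar>d k\<bar> + \<bar>z k\<bar>) summable_on freqs" using z(1) by (rule summable_on_add)
    then show "(\<lambda>k. \<bar>c k\<bar>) summable_on freqs"
      by (rule summable_on_comparison_test) (auto simp: c)
    have "summable (\<lambda>n. \<Sum>k\<in>shell n. sqrt (mu L k) * \<bar>d k\<bar>)"
    proof (rule summableI_nonneg_bounded)
      show "(\<Sum>n<N. \<Sum>k\<in>shell n. sqrt (mu L k) * \<bar>d k\<bar>) \<le> R" for N
        unfolding sum_kbox_shells[symmetric] by (intro d kbox_freqs finite_kbox)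
    qed (auto intro!: sum_nonneg simp: mu_def)
    then show "summable (\<lambda>n. 2 / L * (\<Sum>k\<in>shell n. sqrt (mu L k) * \<bar>d k\<bar>) + B n)"
      using z(2) by (intro summable_add summable_mult)
    show "norm (\<Sum>k\<in>shell n. c k *\<^sub>R grad_e L k x) \<le> 2 / L * (\<Sum>k\<in>shell n. sqrt (mu L k) * \<bar>d k\<bar>) + B n" for n x
      unfolding split[OF shell_freqs] by (intro norm_triangle_le add_mono drift z(3))
  qed
  show "\<bar>(\<Sum>k\<in>kbox N. c k *\<^sub>R grad_e L k x) $ 1 - (\<Sum>k\<in>kbox N. z k * grad_e L k x $ 1)\<bar> \<le> 2 / L * R" for N
  proof -
    have "(\<Sum>k\<in>kbox N. c k *\<^sub>R grad_e L k x) $ 1 - (\<Sum>k\<in>kbox N. z k * grad_e L k x $ 1) = (\<Sum>k\<in>kbox N. d k *\<^sub>R grad_e L k x) $ 1"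
      unfolding split[OF kbox_freqs] by simp
    also have "\<bar>\<dots>\<bar> \<le> norm (\<Sum>k\<in>kbox N. d k *\<^sub>R grad_e L k x)" by (rule component_le_norm_cart)
    also have "\<dots> \<le> 2 / L * (\<Sum>k\<in>kbox N. sqrt (mu L k) * \<bar>d k\<bar>)" by (rule drift)
    also have "\<dots> \<le> 2 / L * R" using L by (intro mult_left_mono d kbox_freqs finite_kbox) auto
    finally show ?thesis .
  qed
qed

end

theorem theorem8:
  fixes M :: "'w measure"
    and L T :: real
    and \<beta> :: "freq \<Rightarrow> real \<Rightarrow> 'w \<Rightarrow> real"
    and \<alpha> :: "real \<Rightarrow> freq \<Rightarrow> real"
    and u0 :: series
    and Z u :: "real \<Rightarrow> real \<Rightarrow> 'w \<Rightarrow> series"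
    and p t :: real
  assumes "prob_space M"
    and "L > 0" and "T > 0"
    and "prob_space.iid_wiener M \<beta>"
    and "regularization \<alpha>"
    and "in_H L 1 u0" and "in_W1inf L u0"
    and "\<And>\<epsilon>. \<epsilon> > 0 \<Longrightarrow> stoch_convolution M L T \<beta> (\<alpha> \<epsilon>) (Z \<epsilon>)"
    and "\<And>\<epsilon>. \<epsilon> > 0 \<Longrightarrow> mild_solution M L T u0 (Z \<epsilon>) (u \<epsilon>)"
    and "p \<ge> 1" and "t \<in> {0<..T}"
  shows "((\<lambda>\<epsilon>. SUP x\<in>cell L.
            \<integral>\<^sup>+ \<omega>. ennreal (norm (f (point_grad L (u \<epsilon> t \<omega>) x)) powr p) \<partial>M) \<longlongrightarrow> 0)
          (at_right 0)"
proof (rule tendsto_ennreal_zeroI)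
  fix \<eta> :: real assume \<eta>: "\<eta> > 0"
  interpret prob_space M by fact
  note L = \<open>L > 0\<close> and t = \<open>t \<in> {0<..T}\<close>
  have t': "t > 0" using t by simp
  obtain R where R: "R \<ge> 0" and dec: "\<And>Z u. mild_solution M L T u0 Z u \<Longrightarrow> (AE \<omega> in M. \<exists>d. (\<forall>k\<in>freqs. u t \<omega> k = d k + Z t \<omega> k) \<and>
      (\<forall>K. finite K \<longrightarrow> K \<subseteq> freqs \<longrightarrow> (\<Sum>k\<in>K. sqrt (mu L k) * \<bar>d k\<bar>) \<le> R))"
    using mild_solution_decomposition[OF L t \<open>in_H L 1 u0\<close>] by blast
  define R' where "R' = 2 / L * R"
  have R': "R' \<ge> 0" using R L by (simp add: R'_def)
  define m where "m = 2 / \<eta>"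
  have m: "m > 0" using \<eta> by (simp add: m_def)
  (* The threshold m and the variance w are chosen so that both error terms equal \<eta> / 2. *)
  define w where "w = (4 * (m + R') / \<eta>)\<^sup>2"
  have w: "w > 0" using \<eta> m R' by (auto simp: w_def add_pos_nonneg)
  have small: "1 / m + 2 * (m + R') / sqrt w = \<eta>"
  proof -
    have "m + R' > 0" using m R' by simp
    then have "2 * (m + R') / (4 * (m + R') / \<eta>) = \<eta> / 2" using \<eta> by (simp add: field_simps)
    moreover have "sqrt w = 4 * (m + R') / \<eta>" using \<eta> m R' by (simp add: w_def)
    ultimately show ?thesis by (simp add: m_def)
  qed
  obtain K where K: "finite K" "K \<subseteq> freqs" "\<And>x. 4 * w \<le> (\<Sum>k\<in>K. (grad_e L k x $ 1)\<^sup>2 * noise_var L t k)"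
    using gradient_variance_unbounded[OF L t'] by blast
  (* On the finite set K the regularization costs at most a factor 4 in the variance. *)
  have "\<forall>\<^sub>F \<epsilon> in at_right 0. \<forall>k\<in>K. 1 / 2 < \<alpha> \<epsilon> k"
  proof (rule eventually_ball_finite[OF K(1)], rule ballI)
    fix k assume "k \<in> K"
    then have "((\<lambda>\<epsilon>. \<alpha> \<epsilon> k) \<longlongrightarrow> 1) (at_right 0)"
      using \<open>regularization \<alpha>\<close> K(2) unfolding regularization_def by blast
    then show "\<forall>\<^sub>F \<epsilon> in at_right 0. 1 / 2 < \<alpha> \<epsilon> k" by (rule order_tendstoD) simp
  qed
  moreover have "\<forall>\<^sub>F \<epsilon> :: real in at_right 0. \<epsilon> > 0" by (rule eventually_at_right_less)
  ultimately show "\<forall>\<^sub>F \<epsilon> in at_right 0. (SUP x\<in>cell L.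
            \<integral>\<^sup>+ \<omega>. ennreal (norm (f (point_grad L (u \<epsilon> t \<omega>) x)) powr p) \<partial>M) \<le> ennreal \<eta>"
  proof eventually_elim
    case (elim \<epsilon>)
    have sol: "mild_solution M L T u0 (Z \<epsilon>) (u \<epsilon>)" using assms(9) elim(2) .
    obtain \<xi> where \<xi>: "gaussian_family \<xi> (noise_var L t)"
      and Z\<xi>: "\<And>k \<omega>. k \<in> freqs \<Longrightarrow> \<omega> \<in> space M \<Longrightarrow> Z \<epsilon> t \<omega> k = \<alpha> \<epsilon> k * \<xi> k \<omega>"
      using stoch_convolution_gaussian[OF L assms(4) assms(8)[OF elim(2)] t] by blast
    have "\<exists>\<delta>>0. \<exists>C>0. \<forall>k\<in>freqs. \<bar>\<alpha> \<epsilon> k\<bar> \<le> C * fabs k powr (- \<delta>)"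
      using \<open>regularization \<alpha>\<close> elim(2) unfolding regularization_def by blast
    then obtain \<delta> C where \<delta>: "\<delta> > 0" "C > 0" "\<And>k. k \<in> freqs \<Longrightarrow> \<bar>\<alpha> \<epsilon> k\<bar> \<le> C * fabs k powr (- \<delta>)"
      by blast
    have reg: "AE \<omega> in M. (\<lambda>k. \<bar>\<alpha> \<epsilon> k * \<xi> k \<omega>\<bar>) summable_on freqs \<and>
       (\<exists>B. summable B \<and> (\<forall>n x. norm (\<Sum>k\<in>shell n. (\<alpha> \<epsilon> k * \<xi> k \<omega>) *\<^sub>R grad_e L k x) \<le> B n))"
      by (rule noise_regular[OF L t' \<xi> \<delta>(1,2)]) (rule \<delta>(3))
    show ?case
    proof (rule SUP_least)
      fix x assume "x \<in> cell L"
      define v where "v = (\<lambda>N. \<Sum>k\<in>kbox N. (\<alpha> \<epsilon> k * grad_e L k x $ 1)\<^sup>2 * noise_var L t k)"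
      define S where "S = (\<lambda>N \<omega>. \<Sum>k\<in>kbox N. (\<alpha> \<epsilon> k * grad_e L k x $ 1) * \<xi> k \<omega>)"
      have g: "gaussian (v N) (S N)" for N
        using \<xi> kbox_freqs[of N] unfolding gaussian_family_def v_def S_def by simp
      obtain N0 where N0: "K \<subseteq> kbox N0" using finite_subset_kbox[OF K(1,2)] by blast
      have "w \<le> v N" if "N \<ge> N0" for N
      proof -
        have sub: "K \<subseteq> kbox N" using subset_trans[OF N0 kbox_mono[OF that]] .
        have "4 * w \<le> (\<Sum>k\<in>K. (grad_e L k x $ 1)\<^sup>2 * noise_var L t k)" by (rule K(3))
        also have "\<dots> \<le> (\<Sum>k\<in>K. 4 * ((\<alpha> \<epsilon> k * grad_e L k x $ 1)\<^sup>2 * noise_var L t k))"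
        proof (rule sum_mono)
          fix k assume "k \<in> K"
          then have "(1 / 2)\<^sup>2 \<le> (\<alpha> \<epsilon> k)\<^sup>2" using elim(1) by (intro power_mono) (auto intro: less_imp_le)
          then have "1 \<le> 4 * (\<alpha> \<epsilon> k)\<^sup>2" by (simp add: power_divide)
          then have "1 * ((grad_e L k x $ 1)\<^sup>2 * noise_var L t k) \<le> 4 * (\<alpha> \<epsilon> k)\<^sup>2 * ((grad_e L k x $ 1)\<^sup>2 * noise_var L t k)"
            using noise_var_nonneg[of t L k] t' by (intro mult_right_mono) auto
          then show "(grad_e L k x $ 1)\<^sup>2 * noise_var L t k \<le> 4 * ((\<alpha> \<epsilon> k * grad_e L k x $ 1)\<^sup>2 * noise_var L t k)"
            by (simp add: power_mult_distrib mult.assoc)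
        qed
        also have "\<dots> \<le> (\<Sum>k\<in>kbox N. 4 * ((\<alpha> \<epsilon> k * grad_e L k x $ 1)\<^sup>2 * noise_var L t k))"
          using sub noise_var_nonneg[of t L] t' by (intro sum_mono2) auto
        also have "\<dots> = 4 * v N" by (simp add: v_def sum_distrib_left)
        finally show ?thesis by simp
      qed
      then have ev: "\<forall>\<^sub>F N in sequentially. w \<le> v N" by (rule eventually_sequentiallyI)
      have "AE \<omega> in M. \<exists>Y. Y \<longlonglongrightarrow> point_grad L (u \<epsilon> t \<omega>) x \<and> (\<forall>N. \<bar>Y N $ 1 - S N \<omega>\<bar> \<le> R')"
        using dec[OF sol] reg AE_space
      proof eventually_elim
        case (elim \<omega>)
        obtain d where d: "\<And>k. k \<in> freqs \<Longrightarrow> u \<epsilon> t \<omega> k = d k + Z \<epsilon> t \<omega> k"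
          "\<And>K. finite K \<Longrightarrow> K \<subseteq> freqs \<Longrightarrow> (\<Sum>k\<in>K. sqrt (mu L k) * \<bar>d k\<bar>) \<le> R" using elim(1) by blast
        obtain B where B: "summable B" "\<And>n x. norm (\<Sum>k\<in>shell n. (\<alpha> \<epsilon> k * \<xi> k \<omega>) *\<^sub>R grad_e L k x) \<le> B n"
          using elim(2) by blast
        have "S N \<omega> = (\<Sum>k\<in>kbox N. \<alpha> \<epsilon> k * \<xi> k \<omega> * grad_e L k x $ 1)" for N
          unfolding S_def by (simp add: mult_ac)
        moreover have "u \<epsilon> t \<omega> k = d k + \<alpha> \<epsilon> k * \<xi> k \<omega>" if "k \<in> freqs" for k
          using d(1)[OF that] Z\<xi>[OF that elim(3)] by simp
        ultimately show ?case
          using point_grad_decomposition[OF L R d(2) conjunct1[OF elim(2)] B, of "u \<epsilon> t \<omega>" x]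
          by (simp add: R'_def)
      qed
      then have "(\<integral>\<^sup>+ \<omega>. ennreal (norm (f (point_grad L (u \<epsilon> t \<omega>) x)) powr p) \<partial>M) \<le> ennreal (1 / m + 2 * (m + R') / sqrt w)"
        by (rule expectation_f_le_small_ball[OF m \<open>p \<ge> 1\<close> R' g w ev])
      then show "(\<integral>\<^sup>+ \<omega>. ennreal (norm (f (point_grad L (u \<epsilon> t \<omega>) x)) powr p) \<partial>M) \<le> ennreal \<eta>"
        unfolding small .
    qed
  qed
qed

end
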